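(* Let $X$ be a square integrable complex random field on $SU(2)\cong S^3$, with expansion $X=\sum_{\ell,m,s}a^\ell_{m,s}\phi^\ell_{m,s}$ in the orthonormal basis of hyperspherical harmonics, and for each $\ell\in\frac12\mathbb{N}$ let $X^\ell=\sum_{m,s=-\ell}^{\ell}a^\ell_{m,s}\phi^\ell_{m,s}$ be its degree $2\ell$ component. Then $X$ is left-invariant (respectively right-invariant, bi-invariant) if and only if the fields $(X^\ell)_{\ell\in\frac12\mathbb{N}}$ are jointly left-invariant (respectively jointly right-invariant, jointly bi-invariant). Moreover, in this case the fields $X^\ell$ are pairwise uncorrelated.
   Context: $\frac12\mathbb{N}=\{0,\frac12,1,\dots\}$; indices $m,s$ run over $\{-\ell,-\ell+1,\dots,\ell\}$. Elements of $SU(2)$ are $h(\alpha,\beta)=\begin{pmatrix}\alpha&-\overline\beta\\ \beta&\overline\alpha\end{pmatrix}$ with $|\alpha|^2+|\beta|^2=1$; $SU(2)$ carries the metric of the round 3-sphere of radius 2 (volume $16\pi^2$), and $L^2(SU(2))$ is taken with respect to this volume. Wigner functions: with $\psi^\ell_m(z_0,z_1)=\binom{2\ell}{\ell+m}^{1/2}z_0^{\ell+m}z_1^{\ell-m}$, the functions $D^\ell_{m,s}:SU(2)\to\mathbb{C}$ are defined by $\sum_m\psi^\ell_m(z_0,z_1)D^\ell_{m,s}(h(\alpha,\beta))=\psi^\ell_s(\overline\alpha z_0+\overline\beta z_1,-\beta z_0+\alpha z_1)$ for all $z_0,z_1\in\mathbb{C}$. The functions $\phi^\ell_{m,s}=\frac{\sqrt{2\ell+1}}{4\pi}D^\ell_{m,s}$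 form an orthonormal basis of $L^2(SU(2))$. A random field is a measurable $X:\Omega\times SU(2)\to\mathbb{C}$, with $\Omega$ a probability space; it is square integrable if $X(\omega,\cdot)\in L^2(SU(2))$ almost surely. $X$ is left-invariant if $X(g^{-1}\,\cdot)$ has the same law as $X$ for all $g\in SU(2)$, right-invariant if $X(\cdot\, g)$ has the same law as $X$ for all $g$, bi-invariant if $X(g^{-1}\cdot g')$ has the same law as $X$ for all $g,g'$. A collection of fields is jointly invariant if the joint law of the collection is unchanged when the same transformation is applied to all fields. Two fields $Y,Z$ are uncorrelated if for all $g,g'$ one has $\mathbb{E}\{Y(g)Z(g')\}=\mathbb{E}Y(g)\,\mathbb{E}Z(g')$ and $\mathbb{E}\{Y(g)\overline{Z(g')}\}=\mathbb{E}Y(g)\,\overline{\mathbb{E}Z(g')}$. *)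

theory Defs
  imports "HOL-Probability.Probability"
begin

section \<open>The group SU(2) and its volume\<close>

definition su2_mat :: "complex \<Rightarrow> complex \<Rightarrow> complex^2^2" where
  "su2_mat \<alpha> \<beta> = vector [vector [\<alpha>, - cnj \<beta>], vector [\<beta>, cnj \<alpha>]]"

definition SU2 :: "(complex^2^2) set" where
  "SU2 = {su2_mat \<alpha> \<beta> | \<alpha> \<beta>. (cmod \<alpha>)\<^sup>2 + (cmod \<beta>)\<^sup>2 = 1}"

text \<open>
  The Riemannian volume of the round 3-sphere of radius \<open>R = 2\<close>, carried over to SU(2) by
  \<open>(R * \<alpha>, R * \<beta>) \<mapsto> su2_mat \<alpha> \<beta>\<close>.  By integration in polar coordinates, a Borel subset \<open>A\<close> of
  the sphere of radius \<open>R\<close> in a 4-dimensional Euclidean space has area \<open>4 / R = 2\<close> times the Lebesgue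
  measure of the cone \<open>{t *\<^sub>R x | t x. 0 < t \<and> t < 1 \<and> x \<in> A}\<close>; this cone is the preimage of \<open>A\<close>
  under the radial projection of the punctured ball of radius \<open>R\<close>.
\<close>

definition radial_proj :: "complex \<times> complex \<Rightarrow> complex^2^2" where
  "radial_proj z = su2_mat (fst z / of_real (norm z)) (snd z / of_real (norm z))"

definition su2_volume :: "(complex^2^2) measure" where
  "su2_volume = scale_measure 2
     (distr (restrict_space lborel (ball 0 2 - {0})) (restrict_space borel SU2) radial_proj)"

lemma su2_mat_nth [simp]:
  "su2_mat \<alpha> \<beta> $ 1 $ 1 = \<alpha>" "su2_mat \<alpha> \<beta> $ 1 $ 2 = - cnj \<beta>"
  "su2_mat \<alpha> \<beta> $ 2 $ 1 = \<beta>" "su2_mat \<alpha> \<beta> $ 2 $ 2 = cnj \<alpha>"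
  by (simp_all add: su2_mat_def)

lemma radial_proj_in_SU2: "z \<noteq> 0 \<Longrightarrow> radial_proj z \<in> SU2"
proof -
  assume "z \<noteq> 0"
  hence "norm z > 0" by simp
  have "(norm z)\<^sup>2 = (cmod (fst z))\<^sup>2 + (cmod (snd z))\<^sup>2"
    by (simp add: norm_prod_def)
  hence "(cmod (fst z / of_real (norm z)))\<^sup>2 + (cmod (snd z / of_real (norm z)))\<^sup>2 = 1"
    using \<open>norm z > 0\<close> by (simp add: norm_divide power_divide prod_eq_iff flip: add_divide_distrib)
  thus ?thesis unfolding SU2_def radial_proj_def by blast
qed

lemma continuous_on_su2_mat:
  assumes "continuous_on S f" "continuous_on S g"
  shows "continuous_on S (\<lambda>x. su2_mat (f x) (g x))"
proof -
  have eq: "su2_mat a b = (\<chi> i j. if i = 1 then (if j = 1 then a else - cnj b)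
      else (if j = 1 then b else cnj a))" for a b
    by (simp add: vec_eq_iff forall_2)
  have "continuous_on S (\<lambda>x. if i = 1 then (if j = 1 then f x else - cnj (g x))
      else (if j = 1 then g x else cnj (f x)))" for i j :: 2
    by (cases "i = 1"; cases "j = 1") (auto intro!: continuous_intros assms)
  thus ?thesis unfolding eq by (intro continuous_on_vec_lambda)
qed

lemma radial_proj_measurable [measurable]:
  "radial_proj \<in> restrict_space lborel (ball 0 2 - {0}) \<rightarrow>\<^sub>M restrict_space borel SU2"
proof (rule measurable_restrict_space2)
  show "radial_proj \<in> space (restrict_space lborel (ball 0 2 - {0})) \<rightarrow> SU2"
    by (auto simp: space_restrict_space intro!: radial_proj_in_SU2)
  have "continuous_on (ball 0 2 - {0}) radial_proj"
    unfolding radial_proj_def by (intro continuous_on_su2_mat continuous_intros) auto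
  thus "radial_proj \<in> borel_measurable (restrict_space lborel (ball 0 2 - {0}))"
    using borel_measurable_continuous_on_restrict measurable_cong_sets[OF
        sets_restrict_space_cong[OF sets_lborel] refl] by blast
qed

lemma space_su2_volume [simp]: "space su2_volume = SU2"
  by (simp add: su2_volume_def space_restrict_space space_scale_measure)

lemma su2_volume_total: "emeasure su2_volume SU2 = ennreal (16 * pi\<^sup>2)"
proof -
  let ?B = "ball (0 :: complex \<times> complex) 2 - {0}"
  have S: "SU2 \<in> sets (restrict_space borel SU2)"
    using sets.top[of "restrict_space borel SU2"] by (simp add: space_restrict_space)
  have "emeasure (distr (restrict_space lborel ?B) (restrict_space borel SU2) radial_proj) SU2
        = emeasure (restrict_space lborel ?B) (radial_proj -` SU2 \<inter> ?B)"
    using S by (subst emeasure_distr) (auto simp: space_restrict_space)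
  also have "radial_proj -` SU2 \<inter> ?B = ?B" using radial_proj_in_SU2 by auto
  also have "emeasure (restrict_space lborel ?B) ?B = emeasure lborel ?B"
    by (subst emeasure_restrict_space) auto
  also have "\<dots> = emeasure lborel (ball (0 :: complex \<times> complex) 2)"
    by (rule emeasure_Diff_null_set) (auto simp: null_sets_def)
  also have "\<dots> = ennreal (8 * pi\<^sup>2)"
    by (subst emeasure_ball) (simp_all add: unit_ball_vol_4)
  finally have *: "emeasure (distr (restrict_space lborel ?B) (restrict_space borel SU2) radial_proj) SU2
      = ennreal (8 * pi\<^sup>2)" .
  have "2 * ennreal (8 * pi\<^sup>2) = ennreal (2 * (8 * pi\<^sup>2))"
    using ennreal_mult[of 2 "8 * pi\<^sup>2"] by simp
  with * show ?thesis by (simp add: su2_volume_def)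
qed


section \<open>Wigner functions and hyperspherical harmonics\<close>

text \<open>
  The half-integer degree \<open>\<ell>\<close> is encoded by the natural number \<open>n = 2 \<ell>\<close>, and an index
  \<open>m \<in> {-\<ell>, \<dots>, \<ell>}\<close> by the natural number \<open>\<ell> + m \<in> {0, \<dots>, n}\<close> (so that \<open>\<ell> - m\<close> is \<open>n\<close> minus this number).
\<close>

definition psi :: "nat \<Rightarrow> nat \<Rightarrow> complex \<Rightarrow> complex \<Rightarrow> complex" where
  "psi n m z0 z1 = of_real (sqrt (real (n choose m))) * z0 ^ m * z1 ^ (n - m)"

text \<open>
  The Wigner functions are the coefficients in the defining identity (for fixed \<open>n\<close>, \<open>s\<close>, \<open>g\<close>);
  existence and uniqueness are shown below.  The clause \<open>D m = 0\<close> for \<open>m > n\<close> only fixes the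
  values at indices that are not used.
\<close>

definition wigner_D :: "nat \<Rightarrow> nat \<Rightarrow> nat \<Rightarrow> complex^2^2 \<Rightarrow> complex" where
  "wigner_D n m s g =
     (THE D. (\<forall>m>n. D m = 0) \<and>
        (\<forall>z0 z1. (\<Sum>m\<le>n. psi n m z0 z1 * D m) =
           psi n s (cnj (g$1$1) * z0 + cnj (g$2$1) * z1) (- (g$2$1) * z0 + g$1$1 * z1))) m"

definition hyp_harmonic :: "nat \<Rightarrow> nat \<Rightarrow> nat \<Rightarrow> complex^2^2 \<Rightarrow> complex" where
  "hyp_harmonic n m s g = of_real (sqrt (real (n + 1)) / (4 * pi)) * wigner_D n m s g"

lemma binary_form_expand:
  fixes A B C E :: complex
  shows "\<exists>c. \<forall>z0 z1. (A * z0 + B * z1) ^ j * (C * z0 + E * z1) ^ k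
           = (\<Sum>i\<le>j + k. c i * z0 ^ i * z1 ^ (j + k - i))"
proof -
  have step: "\<exists>c'. \<forall>z0 z1. (P * z0 + Q * z1) * f z0 z1 = (\<Sum>i\<le>Suc n. c' i * z0 ^ i * z1 ^ (Suc n - i))"
    if "\<forall>z0 z1. f z0 z1 = (\<Sum>i\<le>n. c i * z0 ^ i * z1 ^ (n - i))"
    for n c P Q and f :: "complex \<Rightarrow> complex \<Rightarrow> complex"
  proof (intro exI allI)
    fix z0 z1 :: complex
    have 1: "P * z0 * f z0 z1 =
        (\<Sum>i\<le>Suc n. (if i = 0 then 0 else P * c (i - 1)) * z0 ^ i * z1 ^ (Suc n - i))"
      by (subst sum.atMost_Suc_shift) (simp add: that sum_distrib_left mult_ac)
    have 2: "Q * z1 * f z0 z1 =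
        (\<Sum>i\<le>Suc n. (if i = Suc n then 0 else Q * c i) * z0 ^ i * z1 ^ (Suc n - i))"
      by (simp add: that sum_distrib_left Suc_diff_le mult_ac)
    show "(P * z0 + Q * z1) * f z0 z1 =
        (\<Sum>i\<le>Suc n. ((if i = 0 then 0 else P * c (i - 1)) + (if i = Suc n then 0 else Q * c i))
           * z0 ^ i * z1 ^ (Suc n - i))"
      unfolding ring_distribs 1 2 sum.distrib ..
  qed
  have base: "\<exists>c. \<forall>z0 z1. (C * z0 + E * z1) ^ k = (\<Sum>i\<le>k. c i * z0 ^ i * z1 ^ (k - i))"
  proof (induction k)
    case 0
    show ?case by (intro exI[of _ "\<lambda>_. 1"]) simp
  next
    case (Suc k)
    then obtain c where "\<forall>z0 z1. (C * z0 + E * z1) ^ k = (\<Sum>i\<le>k. c i * z0 ^ i * z1 ^ (k - i))" ..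
    from step[OF this] show ?case by simp
  qed
  show ?thesis
  proof (induction j)
    case 0
    from base show ?case by simp
  next
    case (Suc j)
    then obtain c where "\<forall>z0 z1. (A * z0 + B * z1) ^ j * (C * z0 + E * z1) ^ k
           = (\<Sum>i\<le>j + k. c i * z0 ^ i * z1 ^ (j + k - i))" ..
    from step[OF this] show ?case by (simp add: mult.assoc)
  qed
qed

lemma wigner_D_ex1:
  fixes g :: "complex^2^2"
  assumes "s \<le> n"
  shows "\<exists>!D. (\<forall>m>n. D m = 0) \<and>
     (\<forall>z0 z1. (\<Sum>m\<le>n. psi n m z0 z1 * D m) =
        psi n s (cnj (g$1$1) * z0 + cnj (g$2$1) * z1) (- (g$2$1) * z0 + g$1$1 * z1))"
proof -
  obtain c where c: "\<And>z0 z1. (cnj (g$1$1) * z0 + cnj (g$2$1) * z1) ^ s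
        * (- (g$2$1) * z0 + g$1$1 * z1) ^ (n - s) = (\<Sum>i\<le>n. c i * z0 ^ i * z1 ^ (n - i))"
    using binary_form_expand[of "cnj (g$1$1)" "cnj (g$2$1)" s "- (g$2$1)" "g$1$1" "n - s"] assms
    by auto
  define w where "w m = complex_of_real (sqrt (real (n choose m)))" for m
  have w: "w m \<noteq> 0" if "m \<le> n" for m
    using that by (simp add: w_def)
  define D where "D m = (if m \<le> n then w s * c m / w m else 0)" for m
  have ex: "(\<Sum>m\<le>n. psi n m z0 z1 * D m) =
        psi n s (cnj (g$1$1) * z0 + cnj (g$2$1) * z1) (- (g$2$1) * z0 + g$1$1 * z1)" for z0 z1
  proof -
    have "(\<Sum>m\<le>n. psi n m z0 z1 * D m) = (\<Sum>m\<le>n. w s * (c m * z0 ^ m * z1 ^ (n - m)))"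
      by (intro sum.cong) (auto simp: psi_def D_def w w_def[symmetric])
    also have "\<dots> = w s * ((cnj (g$1$1) * z0 + cnj (g$2$1) * z1) ^ s
        * (- (g$2$1) * z0 + g$1$1 * z1) ^ (n - s))"
      by (simp only: c sum_distrib_left)
    finally show ?thesis by (simp add: psi_def mult.assoc w_def[symmetric])
  qed
  have zero: "\<forall>m>n. D m = 0" by (simp add: D_def)
  have uniq: "F = D"
    if F: "\<forall>m>n. F m = 0" "\<forall>z0 z1. (\<Sum>m\<le>n. psi n m z0 z1 * F m) = (\<Sum>m\<le>n. psi n m z0 z1 * D m)" for F
  proof
    fix m
    have "(\<Sum>i\<le>n. (w i * F i) * z ^ i) = (\<Sum>i\<le>n. (w i * D i) * z ^ i)" for z
      using F(2)[rule_format, of z 1] by (simp add: psi_def mult_ac w_def[symmetric])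
    hence "\<forall>i\<le>n. w i * F i = w i * D i" by (subst polyfun_eq_coeffs[symmetric]) blast
    hence "w m * F m = w m * D m" if "m \<le> n" using that by blast
    hence "F m = D m" if "m \<le> n" using that w[OF that] mult_left_cancel by blast
    moreover have "F m = D m" if "\<not> m \<le> n"
      using F(1) that by (simp add: D_def)
    ultimately show "F m = D m" by blast
  qed
  show ?thesis
  proof (rule ex1I[of _ D])
    show "(\<forall>m>n. D m = 0) \<and> (\<forall>z0 z1. (\<Sum>m\<le>n. psi n m z0 z1 * D m) =
        psi n s (cnj (g$1$1) * z0 + cnj (g$2$1) * z1) (- (g$2$1) * z0 + g$1$1 * z1))"
      using zero ex by blast
  next
    fix F
    assume F: "(\<forall>m>n. F m = 0) \<and> (\<forall>z0 z1. (\<Sum>m\<le>n. psi n m z0 z1 * F m) =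
        psi n s (cnj (g$1$1) * z0 + cnj (g$2$1) * z1) (- (g$2$1) * z0 + g$1$1 * z1))"
    show "F = D"
      by (rule uniq) (use F ex in simp_all)
  qed
qed

lemma wigner_D_eq:
  assumes "s \<le> n"
  shows "(\<Sum>m\<le>n. psi n m z0 z1 * wigner_D n m s g) =
     psi n s (cnj (g$1$1) * z0 + cnj (g$2$1) * z1) (- (g$2$1) * z0 + g$1$1 * z1)"
  using theI'[OF wigner_D_ex1[OF assms, of g]] unfolding wigner_D_def by blast


section \<open>Random fields and their laws\<close>

definition L2 :: "(complex^2^2 \<Rightarrow> complex) set" where
  "L2 = {f \<in> borel_measurable su2_volume. integrable su2_volume (\<lambda>g. (cmod (f g))\<^sup>2)}"

definition L2_dist :: "(complex^2^2 \<Rightarrow> complex) \<Rightarrow> (complex^2^2 \<Rightarrow> complex) \<Rightarrow> real" where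
  "L2_dist f h = sqrt (\<integral>g. (cmod (f g - h g))\<^sup>2 \<partial>su2_volume)"

definition L2_open :: "(complex^2^2 \<Rightarrow> complex) set \<Rightarrow> bool" where
  "L2_open U \<longleftrightarrow> U \<subseteq> L2 \<and> (\<forall>f\<in>U. \<exists>\<epsilon>>0. \<forall>h\<in>L2. L2_dist f h < \<epsilon> \<longrightarrow> h \<in> U)"

text \<open>
  We work with square integrable functions rather than with classes modulo equality almost
  everywhere.  Every open set is a union of such classes, so the sigma-algebra below is the
  preimage of the Borel sigma-algebra of the quotient Hilbert space, and measures on the two
  correspond to each other.
\<close>

definition L2_borel :: "(complex^2^2 \<Rightarrow> complex) measure" where
  "L2_borel = sigma L2 {U. L2_open U}"

definition random_field :: "'w measure \<Rightarrow> ('w \<Rightarrow> complex^2^2 \<Rightarrow> complex) \<Rightarrow> bool" where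
  "random_field M X \<longleftrightarrow> (\<lambda>(\<omega>, g). X \<omega> g) \<in> borel_measurable (M \<Otimes>\<^sub>M su2_volume)"

definition square_integrable_field :: "'w measure \<Rightarrow> ('w \<Rightarrow> complex^2^2 \<Rightarrow> complex) \<Rightarrow> bool" where
  "square_integrable_field M X \<longleftrightarrow> (AE \<omega> in M. X \<omega> \<in> L2)"

text \<open>
  A square integrable field is a random element of \<open>L2\<close> only almost surely; on the
  exceptional null set it is replaced by \<open>0\<close>, which does not affect its law.
\<close>

definition L2_version :: "(complex^2^2 \<Rightarrow> complex) \<Rightarrow> (complex^2^2 \<Rightarrow> complex)" where
  "L2_version f = (if f \<in> L2 then f else (\<lambda>_. 0))"

definition law :: "'w measure \<Rightarrow> ('w \<Rightarrow> complex^2^2 \<Rightarrow> complex) \<Rightarrow> (complex^2^2 \<Rightarrow> complex) measure" where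
  "law M X = distr M L2_borel (\<lambda>\<omega>. L2_version (X \<omega>))"

definition joint_law ::
    "'w measure \<Rightarrow> 'i set \<Rightarrow> ('i \<Rightarrow> 'w \<Rightarrow> complex^2^2 \<Rightarrow> complex) \<Rightarrow> ('i \<Rightarrow> complex^2^2 \<Rightarrow> complex) measure" where
  "joint_law M I Y = distr M (\<Pi>\<^sub>M i\<in>I. L2_borel) (\<lambda>\<omega>. \<lambda>i\<in>I. L2_version (Y i \<omega>))"


section \<open>Invariance and correlation\<close>

definition left_translations :: "(complex^2^2 \<Rightarrow> complex^2^2) set" where
  "left_translations = {\<lambda>h. matrix_inv g ** h | g. g \<in> SU2}"

definition right_translations :: "(complex^2^2 \<Rightarrow> complex^2^2) set" where
  "right_translations = {\<lambda>h. h ** g | g. g \<in> SU2}"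

definition bi_translations :: "(complex^2^2 \<Rightarrow> complex^2^2) set" where
  "bi_translations = {\<lambda>h. matrix_inv g ** h ** g' | g g'. g \<in> SU2 \<and> g' \<in> SU2}"

definition invariant ::
    "(complex^2^2 \<Rightarrow> complex^2^2) set \<Rightarrow> 'w measure \<Rightarrow> ('w \<Rightarrow> complex^2^2 \<Rightarrow> complex) \<Rightarrow> bool" where
  "invariant T M X \<longleftrightarrow> (\<forall>\<tau>\<in>T. law M (\<lambda>\<omega> h. X \<omega> (\<tau> h)) = law M X)"

definition jointly_invariant ::
    "(complex^2^2 \<Rightarrow> complex^2^2) set \<Rightarrow> 'w measure \<Rightarrow> 'i set \<Rightarrow>
     ('i \<Rightarrow> 'w \<Rightarrow> complex^2^2 \<Rightarrow> complex) \<Rightarrow> bool" where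
  "jointly_invariant T M I Y \<longleftrightarrow> (\<forall>\<tau>\<in>T. joint_law M I (\<lambda>i \<omega> h. Y i \<omega> (\<tau> h)) = joint_law M I Y)"

text \<open>
  Expectations are Bochner integrals, so an expectation that does not exist has the value \<open>0\<close>;
  no moment assumption is built into the definition.
\<close>

definition uncorrelated ::
    "'w measure \<Rightarrow> ('w \<Rightarrow> complex^2^2 \<Rightarrow> complex) \<Rightarrow> ('w \<Rightarrow> complex^2^2 \<Rightarrow> complex) \<Rightarrow> bool" where
  "uncorrelated M Y Z \<longleftrightarrow> (\<forall>g\<in>SU2. \<forall>g'\<in>SU2.
     (\<integral>\<omega>. Y \<omega> g * Z \<omega> g' \<partial>M) = (\<integral>\<omega>. Y \<omega> g \<partial>M) * (\<integral>\<omega>. Z \<omega> g' \<partial>M) \<and>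
     (\<integral>\<omega>. Y \<omega> g * cnj (Z \<omega> g') \<partial>M) = (\<integral>\<omega>. Y \<omega> g \<partial>M) * cnj (\<integral>\<omega>. Z \<omega> g' \<partial>M))"


section \<open>Expansion in hyperspherical harmonics\<close>

text \<open>The coefficients of an expansion in an orthonormal basis are the \<open>L\<^sup>2\<close> inner products with it.\<close>

definition coefficient :: "('w \<Rightarrow> complex^2^2 \<Rightarrow> complex) \<Rightarrow> nat \<Rightarrow> nat \<Rightarrow> nat \<Rightarrow> 'w \<Rightarrow> complex" where
  "coefficient X n m s \<omega> = (\<integral>g. X \<omega> g * cnj (hyp_harmonic n m s g) \<partial>su2_volume)"

definition component ::
    "('w \<Rightarrow> complex^2^2 \<Rightarrow> complex) \<Rightarrow> nat \<Rightarrow> 'w \<Rightarrow> complex^2^2 \<Rightarrow> complex" where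
  "component X n \<omega> g = (\<Sum>m\<le>n. \<Sum>s\<le>n. coefficient X n m s \<omega> * hyp_harmonic n m s g)"

end

theory Submission
  imports Defs
begin

text \<open>
  The law of a random element of \<open>L\<^sup>2\<close> is determined by the joint law of its Fourier coefficients, because
  by completeness of the harmonics (Stone-Weierstrass and Parseval) the Borel sets of \<open>L\<^sup>2\<close> are generated
  by the coefficients. The coefficients of \<open>X\<close> and those of the family of its components are measurable
  functions of each other, and the projection to a degree commutes with translations since its kernel is
  a multiple of the character at \<open>g h\<inverse>\<close>. Hence each translation preserves the law of \<open>X\<close> iff it preserves
  the joint law of the components.

  For the correlations, left (or right) invariance makes \<open>E (X\<^sup>n(k g) X\<^sup>n\<^sup>'(k g'))\<close> independent of \<open>k\<close>; averaging
  over \<open>k\<close> inside the expectation gives an inner product of matrix coefficients of different degrees,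
  which vanishes by Schur orthogonality.
\<close>


text \<open>Three obstacles shape the proof. A law on \<open>L2\<close> cannot see values at single
  points, while \<open>uncorrelated\<close> is a statement about single points. The bridge is that a
  component is a finite sum of continuous harmonics, so its value at a point is a Borel function of
  the coefficient vector, whose law is controlled. Next, no moments are assumed. Invariance makes
  integrability of a product of components independent of the translation, so either Fubini applies
  or every expectation in question is 0 by convention; the result is 0 in both cases. Means of
  positive degree vanish in the same way, by orthogonality to the constants, and two distinct
  degrees are not both 0, so the product of the means is 0 as well. Finally, density asks for a span
  that is stable under multiplication by polynomials in the matrix entries. Stability under a single
  entry and under conjugation is enough, and a recursion between neighbouring degrees provides
  it.\<close>

section \<open>The group law, inverses and compactness of SU(2)\<close>

lemma su2_mat_mult: "su2_mat a b ** su2_mat c d = su2_mat (a * c - cnj b * d) (b * c + cnj a * d)"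
  by (simp add: vec_eq_iff forall_2 matrix_matrix_mult_def sum_2 algebra_simps)

lemma SU2_norm_eq: "(cmod a)\<^sup>2 + (cmod b)\<^sup>2 = 1 \<longleftrightarrow> a * cnj a + b * cnj b = 1"
  by (simp only: complex_norm_square[symmetric] of_real_add[symmetric] of_real_eq_1_iff)

lemma SU2_iff: "g \<in> SU2 \<longleftrightarrow> (\<exists>a b. g = su2_mat a b \<and> a * cnj a + b * cnj b = 1)"
  by (auto simp: SU2_def SU2_norm_eq)

lemma SU2_I: "a * cnj a + b * cnj b = 1 \<Longrightarrow> su2_mat a b \<in> SU2"
  by (auto simp: SU2_iff)

lemma SU2_E:
  assumes "g \<in> SU2"
  obtains a b where "g = su2_mat a b" "a * cnj a + b * cnj b = 1"
  using assms by (auto simp: SU2_iff)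

lemma SU2_mult:
  assumes "g \<in> SU2" "h \<in> SU2"
  shows "g ** h \<in> SU2"
proof -
  obtain a b where g: "g = su2_mat a b" "a * cnj a + b * cnj b = 1" using assms(1) by (rule SU2_E)
  obtain c d where h: "h = su2_mat c d" "c * cnj c + d * cnj d = 1" using assms(2) by (rule SU2_E)
  have "(a * c - cnj b * d) * cnj (a * c - cnj b * d) + (b * c + cnj a * d) * cnj (b * c + cnj a * d)
      = (a * cnj a + b * cnj b) * (c * cnj c + d * cnj d)"
    by (simp add: algebra_simps)
  thus ?thesis unfolding g(1) h(1) su2_mat_mult by (intro SU2_I) (simp only: g(2) h(2) mult_1_left)
qed

lemma SU2_one: "mat 1 \<in> SU2"
proof -
  have "mat 1 = su2_mat 1 0" by (simp add: vec_eq_iff forall_2 mat_def)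
  thus ?thesis using SU2_I[of 1 0] by simp
qed

text \<open>\<open>matrix_inv\<close> chooses some two-sided inverse. The adjoint matrix is one, and
  inverses are unique.\<close>

lemma SU2_matrix_inv:
  assumes "a * cnj a + b * cnj b = 1"
  shows "matrix_inv (su2_mat a b) = su2_mat (cnj a) (- b)"
proof -
  let ?g = "su2_mat a b" and ?h = "su2_mat (cnj a) (- b)"
  have one: "mat 1 = su2_mat 1 0" by (simp add: vec_eq_iff forall_2 mat_def)
  have 1: "?g ** ?h = mat 1" "?h ** ?g = mat 1"
    using assms by (simp_all add: su2_mat_mult one algebra_simps)
  have "?g ** matrix_inv ?g = mat 1 \<and> matrix_inv ?g ** ?g = mat 1"
    unfolding matrix_inv_def by (rule someI[of _ ?h]) (use 1 in simp)
  thus ?thesis by (metis 1(2) matrix_mul_assoc matrix_mul_lid matrix_mul_rid)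
qed

lemma SU2_inv:
  assumes "g \<in> SU2"
  shows "matrix_inv g \<in> SU2" "matrix_inv g ** g = mat 1" "g ** matrix_inv g = mat 1"
    "matrix_inv (matrix_inv g) = g"
proof -
  obtain a b where g: "g = su2_mat a b" "a * cnj a + b * cnj b = 1" using assms by (rule SU2_E)
  have g': "cnj a * cnj (cnj a) + - b * cnj (- b) = 1" using g(2) by (simp add: mult.commute)
  have one: "mat 1 = su2_mat 1 0" by (simp add: vec_eq_iff forall_2 mat_def)
  show "matrix_inv g \<in> SU2" using SU2_matrix_inv[OF g(2)] SU2_I[OF g'] by (simp add: g(1))
  show "matrix_inv g ** g = mat 1" "g ** matrix_inv g = mat 1"
    using g(2) by (simp_all add: SU2_matrix_inv[OF g(2)] g(1) su2_mat_mult one algebra_simps)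
  show "matrix_inv (matrix_inv g) = g"
    using SU2_matrix_inv[OF g'] by (simp add: SU2_matrix_inv[OF g(2)] g(1))
qed

lemma compact_SU2: "compact SU2"
proof -
  have "SU2 = (\<lambda>z. su2_mat (fst z) (snd z)) ` sphere (0 :: complex \<times> complex) 1"
  proof (intro equalityI subsetI)
    fix g assume "g \<in> SU2"
    then obtain a b where "g = su2_mat a b" "(cmod a)\<^sup>2 + (cmod b)\<^sup>2 = 1" by (auto simp: SU2_def)
    thus "g \<in> (\<lambda>z. su2_mat (fst z) (snd z)) ` sphere (0 :: complex \<times> complex) 1"
      by (intro image_eqI[of _ _ "(a, b)"]) (auto simp: norm_prod_def)
  next
    fix g assume "g \<in> (\<lambda>z. su2_mat (fst z) (snd z)) ` sphere (0 :: complex \<times> complex) 1"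
    thus "g \<in> SU2" unfolding SU2_def by (fastforce simp: norm_prod_def)
  qed
  moreover have "compact \<dots>"
    by (intro compact_continuous_image continuous_on_su2_mat continuous_intros) auto
  ultimately show ?thesis by simp
qed

lemma SU2_borel [measurable]: "SU2 \<in> sets borel"
  by (simp add: borel_compact compact_SU2)

lemma sets_su2_volume [measurable_cong]: "sets su2_volume = sets (restrict_space borel SU2)"
  by (simp add: su2_volume_def)

lemma finite_measure_su2_volume: "finite_measure su2_volume"
  by (rule finite_measureI) (simp add: su2_volume_total)

interpretation su2: finite_measure su2_volume
  by (rule finite_measure_su2_volume)

lemma borel_measurable_su2_volumeI:
  assumes "continuous_on SU2 f"
  shows "f \<in> borel_measurable su2_volume"
  using borel_measurable_continuous_on_restrict[OF assms]
    measurable_cong_sets[OF sets_su2_volume refl] by blast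

lemma measure_su2_volume: "measure su2_volume SU2 = 16 * pi\<^sup>2"
  by (simp add: measure_def su2_volume_total)


section \<open>Invariance of the volume\<close>

definition lborel_preserving :: "(complex \<times> complex \<Rightarrow> complex \<times> complex) \<Rightarrow> bool" where
  "lborel_preserving T \<longleftrightarrow> T \<in> borel_measurable borel \<and> distr lborel borel T = lborel"

lemma lborel_preserving_comp:
  assumes "lborel_preserving S" "lborel_preserving T"
  shows "lborel_preserving (S \<circ> T)"
proof -
  have S: "S \<in> borel_measurable borel" and T: "T \<in> borel_measurable borel"
    using assms by (auto simp: lborel_preserving_def)
  have "distr lborel borel (S \<circ> T) = distr (distr lborel borel T) borel S"
    using S T by (subst distr_distr) auto
  thus ?thesis using assms S T by (auto simp: lborel_preserving_def)
qed

text \<open>With one coordinate fixed the map is a translation in the other, so Tonelli reduces the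
  claim to translation invariance in one factor. This works for every Borel \<open>f\<close>, in
  particular for multiples of \<open>cnj\<close>.\<close>

lemma lborel_preserving_shear:
  fixes f :: "complex \<Rightarrow> complex"
  assumes [measurable]: "f \<in> borel_measurable borel"
  shows "lborel_preserving (\<lambda>z. (fst z + f (snd z), snd z))"
    and "lborel_preserving (\<lambda>z. (fst z, snd z + f (fst z)))"
proof -
  have translate: "(\<integral>\<^sup>+x. u (x + t) \<partial>lborel) = (\<integral>\<^sup>+x. u x \<partial>lborel)"
    if [measurable]: "u \<in> borel_measurable borel" for u :: "complex \<Rightarrow> ennreal" and t
  proof -
    have "(\<integral>\<^sup>+x. u x \<partial>lborel) = (\<integral>\<^sup>+x. u x \<partial>(distr lborel borel ((+) t)))"
      by (simp add: lborel_distr_plus)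
    also have "\<dots> = (\<integral>\<^sup>+x. u (x + t) \<partial>lborel)"
      by (subst nn_integral_distr) (auto simp: add.commute)
    finally show ?thesis ..
  qed
  have *: "distr lborel borel T = lborel" if [measurable]: "T \<in> borel_measurable borel"
    and T: "\<And>A. A \<in> sets borel \<Longrightarrow>
      (\<integral>\<^sup>+z. indicator A (T z) \<partial>(lborel \<Otimes>\<^sub>M lborel)) = (\<integral>\<^sup>+z. indicator A z \<partial>(lborel \<Otimes>\<^sub>M lborel))"
    for T :: "complex \<times> complex \<Rightarrow> complex \<times> complex"
  proof (rule measure_eqI)
    fix A assume "A \<in> sets (distr lborel borel T)"
    hence [measurable]: "A \<in> sets borel" by simp
    have "emeasure (distr lborel borel T) A = (\<integral>\<^sup>+z. indicator A z \<partial>distr lborel borel T)"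
      by simp
    also have "\<dots> = (\<integral>\<^sup>+z. indicator A (T z) \<partial>lborel)"
      by (subst nn_integral_distr) auto
    also have "\<dots> = (\<integral>\<^sup>+z. indicator A z \<partial>lborel)"
      using T[of A] by (simp add: lborel_prod)
    finally show "emeasure (distr lborel borel T) A = emeasure lborel A" by simp
  qed simp
  have [measurable]: "A \<in> sets (borel \<Otimes>\<^sub>M borel)" if "A \<in> sets borel" for A :: "(complex \<times> complex) set"
    using that unfolding borel_prod .
  have m1: "(\<lambda>z. (fst z + f (snd z), snd z)) \<in> borel_measurable borel"
    unfolding borel_prod[symmetric] by measurable
  have m2: "(\<lambda>z. (fst z, snd z + f (fst z))) \<in> borel_measurable borel"
    unfolding borel_prod[symmetric] by measurable
  show "lborel_preserving (\<lambda>z. (fst z + f (snd z), snd z))"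
    unfolding lborel_preserving_def
  proof (intro conjI m1 *)
    fix A :: "(complex \<times> complex) set" assume [measurable]: "A \<in> sets borel"
    show "(\<integral>\<^sup>+z. indicator A (fst z + f (snd z), snd z) \<partial>(lborel \<Otimes>\<^sub>M lborel))
        = (\<integral>\<^sup>+z. indicator A z \<partial>(lborel \<Otimes>\<^sub>M lborel))"
    proof -
      have "(\<integral>\<^sup>+z. indicator A (fst z + f (snd z), snd z) \<partial>(lborel \<Otimes>\<^sub>M lborel))
        = (\<integral>\<^sup>+y. (\<integral>\<^sup>+x. indicator A (x + f y, y) \<partial>lborel) \<partial>lborel)"
        by (subst lborel_pair.nn_integral_snd[symmetric]) (auto simp: case_prod_beta)
      also have "\<dots> = (\<integral>\<^sup>+y. (\<integral>\<^sup>+x. indicator A (x, y) \<partial>lborel) \<partial>lborel)"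
        by (subst translate[of "\<lambda>x. indicator A (x, _)"]) auto
      also have "\<dots> = (\<integral>\<^sup>+z. indicator A z \<partial>(lborel \<Otimes>\<^sub>M lborel))"
        by (subst lborel_pair.nn_integral_snd[symmetric]) (auto simp: case_prod_beta)
      finally show ?thesis .
    qed
  qed
  show "lborel_preserving (\<lambda>z. (fst z, snd z + f (fst z)))"
    unfolding lborel_preserving_def
  proof (intro conjI m2 *)
    fix A :: "(complex \<times> complex) set" assume [measurable]: "A \<in> sets borel"
    show "(\<integral>\<^sup>+z. indicator A (fst z, snd z + f (fst z)) \<partial>(lborel \<Otimes>\<^sub>M lborel))
        = (\<integral>\<^sup>+z. indicator A z \<partial>(lborel \<Otimes>\<^sub>M lborel))"
    proof -
      have "(\<integral>\<^sup>+z. indicator A (fst z, snd z + f (fst z)) \<partial>(lborel \<Otimes>\<^sub>M lborel))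
        = (\<integral>\<^sup>+x. (\<integral>\<^sup>+y. indicator A (x, y + f x) \<partial>lborel) \<partial>lborel)"
        by (subst lborel.nn_integral_fst[symmetric]) (auto simp: case_prod_beta)
      also have "\<dots> = (\<integral>\<^sup>+x. (\<integral>\<^sup>+y. indicator A (x, y) \<partial>lborel) \<partial>lborel)"
        by (subst translate[of "\<lambda>y. indicator A (_, y)"]) auto
      also have "\<dots> = (\<integral>\<^sup>+z. indicator A z \<partial>(lborel \<Otimes>\<^sub>M lborel))"
        by (subst lborel.nn_integral_fst[symmetric]) (auto simp: case_prod_beta)
      finally show ?thesis .
    qed
  qed
qed

text \<open>A determinant 1 matrix with nonzero lower left entry is a product of three shears.\<close>

lemma lborel_preserving_left_nonzero:
  assumes ab: "a * cnj a + b * cnj b = 1" and b: "b \<noteq> 0"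
  shows "lborel_preserving (\<lambda>z. (a * fst z - cnj b * snd z, b * fst z + cnj a * snd z))"
proof -
  \<comment> \<open>The middle shear supplies the entry b, and the outer parameters are solved from
    the diagonal entries a and \<open>cnj a\<close>. The upper right entry then comes out as
    \<open>- cnj b\<close> because the determinant is 1.\<close>
  have "(\<lambda>z. (a * fst z - cnj b * snd z, b * fst z + cnj a * snd z)) =
      (\<lambda>z. (fst z + (a - 1) / b * snd z, snd z)) \<circ> (\<lambda>z. (fst z, snd z + b * fst z)) \<circ>
      (\<lambda>z. (fst z + (cnj a - 1) / b * snd z, snd z))"
    using ab b by (simp add: fun_eq_iff field_simps) (auto, algebra+)
  thus ?thesis by (simp only:) (intro lborel_preserving_comp lborel_preserving_shear; measurable)
qed

text \<open>The diagonal case escapes the shear factorization, but a diagonal matrix is a product of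
  two antidiagonal ones, to which it does apply.\<close>

lemma lborel_preserving_left:
  assumes ab: "a * cnj a + b * cnj b = 1"
  shows "lborel_preserving (\<lambda>z. (a * fst z - cnj b * snd z, b * fst z + cnj a * snd z))"
proof (cases "b = 0")
  case False
  thus ?thesis using lborel_preserving_left_nonzero ab by blast
next
  case True
  have 1: "lborel_preserving (\<lambda>z. (0 * fst z - cnj 1 * snd z, 1 * fst z + cnj 0 * snd z))"
    by (rule lborel_preserving_left_nonzero) auto
  have "cnj a \<noteq> 0" using True ab by auto
  hence 2: "lborel_preserving (\<lambda>z. (0 * fst z - cnj (- cnj a) * snd z, (- cnj a) * fst z + cnj 0 * snd z))"
    by (intro lborel_preserving_left_nonzero) (use ab True in \<open>auto simp: mult.commute\<close>)
  show ?thesis using lborel_preserving_comp[OF 2 1] True by (simp add: o_def)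
qed

text \<open>On first columns, right multiplication by \<open>su2_mat a b\<close> is only real
  linear: it mixes an entry with the conjugate of the other. The same three-shear factorization
  works with multiples of \<open>cnj\<close> as shear functions.\<close>

lemma lborel_preserving_right_nonzero:
  assumes ab: "a * cnj a + b * cnj b = 1" and b: "b \<noteq> 0"
  shows "lborel_preserving (\<lambda>z. (a * fst z - b * cnj (snd z), a * snd z + b * cnj (fst z)))"
proof -
  have b': "cnj b \<noteq> 0" using b by simp
  have "(\<lambda>z. (a * fst z - b * cnj (snd z), a * snd z + b * cnj (fst z))) =
      (\<lambda>z. (fst z + (a - 1) / cnj b * cnj (snd z), snd z)) \<circ> (\<lambda>z. (fst z, snd z + b * cnj (fst z))) \<circ>
      (\<lambda>z. (fst z + (cnj a - 1) / cnj b * cnj (snd z), snd z))"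
    using ab b b' by (simp add: fun_eq_iff field_simps) (auto, algebra+)
  thus ?thesis
    by (simp only:) (intro lborel_preserving_comp lborel_preserving_shear
        borel_measurable_continuous_onI continuous_intros)
qed

lemma lborel_preserving_right:
  assumes ab: "a * cnj a + b * cnj b = 1"
  shows "lborel_preserving (\<lambda>z. (a * fst z - b * cnj (snd z), a * snd z + b * cnj (fst z)))"
proof (cases "b = 0")
  case False
  thus ?thesis using lborel_preserving_right_nonzero ab by blast
next
  case True
  have 1: "lborel_preserving (\<lambda>z. (0 * fst z - 1 * cnj (snd z), 0 * snd z + 1 * cnj (fst z)))"
    by (rule lborel_preserving_right_nonzero) auto
  have "a \<noteq> 0" using True ab by auto
  hence 2: "lborel_preserving (\<lambda>z. (0 * fst z - (-a) * cnj (snd z), 0 * snd z + (-a) * cnj (fst z)))"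
    by (intro lborel_preserving_right_nonzero) (use ab True in auto)
  show ?thesis using lborel_preserving_comp[OF 2 1] True by (simp add: o_def)
qed

lemma emeasure_su2_volume:
  assumes "A \<in> sets su2_volume"
  shows "emeasure su2_volume A = 2 * emeasure lborel (radial_proj -` A \<inter> (ball 0 2 - {0}))"
proof -
  let ?B = "ball (0 :: complex \<times> complex) 2 - {0}"
  have A: "A \<in> sets (restrict_space borel SU2)" using assms by (simp add: sets_su2_volume)
  have "emeasure (restrict_space lborel ?B) (radial_proj -` A \<inter> ?B) = emeasure lborel (radial_proj -` A \<inter> ?B)"
    by (rule emeasure_restrict_space) auto
  thus ?thesis using A radial_proj_measurable
    by (simp add: su2_volume_def emeasure_distr space_restrict_space)
qed

text \<open>The volume is the image of Lebesgue measure on a ball, so a measure preserving linear isometry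
  \<open>T\<close> covering \<open>\<tau>\<close> transfers its invariance.\<close>

lemma su2_volume_preserved:
  assumes T: "lborel_preserving T" and nT: "\<And>z. norm (T z) = norm z"
    and \<tau>: "\<tau> \<in> su2_volume \<rightarrow>\<^sub>M su2_volume"
    and eq: "\<And>z. z \<noteq> 0 \<Longrightarrow> radial_proj (T z) = \<tau> (radial_proj z)"
  shows "distr su2_volume su2_volume \<tau> = su2_volume"
proof (rule measure_eqI)
  let ?B = "ball (0 :: complex \<times> complex) 2 - {0}"
  have Tm: "T \<in> borel_measurable borel" and Td: "distr lborel borel T = lborel"
    using T by (auto simp: lborel_preserving_def)
  fix A assume "A \<in> sets (distr su2_volume su2_volume \<tau>)"
  hence A: "A \<in> sets su2_volume" by simp
  have "radial_proj -` A \<inter> space (restrict_space lborel ?B) \<in> sets (restrict_space lborel ?B)"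
    by (rule measurable_sets[OF radial_proj_measurable]) (use A in \<open>simp add: sets_su2_volume\<close>)
  hence S: "radial_proj -` A \<inter> ?B \<in> sets borel"
    by (auto simp: sets_restrict_space_iff space_restrict_space)
  have T0: "T z = 0 \<longleftrightarrow> z = 0" for z using nT[of z] by (metis norm_eq_zero)
  have "emeasure (distr su2_volume su2_volume \<tau>) A = emeasure su2_volume (\<tau> -` A \<inter> SU2)"
    using emeasure_distr[OF \<tau> A] by simp
  also have "\<dots> = 2 * emeasure lborel (radial_proj -` (\<tau> -` A \<inter> SU2) \<inter> ?B)"
    using measurable_sets[OF \<tau> A] by (subst emeasure_su2_volume) simp_all
  \<comment> \<open>Being norm preserving, \<open>T\<close> maps exactly the punctured ball into the
    punctured ball.\<close>
  also have "radial_proj -` (\<tau> -` A \<inter> SU2) \<inter> ?B = T -` (radial_proj -` A \<inter> ?B)"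
  proof (intro set_eqI)
    fix z
    show "z \<in> radial_proj -` (\<tau> -` A \<inter> SU2) \<inter> ?B \<longleftrightarrow> z \<in> T -` (radial_proj -` A \<inter> ?B)"
      using radial_proj_in_SU2[of z] by (cases "z = 0") (simp_all add: eq nT T0)
  qed
  also have "emeasure lborel \<dots> = emeasure (distr lborel borel T) (radial_proj -` A \<inter> ?B)"
    using Tm S by (subst emeasure_distr) auto
  also have "2 * \<dots> = emeasure su2_volume A"
    by (simp add: Td emeasure_su2_volume[OF A])
  finally show "emeasure (distr su2_volume su2_volume \<tau>) A = emeasure su2_volume A" .
qed simp

section \<open>Left and right translations preserve the volume\<close>

lemma continuous_on_matrix_mult:
  fixes f g :: "'a::topological_space \<Rightarrow> complex^2^2"
  assumes "continuous_on S f" "continuous_on S g"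
  shows "continuous_on S (\<lambda>x. f x ** g x)"
  unfolding matrix_matrix_mult_def by (intro continuous_on_vec_lambda continuous_intros assms)

lemma translation_measurable:
  assumes "g \<in> SU2"
  shows "(\<lambda>h. g ** h) \<in> su2_volume \<rightarrow>\<^sub>M su2_volume" "(\<lambda>h. h ** g) \<in> su2_volume \<rightarrow>\<^sub>M su2_volume"
proof -
  have *: "f \<in> su2_volume \<rightarrow>\<^sub>M su2_volume" if "continuous_on SU2 f" "f \<in> SU2 \<rightarrow> SU2" for f
  proof -
    have "f \<in> su2_volume \<rightarrow>\<^sub>M restrict_space borel SU2"
      using that borel_measurable_su2_volumeI[OF that(1)] by (intro measurable_restrict_space2) auto
    thus ?thesis using measurable_cong_sets[OF refl sets_su2_volume] by blast
  qed
  show "(\<lambda>h. g ** h) \<in> su2_volume \<rightarrow>\<^sub>M su2_volume" "(\<lambda>h. h ** g) \<in> su2_volume \<rightarrow>\<^sub>M su2_volume"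
    using assms by (auto intro!: * continuous_on_matrix_mult continuous_intros SU2_mult)
qed

lemma norm_pair_eqI:
  fixes z w :: "complex \<times> complex"
  assumes "fst z * cnj (fst z) + snd z * cnj (snd z) = fst w * cnj (fst w) + snd w * cnj (snd w)"
  shows "norm z = norm w"
  using assms
  by (simp only: norm_prod_def complex_norm_square[symmetric] of_real_add[symmetric] of_real_eq_iff)

lemma left_translation_preserves:
  assumes "g \<in> SU2"
  shows "distr su2_volume su2_volume (\<lambda>h. g ** h) = su2_volume"
proof -
  obtain a b where g: "g = su2_mat a b" "a * cnj a + b * cnj b = 1" using assms by (rule SU2_E)
  let ?T = "\<lambda>z. (a * fst z - cnj b * snd z, b * fst z + cnj a * snd z)"
  have n: "norm (?T z) = norm z" for z
  proof (rule norm_pair_eqI)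
    have "fst (?T z) * cnj (fst (?T z)) + snd (?T z) * cnj (snd (?T z)) =
      (a * cnj a + b * cnj b) * (fst z * cnj (fst z) + snd z * cnj (snd z))"
      by (simp add: algebra_simps)
    thus "fst (?T z) * cnj (fst (?T z)) + snd (?T z) * cnj (snd (?T z)) =
      fst z * cnj (fst z) + snd z * cnj (snd z)" using g(2) by simp
  qed
  show ?thesis
  proof (rule su2_volume_preserved[OF lborel_preserving_left[OF g(2)] n translation_measurable(1)[OF assms]])
    fix z :: "complex \<times> complex" assume "z \<noteq> 0"
    show "radial_proj (?T z) = g ** radial_proj z"
      unfolding radial_proj_def n g(1) su2_mat_mult by (simp add: add_divide_distrib diff_divide_distrib)
  qed
qed

lemma right_translation_preserves:
  assumes "g \<in> SU2"
  shows "distr su2_volume su2_volume (\<lambda>h. h ** g) = su2_volume"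
proof -
  obtain a b where g: "g = su2_mat a b" "a * cnj a + b * cnj b = 1" using assms by (rule SU2_E)
  let ?T = "\<lambda>z. (a * fst z - b * cnj (snd z), a * snd z + b * cnj (fst z))"
  have n: "norm (?T z) = norm z" for z
  proof (rule norm_pair_eqI)
    have "fst (?T z) * cnj (fst (?T z)) + snd (?T z) * cnj (snd (?T z)) =
      (a * cnj a + b * cnj b) * (fst z * cnj (fst z) + snd z * cnj (snd z))"
      by (simp add: algebra_simps)
    thus "fst (?T z) * cnj (fst (?T z)) + snd (?T z) * cnj (snd (?T z)) =
      fst z * cnj (fst z) + snd z * cnj (snd z)" using g(2) by simp
  qed
  show ?thesis
  proof (rule su2_volume_preserved[OF lborel_preserving_right[OF g(2)] n translation_measurable(2)[OF assms]])
    fix z :: "complex \<times> complex" assume "z \<noteq> 0"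
    show "radial_proj (?T z) = radial_proj z ** g"
      unfolding radial_proj_def n g(1) su2_mat_mult
      by (simp add: add_divide_distrib diff_divide_distrib mult.commute)
  qed
qed

section \<open>Wigner functions\<close>

definition psiv :: "nat \<Rightarrow> nat \<Rightarrow> complex \<times> complex \<Rightarrow> complex" where
  "psiv n m z = psi n m (fst z) (snd z)"

text \<open>For g in SU(2) this is the inverse of g, that is its adjoint, applied to the vector z.
  It is the substitution in the defining identity of the Wigner functions.\<close>

definition inv_act :: "complex^2^2 \<Rightarrow> complex \<times> complex \<Rightarrow> complex \<times> complex" where
  "inv_act g z = (cnj (g$1$1) * fst z + cnj (g$2$1) * snd z, - (g$2$1) * fst z + g$1$1 * snd z)"

lemma inv_act_su2_mat:
  "inv_act (su2_mat a b) z = (cnj a * fst z + cnj b * snd z, - b * fst z + a * snd z)"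
  by (simp add: inv_act_def)

lemma wigner_expand:
  "s \<le> n \<Longrightarrow> psiv n s (inv_act g z) = (\<Sum>m\<le>n. psiv n m z * wigner_D n m s g)"
  by (simp add: psiv_def inv_act_def wigner_D_eq)

lemma psiv_scale: "m \<le> n \<Longrightarrow> psiv n m (c * fst z, c * snd z) = c ^ n * psiv n m z"
  by (simp add: psiv_def psi_def power_mult_distrib power_add[symmetric] mult_ac)

lemma cnj_psiv: "cnj (psiv n m z) = psiv n m (cnj (fst z), cnj (snd z))"
  by (simp add: psiv_def psi_def)

lemma psiv_e0: "m \<le> n \<Longrightarrow> psiv n m (1, 0) = (if m = n then 1 else 0)"
  by (simp add: psiv_def psi_def)

lemma psiv_top: "psiv n n z = fst z ^ n"
  by (simp add: psiv_def psi_def)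

text \<open>The square roots in \<open>psi\<close> are made for the binomial theorem. With w
  conjugated, the right side is a power of the Hermitian product, which is invariant under the
  group; unitarity and Schur orthogonality rest on this.\<close>

lemma psiv_kernel: "(\<Sum>m\<le>n. psiv n m z * psiv n m w) = (fst z * fst w + snd z * snd w) ^ n"
proof -
  have "complex_of_real (sqrt (real (n choose m))) * complex_of_real (sqrt (real (n choose m))) = of_nat (n choose m)" for m
    by (simp flip: of_real_mult)
  hence "psiv n m z * psiv n m w = of_nat (n choose m) * (fst z * fst w) ^ m * (snd z * snd w) ^ (n - m)" for m
    by (simp add: psiv_def psi_def power_mult_distrib mult_ac)
  thus ?thesis by (simp add: binomial_ring)
qed

text \<open>Linear independence of the basis: at second coordinate 1 the identity is one between
  polynomials in a single variable.\<close>

lemma psiv_coeff_unique: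
  assumes "\<And>z. (\<Sum>m\<le>n. psiv n m z * a m) = (\<Sum>m\<le>n. psiv n m z * b m)" and "m \<le> n"
  shows "a m = b m"
proof -
  let ?w = "\<lambda>m. complex_of_real (sqrt (real (n choose m)))"
  have "(\<Sum>i\<le>n. (?w i * a i) * z ^ i) = (\<Sum>i\<le>n. (?w i * b i) * z ^ i)" for z
    using assms(1)[of "(z, 1)"] by (simp add: psiv_def psi_def mult_ac)
  hence "\<forall>i\<le>n. ?w i * a i = ?w i * b i" by (subst polyfun_eq_coeffs[symmetric]) blast
  moreover have "?w m \<noteq> 0" using assms(2) by simp
  ultimately show ?thesis using assms(2) by simp
qed

text \<open>Homogeneity of degree n extends the identity from the unit sphere to all
  vectors.\<close>

lemma psiv_coeff_unique_unit:
  assumes eq: "\<And>z. fst z * cnj (fst z) + snd z * cnj (snd z) = 1 \<Longrightarrow>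
      (\<Sum>m\<le>n. psiv n m z * a m) = (\<Sum>m\<le>n. psiv n m z * b m)" and "m \<le> n"
  shows "a m = b m"
proof (rule psiv_coeff_unique[OF _ assms(2)])
  fix z :: "complex \<times> complex"
  \<comment> \<open>At z = 0 any unit vector serves, since the scaling factor c is 0 there.\<close>
  define w where "w = (if z = 0 then (1, 0) else (fst z / of_real (norm z), snd z / of_real (norm z)))"
  have w: "fst w * cnj (fst w) + snd w * cnj (snd w) = 1"
  proof (cases "z = 0")
    case False
    hence "radial_proj z \<in> SU2" by (rule radial_proj_in_SU2)
    then obtain a b where ab: "radial_proj z = su2_mat a b" "a * cnj a + b * cnj b = 1" by (rule SU2_E)
    have "radial_proj z $ 1 $ 1 = a" "radial_proj z $ 2 $ 1 = b" unfolding ab(1) by simp_all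
    thus ?thesis using ab(2) False by (simp add: radial_proj_def w_def)
  qed (simp add: w_def)
  define c where "c = complex_of_real (norm z)"
  have z: "z = (c * fst w, c * snd w)" by (cases "z = 0") (auto simp: w_def c_def prod_eq_iff)
  have "(\<Sum>m\<le>n. psiv n m z * f m) = c ^ n * (\<Sum>m\<le>n. psiv n m w * f m)" for f
    unfolding sum_distrib_left by (intro sum.cong) (auto simp: z psiv_scale mult_ac simp del: fst_conv snd_conv)
  thus "(\<Sum>m\<le>n. psiv n m z * a m) = (\<Sum>m\<le>n. psiv n m z * b m)" using eq[OF w] by simp
qed

section \<open>The Wigner functions as a unitary representation\<close>

lemma inv_act_mult:
  assumes "g \<in> SU2" "h \<in> SU2"
  shows "inv_act (g ** h) z = inv_act h (inv_act g z)"
proof -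
  obtain a b where g: "g = su2_mat a b" using assms(1) by (rule SU2_E)
  obtain c d where h: "h = su2_mat c d" using assms(2) by (rule SU2_E)
  show ?thesis by (simp add: g h su2_mat_mult inv_act_su2_mat algebra_simps)
qed

text \<open>The action goes through inverses, so the action of \<open>g ** h\<close> is that of g
  followed by that of h. Expanding first in h and then in g puts the two matrices in the stated
  order.\<close>

lemma wigner_mult:
  assumes "g \<in> SU2" "h \<in> SU2" "m \<le> n" "s \<le> n"
  shows "wigner_D n m s (g ** h) = (\<Sum>k\<le>n. wigner_D n m k g * wigner_D n k s h)"
proof (rule psiv_coeff_unique[OF _ assms(3)])
  fix z
  have "(\<Sum>m\<le>n. psiv n m z * wigner_D n m s (g ** h)) = psiv n s (inv_act h (inv_act g z))"
    by (simp add: wigner_expand[OF assms(4), symmetric] inv_act_mult assms)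
  also have "\<dots> = (\<Sum>k\<le>n. \<Sum>m\<le>n. psiv n m z * wigner_D n m k g * wigner_D n k s h)"
    by (simp add: wigner_expand assms(4) sum_distrib_right)
  also have "\<dots> = (\<Sum>m\<le>n. psiv n m z * (\<Sum>k\<le>n. wigner_D n m k g * wigner_D n k s h))"
    by (subst sum.swap) (simp add: sum_distrib_left mult.assoc)
  finally show "(\<Sum>m\<le>n. psiv n m z * wigner_D n m s (g ** h)) = \<dots>" .
qed

lemma wigner_one:
  assumes "m \<le> n" "s \<le> n"
  shows "wigner_D n m s (mat 1) = (if m = s then 1 else 0)"
proof (rule psiv_coeff_unique[OF _ assms(1)])
  fix z :: "complex \<times> complex"
  have "inv_act (mat 1) z = z" by (simp add: inv_act_def mat_def)
  thus "(\<Sum>m\<le>n. psiv n m z * wigner_D n m s (mat 1)) = (\<Sum>m\<le>n. psiv n m z * (if m = s then 1 else 0))"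
    using assms by (simp add: wigner_expand[symmetric] if_distrib[of "(*) _"] cong: if_cong)
qed

text \<open>In the Hermitian product the action of \<open>matrix_inv g\<close> is adjoint to that of
  g. By \<open>psiv_kernel\<close> the n-th power of the product generates both families of matrix
  coefficients; they are compared first as polynomials in z, then as polynomials in w.\<close>

lemma wigner_inv:
  assumes g: "g \<in> SU2" and m: "m \<le> n" and s: "s \<le> n"
  shows "wigner_D n m s (matrix_inv g) = cnj (wigner_D n s m g)"
proof -
  obtain a b where ab: "g = su2_mat a b" "a * cnj a + b * cnj b = 1" using g by (rule SU2_E)
  have eq: "(\<Sum>s\<le>n. psiv n s w * wigner_D n m s (matrix_inv g)) = (\<Sum>s\<le>n. psiv n s w * cnj (wigner_D n s m g))" for w
  proof (rule psiv_coeff_unique[OF _ m])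
    fix z :: "complex \<times> complex"
    let ?z = "(cnj (fst z), cnj (snd z))" and ?w = "(cnj (fst w), cnj (snd w))"
    have "(\<Sum>m\<le>n. psiv n m z * (\<Sum>s\<le>n. psiv n s w * wigner_D n m s (matrix_inv g)))
       = (\<Sum>s\<le>n. psiv n s w * (\<Sum>m\<le>n. psiv n m z * wigner_D n m s (matrix_inv g)))"
      unfolding sum_distrib_left by (subst sum.swap) (simp add: mult_ac)
    also have "\<dots> = (\<Sum>s\<le>n. psiv n s w * psiv n s (inv_act (matrix_inv g) z))"
      by (intro sum.cong) (simp_all add: wigner_expand)
    also have "\<dots> = cnj (\<Sum>m\<le>n. psiv n m ?z * psiv n m (inv_act g ?w))"
      unfolding psiv_kernel by (simp add: ab SU2_matrix_inv inv_act_su2_mat algebra_simps)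
    also have "\<dots> = (\<Sum>m\<le>n. psiv n m z * cnj (\<Sum>s\<le>n. psiv n s ?w * wigner_D n s m g))"
      by (simp add: cnj_psiv flip: wigner_expand)
    also have "\<dots> = (\<Sum>m\<le>n. psiv n m z * (\<Sum>s\<le>n. psiv n s w * cnj (wigner_D n s m g)))"
      by (simp add: cnj_psiv)
    finally show "(\<Sum>m\<le>n. psiv n m z * (\<Sum>s\<le>n. psiv n s w * wigner_D n m s (matrix_inv g))) = \<dots>" .
  qed
  show ?thesis by (rule psiv_coeff_unique[OF eq s])
qed

lemma wigner_unitary:
  assumes "g \<in> SU2" "s \<le> n" "t \<le> n"
  shows "(\<Sum>k\<le>n. wigner_D n k s g * cnj (wigner_D n k t g)) = (if s = t then 1 else 0)"
    and "(\<Sum>k\<le>n. wigner_D n s k g * cnj (wigner_D n t k g)) = (if s = t then 1 else 0)"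
proof -
  have "(\<Sum>k\<le>n. wigner_D n t k (matrix_inv g) * wigner_D n k s g) = (if s = t then 1 else 0)"
    using assms by (simp add: SU2_inv wigner_one flip: wigner_mult)
  thus "(\<Sum>k\<le>n. wigner_D n k s g * cnj (wigner_D n k t g)) = (if s = t then 1 else 0)"
    using assms by (simp add: wigner_inv mult.commute)
  have "(\<Sum>k\<le>n. wigner_D n s k g * wigner_D n k t (matrix_inv g)) = (if s = t then 1 else 0)"
    using assms by (simp add: SU2_inv wigner_one flip: wigner_mult)
  thus "(\<Sum>k\<le>n. wigner_D n s k g * cnj (wigner_D n t k g)) = (if s = t then 1 else 0)"
    using assms by (simp add: wigner_inv)
qed

text \<open>\<open>(z\<^sub>0, z\<^sub>1) \<mapsto> (- cnj z\<^sub>1, cnj z\<^sub>0)\<close> commutes with the action, so complex conjugation maps a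
  Wigner function to one of the same degree.\<close>

lemma cnj_wigner:
  assumes "m \<le> n" "s \<le> n"
  shows "cnj (wigner_D n m s g) = (-1) ^ (m + s) * wigner_D n (n - m) (n - s) g"
proof -
  define J :: "complex \<times> complex \<Rightarrow> complex \<times> complex" where "J z = (- cnj (snd z), cnj (fst z))" for z
  have psiJ: "psiv n (n - k) (J z) = (-1) ^ (n - k) * cnj (psiv n k z)" if "k \<le> n" for k z
  proof -
    have "psiv n (n - k) (J z) = of_real (sqrt (real (n choose k))) * (- cnj (snd z)) ^ (n - k) * cnj (fst z) ^ k"
      using that by (simp add: psiv_def psi_def J_def binomial_symmetric[OF that])
    also have "(- cnj (snd z)) ^ (n - k) = (-1) ^ (n - k) * cnj (snd z) ^ (n - k)"
      by (metis mult_minus1 power_mult_distrib)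
    finally show ?thesis by (simp add: psiv_def psi_def)
  qed
  have J_act: "inv_act g (J z) = J (inv_act g z)" for z
    by (simp add: inv_act_def J_def)
  have sign: "(-1) ^ (n - k) * (-1) ^ (n - k) = (1 :: complex)" for k
    by (simp flip: power_add)
  have "(-1) ^ (n - m) * cnj (wigner_D n m s g) = (-1) ^ (n - s) * wigner_D n (n - m) (n - s) g"
  proof -
    define a where "a k = (-1) ^ (n - (n - k)) * cnj (wigner_D n (n - k) s g)" for k
    have "(\<Sum>k\<le>n. psiv n k w * a k) = (\<Sum>k\<le>n. psiv n k w * ((-1) ^ (n - s) * wigner_D n k (n - s) g))" for w
    proof -
      \<comment> \<open>\<open>J\<close> squares to -1, so the preimage of w under \<open>J\<close>
        is minus its image.\<close>
      define z where "z = (cnj (snd w), - cnj (fst w))"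
      have w: "w = J z" by (simp add: z_def J_def)
      have "(\<Sum>k\<le>n. psiv n k w * a k) = (\<Sum>k\<le>n. psiv n (n - k) (J z) * a (n - k))"
        unfolding w by (rule sum.reindex_bij_witness[of _ "\<lambda>k. n - k" "\<lambda>k. n - k"]) auto
      also have "\<dots> = (\<Sum>k\<le>n. cnj (psiv n k z * wigner_D n k s g))"
      proof (intro sum.cong refl)
        fix k assume "k \<in> {..n}"
        hence "psiv n (n - k) (J z) * a (n - k)
            = ((-1) ^ (n - k) * (-1) ^ (n - k)) * (cnj (psiv n k z) * cnj (wigner_D n k s g))"
          by (simp add: psiJ a_def)
        thus "psiv n (n - k) (J z) * a (n - k) = cnj (psiv n k z * wigner_D n k s g)"
          unfolding sign by simp
      qed
      also have "\<dots> = cnj (psiv n s (inv_act g z))"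
        unfolding wigner_expand[OF assms(2)] by simp
      also have "\<dots> = ((-1) ^ (n - s) * (-1) ^ (n - s)) * cnj (psiv n s (inv_act g z))"
        unfolding sign by simp
      also have "\<dots> = (-1) ^ (n - s) * psiv n (n - s) (inv_act g w)"
        by (simp add: w J_act psiJ[OF assms(2)])
      also have "\<dots> = (\<Sum>k\<le>n. psiv n k w * ((-1) ^ (n - s) * wigner_D n k (n - s) g))"
        by (simp add: wigner_expand sum_distrib_left mult_ac)
      finally show ?thesis .
    qed
    hence "a (n - m) = (-1) ^ (n - s) * wigner_D n (n - m) (n - s) g"
      by (rule psiv_coeff_unique) simp
    thus ?thesis using assms by (simp add: a_def)
  qed
  hence "((-1) ^ (n - m) * (-1) ^ (n - m)) * cnj (wigner_D n m s g)
      = ((-1) ^ (n - m) * (-1) ^ (n - s)) * wigner_D n (n - m) (n - s) g"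
    by (simp only: mult.assoc)
  \<comment> \<open>(n - m) + (n - s) and m + s add up to 2 n, so they have the same parity.\<close>
  moreover have "(-1) ^ (n - m) * (-1) ^ (n - s) = ((-1) ^ (m + s) :: complex)"
    using assms by (auto simp flip: power_add simp: minus_one_power_iff)
  ultimately show ?thesis unfolding sign by simp
qed

text \<open>The defining identity at second coordinate 1, read as an equality of polynomials in the
  first. The closed form gives continuity in g and, later, the recursions between degrees.\<close>

lemma wigner_coeff:
  assumes "m \<le> n" "s \<le> n"
  shows "wigner_D n m s g = of_real (sqrt (real (n choose s)) / sqrt (real (n choose m))) *
    poly.coeff ([:cnj (g$2$1), cnj (g$1$1):] ^ s * [:g$1$1, - (g$2$1):] ^ (n - s)) m"
    (is "_ = of_real (?w s / ?w m) * poly.coeff ?p m")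
proof -
  have deg: "degree ?p \<le> n"
  proof -
    have "degree ?p \<le> degree ([:cnj (g$2$1), cnj (g$1$1):] ^ s) + degree ([:g$1$1, - (g$2$1):] ^ (n - s))"
      by (rule degree_mult_le)
    also have "\<dots> \<le> degree [:cnj (g$2$1), cnj (g$1$1):] * s + degree [:g$1$1, - (g$2$1):] * (n - s)"
      by (intro add_mono degree_power_le)
    also have "\<dots> \<le> 1 * s + 1 * (n - s)" by (intro add_mono mult_right_mono) auto
    also have "\<dots> = n" using assms by simp
    finally show ?thesis .
  qed
  have "(\<Sum>k\<le>n. (of_real (?w k) * wigner_D n k s g) * x ^ k) = (\<Sum>k\<le>n. (of_real (?w s) * poly.coeff ?p k) * x ^ k)" for x
  proof -
    have "(\<Sum>k\<le>n. (of_real (?w k) * wigner_D n k s g) * x ^ k) = (\<Sum>k\<le>n. psiv n k (x, 1) * wigner_D n k s g)"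
      by (simp add: psiv_def psi_def mult_ac)
    also have "\<dots> = of_real (?w s) * poly ?p x"
      unfolding wigner_expand[OF assms(2), symmetric]
      by (simp add: psiv_def psi_def inv_act_def mult.commute add.commute)
    also have "poly ?p x = (\<Sum>k\<le>n. poly.coeff ?p k * x ^ k)" 
      unfolding poly_altdef using deg by (intro sum.mono_neutral_left) (auto simp: coeff_eq_0)
    finally show ?thesis by (simp add: sum_distrib_left mult_ac)
  qed
  hence "\<forall>k\<le>n. of_real (?w k) * wigner_D n k s g = of_real (?w s) * poly.coeff ?p k"
    by (subst polyfun_eq_coeffs[symmetric]) blast
  with assms have "of_real (?w m) * wigner_D n m s g = of_real (?w s) * poly.coeff ?p m" by blast
  moreover have "of_real (?w m) \<noteq> (0 :: complex)" using assms by simp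
  ultimately show ?thesis by (simp add: field_simps)
qed

lemma continuous_on_wigner:
  assumes "m \<le> n" "s \<le> n"
  shows "continuous_on S (wigner_D n m s)"
proof -
  have mult: "continuous_on S (\<lambda>g. poly.coeff (p g * q g) k)"
    if "\<And>k. continuous_on S (\<lambda>g. poly.coeff (p g) k)" "\<And>k. continuous_on S (\<lambda>g. poly.coeff (q g) k)"
    for p q :: "complex^2^2 \<Rightarrow> complex poly" and k
    unfolding coeff_mult by (intro continuous_intros that)
  have pow: "continuous_on S (\<lambda>g. poly.coeff (p g ^ j) k)"
    if "\<And>k. continuous_on S (\<lambda>g. poly.coeff (p g) k)"
    for p :: "complex^2^2 \<Rightarrow> complex poly" and j k
  proof (induction j arbitrary: k)
    case (Suc j)
    show ?case unfolding power_Suc by (intro mult that Suc)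
  qed simp
  have lin: "continuous_on S (\<lambda>g. poly.coeff [:a g, b g:] k)"
    if "continuous_on S a" "continuous_on S b" for a b :: "complex^2^2 \<Rightarrow> complex" and k
    using that by (cases k; cases "k - 1") auto
  show ?thesis
    unfolding wigner_coeff[OF assms, abs_def]
    by (intro continuous_intros mult pow lin)
qed

section \<open>Schur orthogonality\<close>

lemma integrable_su2_continuous:
  fixes f :: "complex^2^2 \<Rightarrow> complex"
  assumes "continuous_on SU2 f"
  shows "integrable su2_volume f"
proof -
  have "compact (f ` SU2)" by (rule compact_continuous_image[OF assms compact_SU2])
  then obtain B where "\<forall>x\<in>f ` SU2. norm x \<le> B" using compact_imp_bounded bounded_iff by blast
  thus ?thesis
    by (intro su2.integrable_const_bound[of _ B] borel_measurable_su2_volumeI assms) auto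
qed

lemma integral_left_translate:
  fixes f :: "complex^2^2 \<Rightarrow> complex"
  assumes "k \<in> SU2" "f \<in> borel_measurable su2_volume"
  shows "(\<integral>g. f (k ** g) \<partial>su2_volume) = (\<integral>g. f g \<partial>su2_volume)"
  using integral_distr[OF translation_measurable(1)[OF assms(1)] assms(2)]
  by (simp add: left_translation_preserves[OF assms(1)])

text \<open>The form \<open>F z z' = \<integral> \<psi>\<^sub>s(g\<inverse> z) cnj (\<psi>\<^sub>s\<^sub>'(g\<inverse> z')) dg\<close> is invariant, hence determined by
  its values at \<open>z' = (1, 0)\<close>, and there invariance under the diagonal torus leaves one coefficient only.\<close>

lemma wigner_schur:
  assumes "s \<le> n" "s' \<le> n'" "n \<le> n'"
  shows "\<exists>lam. \<forall>m\<le>n. \<forall>m'\<le>n'. (\<integral>g. wigner_D n m s g * cnj (wigner_D n' m' s' g) \<partial>su2_volume)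
     = (if n = n' \<and> m = m' then lam else 0)"
proof -
  define I where "I m m' = (\<integral>g. wigner_D n m s g * cnj (wigner_D n' m' s' g) \<partial>su2_volume)" for m m'
  define F where "F z z' = (\<integral>g. psiv n s (inv_act g z) * cnj (psiv n' s' (inv_act g z')) \<partial>su2_volume)" for z z'
  have cont: "continuous_on SU2 (\<lambda>g. wigner_D n m s g * cnj (wigner_D n' m' s' g))"
    if "m \<le> n" "m' \<le> n'" for m m'
    by (intro continuous_intros continuous_on_wigner that assms)
  have F: "F z z' = (\<Sum>m\<le>n. psiv n m z * (\<Sum>m'\<le>n'. cnj (psiv n' m' z') * I m m'))" for z z'
  proof -
    have "F z z' = (\<integral>g. (\<Sum>m\<le>n. \<Sum>m'\<le>n'. (psiv n m z * cnj (psiv n' m' z')) *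
        (wigner_D n m s g * cnj (wigner_D n' m' s' g))) \<partial>su2_volume)"
      unfolding F_def wigner_expand[OF assms(1)] wigner_expand[OF assms(2)]
      by (simp add: sum_product mult_ac)
    also have "\<dots> = (\<Sum>m\<le>n. \<integral>g. (\<Sum>m'\<le>n'. (psiv n m z * cnj (psiv n' m' z')) *
        (wigner_D n m s g * cnj (wigner_D n' m' s' g))) \<partial>su2_volume)"
      by (intro Bochner_Integration.integral_sum Bochner_Integration.integrable_sum
          integrable_mult_right integrable_su2_continuous cont) auto
    also have "\<dots> = (\<Sum>m\<le>n. \<Sum>m'\<le>n'. \<integral>g. (psiv n m z * cnj (psiv n' m' z')) *
        (wigner_D n m s g * cnj (wigner_D n' m' s' g)) \<partial>su2_volume)"
      by (intro sum.cong refl Bochner_Integration.integral_sum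
          integrable_mult_right integrable_su2_continuous cont) auto
    also have "\<dots> = (\<Sum>m\<le>n. \<Sum>m'\<le>n'. (psiv n m z * cnj (psiv n' m' z')) * I m m')"
      unfolding I_def by (intro sum.cong refl integral_mult_right_zero)
    finally show ?thesis by (simp add: sum_distrib_left mult_ac)
  qed
  have psiv_meas: "(\<lambda>g. psiv n s (inv_act g z) * cnj (psiv n' s' (inv_act g z'))) \<in> borel_measurable su2_volume" for z z'
    unfolding wigner_expand[OF assms(1)] wigner_expand[OF assms(2)]
    by (intro borel_measurable_su2_volumeI continuous_intros continuous_on_wigner assms) auto
  have F_inv: "F (inv_act k z) (inv_act k z') = F z z'" if "k \<in> SU2" for k z z'
  proof -
    have "F (inv_act k z) (inv_act k z') = (\<integral>g. psiv n s (inv_act (k ** g) z) * cnj (psiv n' s' (inv_act (k ** g) z')) \<partial>su2_volume)"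
      unfolding F_def using that by (intro Bochner_Integration.integral_cong) (auto simp: inv_act_mult)
    also have "\<dots> = F z z'"
      unfolding F_def by (rule integral_left_translate[OF that psiv_meas])
    finally show ?thesis .
  qed
  have F_e0: "F z (1, 0) = (\<Sum>m\<le>n. psiv n m z * I m n')" for z
    unfolding F by (intro sum.cong refl arg_cong2[where f = "(*)"])
      (simp add: psiv_e0 if_distrib[of cnj] if_distrib[of "\<lambda>x. x * _"] cong: if_cong)
  have torus: "I m n' = 0" if "m \<le> n" "2 * m \<noteq> n + n'" for m
  proof -
    \<comment> \<open>\<open>e powi k\<close> is the factor that the diagonal matrix
      \<open>?k\<close> puts on the coefficient with index m. The angle \<open>pi / k\<close> makes
      this factor -1, so the coefficient equals its own negative.\<close>
    define k :: int where "k = 2 * int m - int n - int n'"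
    have k: "k \<noteq> 0" using that by (simp add: k_def)
    define e where "e = cis (pi / of_int k)"
    have ee: "e * cnj e = 1" by (simp add: e_def cis_cnj cis_mult)
    have e0: "e \<noteq> 0" by (simp add: e_def)
    have e': "cnj e = inverse e" using ee e0 by (simp add: field_simps)
    let ?k = "su2_mat (cnj e) 0"
    have kS: "?k \<in> SU2" using ee by (intro SU2_I) (simp add: mult.commute)
    have act: "inv_act ?k z = (e * fst z, cnj e * snd z)" for z by (simp add: inv_act_su2_mat)
    have "(\<Sum>m\<le>n. psiv n m z * (cnj e ^ n' * e ^ m * cnj e ^ (n - m) * I m n')) = (\<Sum>m\<le>n. psiv n m z * I m n')" for z
    proof -
      have "F z (1, 0) = F (inv_act ?k z) (inv_act ?k (1, 0))" by (rule F_inv[OF kS, symmetric])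
      also have "\<dots> = (\<Sum>m\<le>n. psiv n m (inv_act ?k z) * (\<Sum>m'\<le>n'. cnj (psiv n' m' (e * 1, e * 0)) * I m m'))"
        unfolding F act by simp
      also have "\<dots> = (\<Sum>m\<le>n. psiv n m z * (cnj e ^ n' * e ^ m * cnj e ^ (n - m) * I m n'))"
      proof (intro sum.cong refl)
        fix m assume "m \<in> {..n}"
        have "(\<Sum>m'\<le>n'. cnj (psiv n' m' (e * 1, e * 0)) * I m m') = (\<Sum>m'\<le>n'. if m' = n' then cnj e ^ n' * I m m' else 0)"
          by (intro sum.cong refl) (use psiv_scale[of _ n' e "(1, 0)"] in \<open>simp add: psiv_e0\<close>)
        also have "\<dots> = cnj e ^ n' * I m n'" by simp
        finally show "psiv n m (inv_act ?k z) * (\<Sum>m'\<le>n'. cnj (psiv n' m' (e * 1, e * 0)) * I m m')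
            = psiv n m z * (cnj e ^ n' * e ^ m * cnj e ^ (n - m) * I m n')"
          by (simp add: act psiv_def psi_def power_mult_distrib mult_ac)
      qed
      finally show ?thesis by (simp add: F_e0)
    qed
    from psiv_coeff_unique[OF this that(1)]
    have "cnj e ^ n' * e ^ m * cnj e ^ (n - m) * I m n' = I m n'" .
    moreover have "cnj e ^ n' * e ^ m * cnj e ^ (n - m) = e powi k"
    proof -
      have "k = int m + (- int n') + (- int (n - m))" using that by (simp add: k_def of_nat_diff)
      hence "e powi k = e powi (int m) * e powi (- int n') * e powi (- int (n - m))"
        using e0 by (simp only: power_int_add simp_thms)
      thus ?thesis by (simp add: e' power_int_minus power_inverse)
    qed
    moreover have "e powi k = -1"
    proof -
      have "e powi k = cis (of_int k * (pi / of_int k))" unfolding e_def by (rule cis_power_int)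
      also have "of_int k * (pi / of_int k) = pi" using k by simp
      finally show ?thesis by simp
    qed
    ultimately show ?thesis by simp
  qed
  define lam where "lam = I n n'"
  have F_e0': "F z (1, 0) = (if n = n' then lam * fst z ^ n else 0)" for z
  proof -
    have "(\<Sum>m\<le>n. psiv n m z * I m n') = (\<Sum>m\<le>n. if m = n then (if n = n' then lam * fst z ^ n else 0) else 0)"
    proof (intro sum.cong refl)
      \<comment> \<open>As m \<le> n \<le> n', the surviving case 2 m = n + n' forces m = n =
        n'.\<close>
      fix m assume "m \<in> {..n}"
      thus "psiv n m z * I m n' = (if m = n then (if n = n' then lam * fst z ^ n else 0) else 0)"
        using torus[of m] assms(3) by (auto simp: psiv_top lam_def)
    qed
    thus ?thesis by (simp add: F_e0)
  qed
  have I_eq: "(\<Sum>m'\<le>n'. cnj (psiv n' m' z') * I m m') = (\<Sum>m'\<le>n'. cnj (psiv n' m' z') * (if n = n' \<and> m = m' then lam else 0))"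
    if z': "fst z' * cnj (fst z') + snd z' * cnj (snd z') = 1" and m: "m \<le> n" for z' m
  proof (rule psiv_coeff_unique[OF _ m])
    fix z :: "complex \<times> complex"
    \<comment> \<open>The group is transitive on the unit sphere: the element with first column z'
      carries (1, 0) to z', so its inverse carries z' back.\<close>
    let ?k = "su2_mat (fst z') (snd z')"
    have kS: "?k \<in> SU2" using z' by (intro SU2_I)
    have "inv_act ?k z' = (1, 0)" using z' by (simp add: inv_act_su2_mat mult.commute)
    hence "F z z' = F (inv_act ?k z) (1, 0)" using F_inv[OF kS, of z z'] by simp
    also have "\<dots> = (if n = n' then lam * (\<Sum>m\<le>n. psiv n m z * cnj (psiv n m z')) else 0)"
      by (simp add: F_e0' inv_act_su2_mat cnj_psiv psiv_kernel mult.commute)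
    also have "\<dots> = (\<Sum>m\<le>n. psiv n m z * (\<Sum>m'\<le>n'. cnj (psiv n' m' z') * (if n = n' \<and> m = m' then lam else 0)))"
      by (auto simp: sum_distrib_left if_distrib[of "(*) _"] mult_ac cong: if_cong intro!: sum.cong)
    finally show "(\<Sum>m\<le>n. psiv n m z * (\<Sum>m'\<le>n'. cnj (psiv n' m' z') * I m m')) = \<dots>"
      by (simp add: F)
  qed
  have "I m m' = (if n = n' \<and> m = m' then lam else 0)" if "m \<le> n" "m' \<le> n'" for m m'
  proof (rule psiv_coeff_unique_unit[OF _ that(2), of "\<lambda>m'. I m m'"])
    fix w :: "complex \<times> complex" assume w: "fst w * cnj (fst w) + snd w * cnj (snd w) = 1"
    show "(\<Sum>m'\<le>n'. psiv n' m' w * I m m') = (\<Sum>m'\<le>n'. psiv n' m' w * (if n = n' \<and> m = m' then lam else 0))"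
      using I_eq[of "(cnj (fst w), cnj (snd w))", OF _ that(1)] w by (simp add: cnj_psiv mult.commute)
  qed
  thus ?thesis unfolding I_def by blast
qed

text \<open>The constant comes from summing the diagonal integrals over m: n + 1 equal terms add up,
  by unitarity, to the total volume \<open>16 * pi\<^sup>2\<close>. Since
  \<open>wigner_schur\<close> takes the smaller degree first, the opposite order is obtained by
  conjugation.\<close>

lemma wigner_orthogonal:
  assumes "m \<le> n" "s \<le> n" "m' \<le> n'" "s' \<le> n'"
  shows "(\<integral>g. wigner_D n m s g * cnj (wigner_D n' m' s' g) \<partial>su2_volume)
     = (if n = n' \<and> m = m' \<and> s = s' then of_real (16 * pi\<^sup>2 / real (n + 1)) else 0)"
proof -
  consider "n = n'" | "n < n'" | "n' < n" by linarith
  thus ?thesis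
  proof cases
    case 1
    have s': "s' \<le> n" using assms 1 by simp
    from wigner_schur[OF assms(2) assms(4)] 1 obtain lam where lam:
      "\<And>m m'. m \<le> n \<Longrightarrow> m' \<le> n \<Longrightarrow> (\<integral>g. wigner_D n m s g * cnj (wigner_D n m' s' g) \<partial>su2_volume) = (if m = m' then lam else 0)"
      by auto
    have "of_nat (n + 1) * lam = (\<Sum>m\<le>n. \<integral>g. wigner_D n m s g * cnj (wigner_D n m s' g) \<partial>su2_volume)"
      by (simp add: lam)
    also have "\<dots> = (\<integral>g. (\<Sum>m\<le>n. wigner_D n m s g * cnj (wigner_D n m s' g)) \<partial>su2_volume)"
      by (rule Bochner_Integration.integral_sum[symmetric])
        (use assms s' in \<open>auto intro!: integrable_su2_continuous continuous_intros continuous_on_wigner\<close>)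
    also have "\<dots> = (\<integral>g. (if s = s' then 1 else 0) \<partial>su2_volume)"
      by (intro Bochner_Integration.integral_cong) (use assms s' in \<open>auto simp: wigner_unitary\<close>)
    also have "\<dots> = (if s = s' then of_real (16 * pi\<^sup>2) else 0)"
      by (simp add: measure_su2_volume scaleR_conv_of_real)
    finally have *: "of_nat (n + 1) * lam = (if s = s' then of_real (16 * pi\<^sup>2) else 0)" .
    have "lam = of_nat (n + 1) * lam / of_nat (n + 1)" by (simp del: of_nat_Suc of_nat_add)
    hence "lam = (if s = s' then of_real (16 * pi\<^sup>2 / real (n + 1)) else 0)" unfolding * by simp
    thus ?thesis using lam[of m m'] assms 1 by auto
  next
    case 2
    obtain lam where "\<forall>k\<le>n. \<forall>k'\<le>n'. (\<integral>g. wigner_D n k s g * cnj (wigner_D n' k' s' g) \<partial>su2_volume)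
       = (if n = n' \<and> k = k' then lam else 0)"
      using wigner_schur[OF assms(2) assms(4)] 2 by (meson less_imp_le)
    thus ?thesis using assms 2 by simp
  next
    case 3
    have "(\<integral>g. wigner_D n m s g * cnj (wigner_D n' m' s' g) \<partial>su2_volume)
        = cnj (\<integral>g. wigner_D n' m' s' g * cnj (wigner_D n m s g) \<partial>su2_volume)"
      unfolding Bochner_Integration.integral_cnj[symmetric] by (simp add: mult.commute)
    also obtain lam where "\<forall>k\<le>n'. \<forall>k'\<le>n. (\<integral>g. wigner_D n' k s' g * cnj (wigner_D n k' s g) \<partial>su2_volume)
       = (if n' = n \<and> k = k' then lam else 0)"
      using wigner_schur[OF assms(4) assms(2)] 3 by (meson less_imp_le)
    hence "(\<integral>g. wigner_D n' m' s' g * cnj (wigner_D n m s g) \<partial>su2_volume) = 0"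
      using assms 3 by simp
    finally show ?thesis using 3 by simp
  qed
qed

section \<open>Density of the hyperspherical harmonics\<close>

definition hidx :: "(nat \<times> nat \<times> nat) set" where
  "hidx = {(n, m, s). m \<le> n \<and> s \<le> n}"

definition hharm :: "nat \<times> nat \<times> nat \<Rightarrow> complex^2^2 \<Rightarrow> complex" where
  "hharm i = (case i of (n, m, s) \<Rightarrow> hyp_harmonic n m s)"

definition hidx_upto :: "nat \<Rightarrow> (nat \<times> nat \<times> nat) set" where
  "hidx_upto N = {i \<in> hidx. fst i \<le> N}"

lemma finite_hidx_upto [simp]: "finite (hidx_upto N)"
  by (rule finite_subset[of _ "{..N} \<times> {..N} \<times> {..N}"]) (auto simp: hidx_upto_def hidx_def)

lemma hidx_upto_subset: "hidx_upto N \<subseteq> hidx"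
  by (auto simp: hidx_upto_def)

lemma hidx_upto_mono: "M \<le> N \<Longrightarrow> hidx_upto M \<subseteq> hidx_upto N"
  by (auto simp: hidx_upto_def)

lemma continuous_on_hharm: "i \<in> hidx \<Longrightarrow> continuous_on S (hharm i)"
  by (auto simp: hharm_def hidx_def hyp_harmonic_def[abs_def] intro!: continuous_intros continuous_on_wigner)

lemma hharm_orthonormal:
  assumes "i \<in> hidx" "j \<in> hidx"
  shows "(\<integral>g. hharm i g * cnj (hharm j g) \<partial>su2_volume) = (if i = j then 1 else 0)"
proof -
  obtain n m s where i: "i = (n, m, s)" by (cases i) auto
  obtain n' m' s' where j: "j = (n', m', s')" by (cases j) auto
  let ?c = "\<lambda>n. complex_of_real (sqrt (real (n + 1)) / (4 * pi))"
  have "(\<integral>g. hharm i g * cnj (hharm j g) \<partial>su2_volume)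
      = (\<integral>g. (?c n * ?c n') * (wigner_D n m s g * cnj (wigner_D n' m' s' g)) \<partial>su2_volume)"
    by (intro Bochner_Integration.integral_cong) (simp_all add: i j hharm_def hyp_harmonic_def)
  also have "\<dots> = (?c n * ?c n') * (\<integral>g. wigner_D n m s g * cnj (wigner_D n' m' s' g) \<partial>su2_volume)"
    by (rule integral_mult_right_zero)
  also have "\<dots> = (?c n * ?c n') * (if n = n' \<and> m = m' \<and> s = s' then of_real (16 * pi\<^sup>2 / real (n + 1)) else 0)"
    by (subst wigner_orthogonal) (use assms in \<open>auto simp: i j hidx_def\<close>)
  also have "\<dots> = (if i = j then 1 else 0)"
  proof (cases "i = j")
    case True
    have "(sqrt (real (n + 1)) / (4 * pi)) * (sqrt (real (n + 1)) / (4 * pi)) * (16 * pi\<^sup>2 / real (n + 1)) = 1"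
      by (simp add: power2_eq_square del: of_nat_add of_nat_Suc)
    hence "?c n * ?c n * of_real (16 * pi\<^sup>2 / real (n + 1)) = 1"
      unfolding of_real_mult[symmetric] by simp
    thus ?thesis using True by (simp add: i j)
  qed (auto simp: i j)
  finally show ?thesis .
qed

section \<open>The span of the harmonics and its closure under conjugation\<close>

text \<open>Only the values on \<open>SU2\<close> are compared, since the functions live on all
  matrices while identities such as the recursions for \<open>wcoeff\<close> use the group
  relation.\<close>

definition trig :: "(complex^2^2 \<Rightarrow> complex) set" where
  "trig = {f. \<exists>N b. \<forall>g\<in>SU2. f g = (\<Sum>i\<in>hidx_upto N. b i * hharm i g)}"

lemma trigI: "(\<And>g. g \<in> SU2 \<Longrightarrow> f g = (\<Sum>i\<in>hidx_upto N. b i * hharm i g)) \<Longrightarrow> f \<in> trig"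
  by (auto simp: trig_def)

lemma trig_cong: "f \<in> trig \<Longrightarrow> (\<And>g. g \<in> SU2 \<Longrightarrow> h g = f g) \<Longrightarrow> h \<in> trig"
  by (auto simp: trig_def)

text \<open>Padding with zero coefficients raises the degree bound, so that two elements of the span
  can be written over the same index set.\<close>

lemma trig_upto:
  assumes "f \<in> trig"
  obtains N where "\<And>M. N \<le> M \<Longrightarrow> \<exists>b. \<forall>g\<in>SU2. f g = (\<Sum>i\<in>hidx_upto M. b i * hharm i g)"
proof -
  obtain N b where b: "\<forall>g\<in>SU2. f g = (\<Sum>i\<in>hidx_upto N. b i * hharm i g)"
    using assms by (auto simp: trig_def)
  have "\<exists>b. \<forall>g\<in>SU2. f g = (\<Sum>i\<in>hidx_upto M. b i * hharm i g)" if "N \<le> M" for M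
  proof (intro exI ballI)
    fix g assume "g \<in> SU2"
    show "f g = (\<Sum>i\<in>hidx_upto M. (if i \<in> hidx_upto N then b i else 0) * hharm i g)"
      using b \<open>g \<in> SU2\<close> hidx_upto_mono[OF that]
      by (subst sum.mono_neutral_right[of "hidx_upto M" "hidx_upto N"]) auto
  qed
  thus ?thesis using that by blast
qed

lemma trig_add:
  assumes "f \<in> trig" "h \<in> trig"
  shows "(\<lambda>g. f g + h g) \<in> trig"
proof -
  obtain N where N: "\<And>M. N \<le> M \<Longrightarrow> \<exists>b. \<forall>g\<in>SU2. f g = (\<Sum>i\<in>hidx_upto M. b i * hharm i g)"
    using trig_upto[OF assms(1)] by blast
  obtain N' where N': "\<And>M. N' \<le> M \<Longrightarrow> \<exists>b. \<forall>g\<in>SU2. h g = (\<Sum>i\<in>hidx_upto M. b i * hharm i g)"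
    using trig_upto[OF assms(2)] by blast
  obtain b where "\<forall>g\<in>SU2. f g = (\<Sum>i\<in>hidx_upto (max N N'). b i * hharm i g)" using N[of "max N N'"] by auto
  moreover obtain b' where "\<forall>g\<in>SU2. h g = (\<Sum>i\<in>hidx_upto (max N N'). b' i * hharm i g)"
    using N'[of "max N N'"] by auto
  ultimately show ?thesis
    by (intro trigI[where N = "max N N'" and b = "\<lambda>i. b i + b' i"]) (simp add: ring_distribs sum.distrib)
qed

lemma trig_cmult:
  assumes "f \<in> trig"
  shows "(\<lambda>g. c * f g) \<in> trig"
proof -
  obtain N b where b: "\<forall>g\<in>SU2. f g = (\<Sum>i\<in>hidx_upto N. b i * hharm i g)"
    using assms by (auto simp: trig_def)
  thus ?thesis by (intro trigI[where N = N and b = "\<lambda>i. c * b i"]) (simp add: sum_distrib_left mult_ac)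
qed

lemma trig_zero: "(\<lambda>g. 0) \<in> trig"
  by (rule trigI[where N = 0 and b = "\<lambda>_. 0"]) simp

lemma trig_sum: "finite A \<Longrightarrow> (\<And>i. i \<in> A \<Longrightarrow> f i \<in> trig) \<Longrightarrow> (\<lambda>g. \<Sum>i\<in>A. f i g) \<in> trig"
  by (induction A rule: finite_induct) (auto intro: trig_zero trig_add)

lemma trig_hharm:
  assumes "i \<in> hidx" shows "hharm i \<in> trig"
proof (rule trigI[where N = "fst i" and b = "\<lambda>j. if j = i then 1 else 0"])
  fix g
  have "i \<in> hidx_upto (fst i)" using assms by (simp add: hidx_upto_def)
  hence "(\<Sum>j\<in>hidx_upto (fst i). if j = i then hharm j g else 0) = hharm i g" by simp
  thus "hharm i g = (\<Sum>j\<in>hidx_upto (fst i). (if j = i then 1 else 0) * hharm j g)"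
    by (simp add: if_distrib[of "\<lambda>x. x * _"] cong: if_cong)
qed

lemma hharm_wigner:
  "hharm (n, m, s) g = of_real (sqrt (real (n + 1)) / (4 * pi)) * wigner_D n m s g"
  by (simp add: hharm_def hyp_harmonic_def)

lemma trig_wigner:
  assumes "m \<le> n" "s \<le> n"
  shows "wigner_D n m s \<in> trig"
proof (rule trig_cong[OF trig_cmult[OF trig_hharm[of "(n, m, s)"]]])
  show "(n, m, s) \<in> hidx" using assms by (simp add: hidx_def)
  fix g
  have "complex_of_real (sqrt (real (n + 1)) / (4 * pi)) \<noteq> 0"
    unfolding of_real_eq_0_iff by (simp del: of_nat_add of_nat_Suc)
  thus "wigner_D n m s g = inverse (of_real (sqrt (real (n + 1)) / (4 * pi))) * hharm (n, m, s) g"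
    unfolding hharm_wigner mult.assoc[symmetric] by (subst left_inverse) simp_all
qed

text \<open>Reduces a closure property of the span to the Wigner functions. With \<open>q\<close>
  the conjugation it serves \<open>trig_cnj\<close>, with \<open>q\<close> the identity and
  \<open>p\<close> a matrix entry it serves \<open>trig_entry_mult\<close>.\<close>

lemma trig_semilinear_image:
  assumes "f \<in> trig" and wigner: "\<And>n m s. m \<le> n \<Longrightarrow> s \<le> n \<Longrightarrow> (\<lambda>g. p g * q (wigner_D n m s g)) \<in> trig"
    and add: "\<And>x y. q (x + y) = q x + q y" and mult: "\<And>x y. q (x * y) = q x * q y" and zero: "q 0 = (0 :: complex)"
  shows "(\<lambda>g. p g * q (f g)) \<in> trig"
proof -
  obtain N b where b: "\<forall>g\<in>SU2. f g = (\<Sum>i\<in>hidx_upto N. b i * hharm i g)"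
    using assms by (auto simp: trig_def)
  have qsum: "q (\<Sum>i\<in>A. h i) = (\<Sum>i\<in>A. q (h i))" if "finite A" for A and h :: "nat \<times> nat \<times> nat \<Rightarrow> complex"
    using that by (induction A rule: finite_induct) (auto simp: add zero)
  have "(\<lambda>g. \<Sum>i\<in>hidx_upto N. q (b i) * q (of_real (sqrt (real (fst i + 1)) / (4 * pi))) *
      (p g * q (wigner_D (fst i) (fst (snd i)) (snd (snd i)) g))) \<in> trig"
    by (intro trig_sum finite_hidx_upto trig_cmult wigner) (auto simp: hidx_upto_def hidx_def)
  thus ?thesis
  proof (rule trig_cong)
    fix g assume g: "g \<in> SU2"
    show "p g * q (f g) = (\<Sum>i\<in>hidx_upto N. q (b i) * q (of_real (sqrt (real (fst i + 1)) / (4 * pi))) *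
      (p g * q (wigner_D (fst i) (fst (snd i)) (snd (snd i)) g)))"
      unfolding b[rule_format, OF g] qsum[OF finite_hidx_upto] mult sum_distrib_left
    proof (intro sum.cong refl)
      fix i assume "i \<in> hidx_upto N"
      have "hharm i g = of_real (sqrt (real (fst i + 1)) / (4 * pi)) * wigner_D (fst i) (fst (snd i)) (snd (snd i)) g"
        by (metis hharm_wigner prod.collapse)
      thus "p g * (q (b i) * q (hharm i g)) = q (b i) * q (of_real (sqrt (real (fst i + 1)) / (4 * pi))) *
          (p g * q (wigner_D (fst i) (fst (snd i)) (snd (snd i)) g))"
        by (simp only: mult) (simp only: ac_simps)
    qed
  qed
qed

lemma trig_cnj:
  assumes "f \<in> trig"
  shows "(\<lambda>g. cnj (f g)) \<in> trig"
proof -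
  have "(\<lambda>g. 1 * cnj (f g)) \<in> trig"
  proof (rule trig_semilinear_image[OF assms])
    fix n m s :: nat assume ms: "m \<le> n" "s \<le> n"
    show "(\<lambda>g. 1 * cnj (wigner_D n m s g)) \<in> trig"
      unfolding cnj_wigner[OF ms] mult_1_left by (intro trig_cmult trig_wigner) auto
  qed auto
  thus ?thesis by simp
qed

text \<open>The coefficient of \<open>z\<^sub>0\<^sup>m\<close> in \<open>u\<^sup>j v\<^sup>k\<close> at \<open>z\<^sub>1 = 1\<close>, where \<open>(u, v) = g\<inverse> (z\<^sub>0, z\<^sub>1)\<close>: the Wigner function of degree
  \<open>j + k\<close> without its normalization, extended by zero to \<open>m > j + k\<close>.\<close>

definition wcoeff :: "nat \<Rightarrow> nat \<Rightarrow> nat \<Rightarrow> complex^2^2 \<Rightarrow> complex" where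
  "wcoeff j k m g = poly.coeff ([:cnj (g$2$1), cnj (g$1$1):] ^ j * [:g$1$1, - (g$2$1):] ^ k) m"

lemma trig_wcoeff: "wcoeff j k m \<in> trig"
proof (cases "m \<le> j + k")
  case True
  have w: "wcoeff j k m g = of_real (sqrt (real (j + k choose m)) / sqrt (real (j + k choose j))) * wigner_D (j + k) m j g" for g
  proof -
    have "sqrt (real (j + k choose m)) / sqrt (real (j + k choose j)) * (sqrt (real (j + k choose j)) / sqrt (real (j + k choose m))) = 1"
      using True by simp
    hence "complex_of_real (sqrt (real (j + k choose m)) / sqrt (real (j + k choose j))) *
        complex_of_real (sqrt (real (j + k choose j)) / sqrt (real (j + k choose m))) = 1"
      unfolding of_real_mult[symmetric] by simp
    thus ?thesis using True
      by (simp only: wigner_coeff[of m "j + k" j] le_add1 mult.assoc[symmetric] mult_1_left wcoeff_def add_diff_cancel_left')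
  qed
  show ?thesis
    by (rule trig_cong[OF trig_cmult[OF trig_wigner[OF True le_add1]]]) (rule w)
next
  case False
  have "wcoeff j k m g = 0" for g
    unfolding wcoeff_def
  proof (rule coeff_eq_0)
    have "degree ([:cnj (g$2$1), cnj (g$1$1):] ^ j * [:g$1$1, - (g$2$1):] ^ k)
        \<le> degree ([:cnj (g$2$1), cnj (g$1$1):] ^ j) + degree ([:g$1$1, - (g$2$1):] ^ k)"
      by (rule degree_mult_le)
    also have "\<dots> \<le> degree [:cnj (g$2$1), cnj (g$1$1):] * j + degree [:g$1$1, - (g$2$1):] * k"
      by (intro add_mono degree_power_le)
    also have "\<dots> \<le> 1 * j + 1 * k" by (intro add_mono mult_right_mono) auto
    finally show "degree ([:cnj (g$2$1), cnj (g$1$1):] ^ j * [:g$1$1, - (g$2$1):] ^ k) < m"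
      using False by simp
  qed
  thus ?thesis using trig_cong[OF trig_zero] by blast
qed

section \<open>Multiplication by matrix entries and by polynomials\<close>

text \<open>The Leibniz rule in a form that includes j = 0, where the truncated exponent
  \<open>j - 1\<close> stands behind a factor 0.\<close>

lemma pderiv_linear_powers:
  fixes a b c d :: complex
  shows "pderiv ([:a, b:] ^ j * [:c, d:] ^ Suc k) =
    smult (of_nat j * b) ([:a, b:] ^ (j - 1) * [:c, d:] ^ Suc k) + smult (of_nat (Suc k) * d) ([:a, b:] ^ j * [:c, d:] ^ k)"
proof -
  have *: "pderiv ([:a, b:] ^ j) = smult (of_nat j * b) ([:a, b:] ^ (j - 1))" for a b :: complex and j
    by (cases j) (simp_all add: pderiv_power_Suc pderiv_pCons mult.commute del: power_Suc)
  show ?thesis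
    unfolding pderiv_mult * by (simp add: algebra_simps smult_add_right)
qed

text \<open>The two recursions express multiplication by a matrix entry through degrees \<open>j + k + 1\<close> and \<open>j + k - 1\<close>;
  they combine Euler's identity for \<open>u\<^sup>j v\<^sup>k\<^sup>+\<^sup>1\<close> with \<open>z\<^sub>0 = \<alpha> u - cnj \<beta> v\<close> and \<open>z\<^sub>1 = \<beta> u + cnj \<alpha> v\<close>.\<close>

lemma entry_mult_wcoeff:
  assumes "g \<in> SU2"
  shows "of_nat (j + k + 1) * g$1$1 * wcoeff j k m g =
      (of_nat (j + k + 1) - of_nat m) * wcoeff j (Suc k) m g + (if m = 0 \<or> j = 0 then 0 else of_nat j * wcoeff (j - 1) k (m - 1) g)"
    and "of_nat (j + k + 1) * g$2$1 * wcoeff j k m g =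
      (if j = 0 then 0 else of_nat j * wcoeff (j - 1) k m g) - of_nat (Suc m) * wcoeff j (Suc k) (Suc m) g"
proof -
  obtain a b where ab: "g = su2_mat a b" "a * cnj a + b * cnj b = 1" using assms by (rule SU2_E)
  let ?U = "[:cnj b, cnj a:]" and ?V = "[:a, - b:]"
  let ?R = "if j = 0 then 0 else smult (of_nat j) (?U ^ (j - 1) * ?V ^ k)"
  let ?P = "?U ^ j * ?V ^ Suc k"
  \<comment> \<open>With u and v for the values of \<open>?U\<close> and \<open>?V\<close>, the
    second identity is the derivative of \<open>?P\<close> after inserting 1 = \<open>cnj a\<close>
    v + b u into \<open>?R\<close>. The first amounts to the second together with a = v + x
    b.\<close>
  have eqs: "smult (of_nat (j + k + 1) * a) (?U ^ j * ?V ^ k) = smult (of_nat (j + k + 1)) ?P - pCons 0 (pderiv ?P) + pCons 0 ?R"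
    "smult (of_nat (j + k + 1) * b) (?U ^ j * ?V ^ k) = ?R - pderiv ?P"
    unfolding poly_eq_poly_eq_iff[symmetric] fun_eq_iff pderiv_linear_powers
  proof (safe)
    fix x
    let ?u = "cnj b + x * cnj a" and ?v = "a - x * b"
    have uv: "cnj a * ?v + b * ?u = 1" "a * ?u - cnj b * ?v = x"
      using ab(2) by algebra+
    show "poly (smult (of_nat (j + k + 1) * a) (?U ^ j * ?V ^ k)) x = poly (smult (of_nat (j + k + 1)) ?P -
       pCons 0 (smult (of_nat j * cnj a) (?U ^ (j - 1) * ?V ^ Suc k) + smult (of_nat (Suc k) * - b) (?U ^ j * ?V ^ k)) + pCons 0 ?R) x"
    proof (cases j)
      case 0
      thus ?thesis by (simp add: algebra_simps)
    next
      case (Suc i)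
      have "of_nat (j + k + 1) * a * ?u = of_nat (j + k + 1) * (?u * ?v) - x * (of_nat j * cnj a * ?v - of_nat (Suc k) * b * ?u) + x * of_nat j"
      proof -
        have "of_nat (j + k + 1) = of_nat j + (of_nat (Suc k) :: complex)" by simp
        thus ?thesis using uv by algebra
      qed
      hence "(of_nat (j + k + 1) * a * ?u) * (?u ^ i * ?v ^ k) =
        (of_nat (j + k + 1) * (?u * ?v) - x * (of_nat j * cnj a * ?v - of_nat (Suc k) * b * ?u) + x * of_nat j) * (?u ^ i * ?v ^ k)"
        by simp
      thus ?thesis using Suc by (simp add: algebra_simps del: of_nat_Suc of_nat_add)
    qed
    show "poly (smult (of_nat (j + k + 1) * b) (?U ^ j * ?V ^ k)) x = poly (?R -
       (smult (of_nat j * cnj a) (?U ^ (j - 1) * ?V ^ Suc k) + smult (of_nat (Suc k) * - b) (?U ^ j * ?V ^ k))) x"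
    proof (cases j)
      case 0
      thus ?thesis by (simp add: algebra_simps)
    next
      case (Suc i)
      have "of_nat (j + k + 1) * b * ?u = of_nat j - (of_nat j * cnj a * ?v - of_nat (Suc k) * b * ?u)"
      proof -
        have "of_nat (j + k + 1) = of_nat j + (of_nat (Suc k) :: complex)" by simp
        thus ?thesis using uv by algebra
      qed
      hence "(of_nat (j + k + 1) * b * ?u) * (?u ^ i * ?v ^ k) =
        (of_nat j - (of_nat j * cnj a * ?v - of_nat (Suc k) * b * ?u)) * (?u ^ i * ?v ^ k)"
        by simp
      thus ?thesis using Suc by (simp add: algebra_simps del: of_nat_Suc of_nat_add)
    qed
  qed
  have "poly.coeff (smult (of_nat (j + k + 1) * a) (?U ^ j * ?V ^ k)) m
      = poly.coeff (smult (of_nat (j + k + 1)) ?P - pCons 0 (pderiv ?P) + pCons 0 ?R) m" by (simp only: eqs(1))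
  thus "of_nat (j + k + 1) * g$1$1 * wcoeff j k m g =
      (of_nat (j + k + 1) - of_nat m) * wcoeff j (Suc k) m g + (if m = 0 \<or> j = 0 then 0 else of_nat j * wcoeff (j - 1) k (m - 1) g)"
    by (cases m) (simp_all add: ab(1) wcoeff_def coeff_pderiv left_diff_distrib del: of_nat_Suc of_nat_add power_Suc mult_pCons_left mult_pCons_right)
  have "poly.coeff (smult (of_nat (j + k + 1) * b) (?U ^ j * ?V ^ k)) m = poly.coeff (?R - pderiv ?P) m"
    by (simp only: eqs(2))
  thus "of_nat (j + k + 1) * g$2$1 * wcoeff j k m g =
      (if j = 0 then 0 else of_nat j * wcoeff (j - 1) k m g) - of_nat (Suc m) * wcoeff j (Suc k) (Suc m) g"
    by (simp add: ab(1) wcoeff_def coeff_pderiv del: of_nat_Suc of_nat_add power_Suc mult_pCons_left mult_pCons_right)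
qed

text \<open>Solved for the product with an entry, the recursions express it through
  \<open>wcoeff\<close> of the next higher and the next lower degree, hence within the span.\<close>

lemma trig_entry_mult:
  assumes "f \<in> trig"
  shows "(\<lambda>g. g$1$1 * f g) \<in> trig" "(\<lambda>g. g$2$1 * f g) \<in> trig"
proof -
  have w: "(\<lambda>g. g$1$1 * wcoeff j k m g) \<in> trig \<and> (\<lambda>g. g$2$1 * wcoeff j k m g) \<in> trig" for j k m
  proof
    let ?n = "of_nat (j + k + 1) :: complex"
    have n: "?n \<noteq> 0" unfolding of_nat_eq_0_iff by simp
    \<comment> \<open>When m or j is 0 the truncated arguments \<open>m - 1\<close> and
      \<open>j - 1\<close> are meaningless, but the factor in front of that term is 0.\<close>
    have "(\<lambda>g. inverse ?n * ((?n - of_nat m) * wcoeff j (Suc k) m g + (if m = 0 \<or> j = 0 then 0 else of_nat j) * wcoeff (j - 1) k (m - 1) g)) \<in> trig"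
      by (intro trig_cmult trig_add trig_wcoeff)
    thus "(\<lambda>g. g$1$1 * wcoeff j k m g) \<in> trig"
    proof (rule trig_cong)
      fix g :: "complex^2^2" assume g: "g \<in> SU2"
      have "g$1$1 * wcoeff j k m g = inverse ?n * (?n * g$1$1 * wcoeff j k m g)"
        unfolding mult.assoc[symmetric] by (subst left_inverse[OF n]) simp
      thus "g$1$1 * wcoeff j k m g = inverse ?n * ((?n - of_nat m) * wcoeff j (Suc k) m g + (if m = 0 \<or> j = 0 then 0 else of_nat j) * wcoeff (j - 1) k (m - 1) g)"
        unfolding entry_mult_wcoeff(1)[OF g] by auto
    qed
    have "(\<lambda>g. inverse ?n * ((if j = 0 then 0 else of_nat j) * wcoeff (j - 1) k m g + (- of_nat (Suc m)) * wcoeff j (Suc k) (Suc m) g)) \<in> trig"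
      by (intro trig_cmult trig_add trig_wcoeff)
    thus "(\<lambda>g. g$2$1 * wcoeff j k m g) \<in> trig"
    proof (rule trig_cong)
      fix g :: "complex^2^2" assume g: "g \<in> SU2"
      have "g$2$1 * wcoeff j k m g = inverse ?n * (?n * g$2$1 * wcoeff j k m g)"
        unfolding mult.assoc[symmetric] by (subst left_inverse[OF n]) simp
      thus "g$2$1 * wcoeff j k m g = inverse ?n * ((if j = 0 then 0 else of_nat j) * wcoeff (j - 1) k m g + (- of_nat (Suc m)) * wcoeff j (Suc k) (Suc m) g)"
        unfolding entry_mult_wcoeff(2)[OF g] by (simp del: of_nat_Suc of_nat_add)
    qed
  qed
  have D: "wigner_D n m s g = of_real (sqrt (real (n choose s)) / sqrt (real (n choose m))) * wcoeff s (n - s) m g"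
    if "m \<le> n" "s \<le> n" for n m s g
    by (simp only: wcoeff_def wigner_coeff[OF that])
  show "(\<lambda>g. g$1$1 * f g) \<in> trig"
  proof (rule trig_semilinear_image[OF assms, of _ "\<lambda>x. x"])
    fix n m s :: nat assume ms: "m \<le> n" "s \<le> n"
    show "(\<lambda>g. g$1$1 * wigner_D n m s g) \<in> trig"
      by (rule trig_cong[OF trig_cmult[OF conjunct1[OF w[of s "n - s" m]],
            where c = "of_real (sqrt (real (n choose s)) / sqrt (real (n choose m)))"]]) (simp only: D[OF ms] mult.left_commute)
  qed auto
  show "(\<lambda>g. g$2$1 * f g) \<in> trig"
  proof (rule trig_semilinear_image[OF assms, of _ "\<lambda>x. x"])
    fix n m s :: nat assume ms: "m \<le> n" "s \<le> n"
    show "(\<lambda>g. g$2$1 * wigner_D n m s g) \<in> trig"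
      by (rule trig_cong[OF trig_cmult[OF conjunct2[OF w[of s "n - s" m]],
            where c = "of_real (sqrt (real (n choose s)) / sqrt (real (n choose m)))"]]) (simp only: D[OF ms] mult.left_commute)
  qed auto
qed

text \<open>Multiplication by \<open>cnj (p g)\<close> is multiplication by \<open>p g\<close>
  between two conjugations, and the span is closed under both.\<close>

lemma trig_Re_Im_mult:
  assumes f: "f \<in> trig" and p: "\<And>f. f \<in> trig \<Longrightarrow> (\<lambda>g. p g * f g) \<in> trig"
  shows "(\<lambda>g. of_real (Re (p g)) * f g) \<in> trig" "(\<lambda>g. of_real (Im (p g)) * f g) \<in> trig"
proof -
  have c: "(\<lambda>g. cnj (p g) * f g) \<in> trig"
    using trig_cnj[OF p[OF trig_cnj[OF f]]] by simp
  have Re: "of_real (Re z) * w = (1 / 2) * (z * w + cnj z * w)" for z w :: complex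
    by (simp add: complex_eq_iff field_simps)
  have Im: "of_real (Im z) * w = (\<i> / 2) * (cnj z * w + (- 1) * (z * w))" for z w :: complex
    by (simp add: complex_eq_iff field_simps)
  show "(\<lambda>g. of_real (Re (p g)) * f g) \<in> trig" "(\<lambda>g. of_real (Im (p g)) * f g) \<in> trig"
    unfolding Re Im by (intro trig_cmult trig_add p f c)+
qed

lemma trig_one: "(\<lambda>g. 1) \<in> trig"
  by (rule trig_cong[OF trig_wcoeff[of 0 0 0]]) (simp add: wcoeff_def)

text \<open>The induction is on the polynomial as a multiplier of the whole span, since only then
  does the product case reduce to applying two multipliers in turn. The polynomial itself is its
  product with the constant 1.\<close>

lemma trig_polynomial:
  assumes "real_polynomial_function p"
  shows "(\<lambda>g. complex_of_real (p g)) \<in> trig"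
proof -
  have "\<forall>f\<in>trig. (\<lambda>g. complex_of_real (p g) * f g) \<in> trig"
    using assms
  proof (induction rule: real_polynomial_function.induct)
    case (linear q)
    interpret bounded_linear q by fact
    show ?case
    proof
      fix f assume f: "f \<in> trig"
      \<comment> \<open>The matrices \<open>su2_mat a b\<close> form a real space of dimension four,
        the quaternions, with these four units as a basis. On it \<open>q\<close> is a combination
        of the real and imaginary parts of the first column.\<close>
      have "(\<lambda>g. (of_real (q (su2_mat 1 0)) * (of_real (Re (g$1$1)) * f g) + of_real (q (su2_mat \<i> 0)) * (of_real (Im (g$1$1)) * f g)) +
          (of_real (q (su2_mat 0 1)) * (of_real (Re (g$2$1)) * f g) + of_real (q (su2_mat 0 \<i>)) * (of_real (Im (g$2$1)) * f g))) \<in> trig"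
        by (intro trig_add trig_cmult trig_Re_Im_mult f trig_entry_mult)
      thus "(\<lambda>g. complex_of_real (q g) * f g) \<in> trig"
      proof (rule trig_cong)
        fix g :: "complex^2^2" assume "g \<in> SU2"
        then obtain a b where g: "g = su2_mat a b" by (rule SU2_E)
        have "g = Re a *\<^sub>R su2_mat 1 0 + Im a *\<^sub>R su2_mat \<i> 0 + (Re b *\<^sub>R su2_mat 0 1 + Im b *\<^sub>R su2_mat 0 \<i>)"
          by (simp add: g vec_eq_iff forall_2 complex_eq_iff)
        hence "q g = q (Re a *\<^sub>R su2_mat 1 0 + Im a *\<^sub>R su2_mat \<i> 0 + (Re b *\<^sub>R su2_mat 0 1 + Im b *\<^sub>R su2_mat 0 \<i>))"
          by (rule arg_cong)
        also have "\<dots> = Re a * q (su2_mat 1 0) + Im a * q (su2_mat \<i> 0) + (Re b * q (su2_mat 0 1) + Im b * q (su2_mat 0 \<i>))"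
          by (simp only: add scaleR real_scaleR_def)
        finally show "complex_of_real (q g) * f g = (of_real (q (su2_mat 1 0)) * (of_real (Re (g$1$1)) * f g) + of_real (q (su2_mat \<i> 0)) * (of_real (Im (g$1$1)) * f g)) +
          (of_real (q (su2_mat 0 1)) * (of_real (Re (g$2$1)) * f g) + of_real (q (su2_mat 0 \<i>)) * (of_real (Im (g$2$1)) * f g))"
          by (simp add: g algebra_simps)
      qed
    qed
  next
    case (const c)
    show ?case by (auto intro: trig_cmult)
  next
    case (add p q)
    thus ?case by (auto simp: ring_distribs intro: trig_add)
  next
    case (mult p q)
    show ?case
    proof
      fix f assume "f \<in> trig"
      hence "(\<lambda>g. complex_of_real (p g) * (complex_of_real (q g) * f g)) \<in> trig" 
        by (rule bspec[OF mult.IH(1) bspec[OF mult.IH(2)]])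
      thus "(\<lambda>g. complex_of_real (p g * q g) * f g) \<in> trig" by (simp add: mult.assoc)
    qed
  qed
  from bspec[OF this trig_one] show ?thesis by simp
qed

section \<open>The square norm on \<open>L2\<close>\<close>

text \<open>Squares avoid roots in the estimates, at the price of the factors 2 in place of the
  triangle inequality.\<close>

definition sqnorm :: "(complex^2^2 \<Rightarrow> complex) \<Rightarrow> real" where
  "sqnorm f = (\<integral>g. (cmod (f g))\<^sup>2 \<partial>su2_volume)"

lemma L2_dist_eq: "L2_dist f h = sqrt (sqnorm (\<lambda>g. f g - h g))"
  by (simp add: L2_dist_def sqnorm_def)

lemma sqnorm_nonneg [simp]: "0 \<le> sqnorm f"
  unfolding sqnorm_def by (rule integral_nonneg_AE) simp

lemma L2_measurable: "f \<in> L2 \<Longrightarrow> f \<in> borel_measurable su2_volume"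
  by (simp add: L2_def)

lemma L2_integrable: "f \<in> L2 \<Longrightarrow> integrable su2_volume (\<lambda>g. (cmod (f g))\<^sup>2)"
  by (simp add: L2_def)

lemma cmod_add_square_le: "(cmod (x + y))\<^sup>2 \<le> 2 * (cmod x)\<^sup>2 + 2 * (cmod y)\<^sup>2"
proof -
  have "(cmod (x + y))\<^sup>2 \<le> (cmod x + cmod y)\<^sup>2" by (intro power_mono norm_triangle_ineq) auto
  also have "\<dots> \<le> 2 * (cmod x)\<^sup>2 + 2 * (cmod y)\<^sup>2"
    using zero_le_power2[of "cmod x - cmod y"] by (simp add: power2_eq_square algebra_simps)
  finally show ?thesis .
qed

lemma L2_add:
  assumes "f \<in> L2" "h \<in> L2"
  shows "(\<lambda>g. f g + h g) \<in> L2" "sqnorm (\<lambda>g. f g + h g) \<le> 2 * sqnorm f + 2 * sqnorm h"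
proof -
  note [measurable] = L2_measurable[OF assms(1)] L2_measurable[OF assms(2)]
  note I = L2_integrable[OF assms(1)] L2_integrable[OF assms(2)]
  have 1: "integrable su2_volume (\<lambda>g. 2 * (cmod (f g))\<^sup>2 + 2 * (cmod (h g))\<^sup>2)" using I by auto
  have 2: "integrable su2_volume (\<lambda>g. (cmod (f g + h g))\<^sup>2)"
    by (rule Bochner_Integration.integrable_bound[OF 1])
      (use cmod_add_square_le in \<open>auto simp: abs_of_nonneg\<close>)
  thus "(\<lambda>g. f g + h g) \<in> L2" by (simp add: L2_def)
  have "sqnorm (\<lambda>g. f g + h g) \<le> (\<integral>g. 2 * (cmod (f g))\<^sup>2 + 2 * (cmod (h g))\<^sup>2 \<partial>su2_volume)"
    unfolding sqnorm_def by (intro integral_mono 1 2 cmod_add_square_le)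
  also have "\<dots> = 2 * sqnorm f + 2 * sqnorm h" using I by (simp add: sqnorm_def)
  finally show "sqnorm (\<lambda>g. f g + h g) \<le> 2 * sqnorm f + 2 * sqnorm h" .
qed

lemma sqnorm_cmult: "sqnorm (\<lambda>g. c * f g) = (cmod c)\<^sup>2 * sqnorm f"
  by (simp add: sqnorm_def norm_mult power_mult_distrib)

lemma L2_cmult: "f \<in> L2 \<Longrightarrow> (\<lambda>g. c * f g) \<in> L2"
  by (auto simp: L2_def norm_mult power_mult_distrib intro!: borel_measurable_times)

lemma L2_diff:
  assumes "f \<in> L2" "h \<in> L2"
  shows "(\<lambda>g. f g - h g) \<in> L2" "sqnorm (\<lambda>g. f g - h g) \<le> 2 * sqnorm f + 2 * sqnorm h"
  using L2_add[OF assms(1) L2_cmult[OF assms(2), of "-1"]] sqnorm_cmult[of "-1" h] by simp_all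

lemma sqnorm_triangle:
  assumes "f \<in> L2" "h \<in> L2" "k \<in> L2"
  shows "sqnorm (\<lambda>g. f g - k g) \<le> 2 * sqnorm (\<lambda>g. f g - h g) + 2 * sqnorm (\<lambda>g. h g - k g)"
  using L2_add(2)[OF L2_diff(1)[OF assms(1,2)] L2_diff(1)[OF assms(2,3)]] by simp

lemma sqnorm_diff_commute: "sqnorm (\<lambda>g. f g - h g) = sqnorm (\<lambda>g. h g - f g)"
  by (simp add: sqnorm_def norm_minus_commute)

lemma L2_zero: "(\<lambda>_. 0) \<in> L2"
  by (simp add: L2_def)

lemma L2_sum: "finite A \<Longrightarrow> (\<And>i. i \<in> A \<Longrightarrow> f i \<in> L2) \<Longrightarrow> (\<lambda>g. \<Sum>i\<in>A. f i g) \<in> L2"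
  by (induction A rule: finite_induct) (auto intro: L2_zero L2_add)

lemma L2_continuous:
  assumes "continuous_on SU2 f" shows "f \<in> L2"
proof -
  have "integrable su2_volume (\<lambda>g. complex_of_real ((cmod (f g))\<^sup>2))"
    by (intro integrable_su2_continuous continuous_intros assms)
  from integrable_norm[OF this] have "integrable su2_volume (\<lambda>g. (cmod (f g))\<^sup>2)"
    by (simp add: norm_power)
  thus ?thesis using borel_measurable_su2_volumeI[OF assms] by (simp add: L2_def)
qed

lemma L2_hharm: "i \<in> hidx \<Longrightarrow> hharm i \<in> L2"
  by (intro L2_continuous continuous_on_hharm)

lemma borel_measurable_cnj:
  "f \<in> borel_measurable M \<Longrightarrow> (\<lambda>x. cnj (f x)) \<in> borel_measurable M"
  by (rule borel_measurable_continuous_on[of cnj]) (intro continuous_intros)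

lemma integrable_L2_mult:
  assumes "f \<in> L2" "h \<in> L2"
  shows "integrable su2_volume (\<lambda>g. f g * cnj (h g))"
proof -
  note [measurable] = L2_measurable[OF assms(1)] L2_measurable[OF assms(2)]
  have 1: "integrable su2_volume (\<lambda>g. (cmod (f g))\<^sup>2 + (cmod (h g))\<^sup>2)"
    using L2_integrable[OF assms(1)] L2_integrable[OF assms(2)] by auto
  have bd: "cmod (x * cnj y) \<le> (cmod x)\<^sup>2 + (cmod y)\<^sup>2" for x y
  proof -
    have "2 * (cmod x * cmod y) \<le> (cmod x)\<^sup>2 + (cmod y)\<^sup>2"
      using zero_le_power2[of "cmod x - cmod y"] by (simp add: power2_eq_square algebra_simps)
    moreover have "cmod x * cmod y \<ge> 0" by simp
    ultimately show ?thesis unfolding norm_mult complex_mod_cnj by linarith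
  qed
  show ?thesis
    by (rule Bochner_Integration.integrable_bound[OF 1])
      (use bd in \<open>auto simp: abs_of_nonneg intro!: borel_measurable_times borel_measurable_cnj\<close>)
qed

lemma trig_L2:
  assumes "f \<in> trig" shows "f \<in> L2"
proof -
  obtain N b where b: "\<forall>g\<in>SU2. f g = (\<Sum>i\<in>hidx_upto N. b i * hharm i g)"
    using assms by (auto simp: trig_def)
  have "continuous_on SU2 (\<lambda>g. \<Sum>i\<in>hidx_upto N. b i * hharm i g)"
    using hidx_upto_subset by (intro continuous_intros continuous_on_hharm) auto
  with b have "continuous_on SU2 f" by (metis (no_types, lifting) continuous_on_cong)
  thus ?thesis by (rule L2_continuous)
qed

section \<open>From polynomials to all square integrable functions\<close>

definition trig_closure :: "(complex^2^2 \<Rightarrow> complex) set" where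
  "trig_closure = {f \<in> L2. \<forall>e>0. \<exists>p\<in>trig. sqnorm (\<lambda>g. f g - p g) < e}"

lemma trig_closureE:
  assumes "f \<in> trig_closure" "e > 0"
  obtains p where "p \<in> trig" "sqnorm (\<lambda>g. f g - p g) < e"
  using assms unfolding trig_closure_def by auto

lemma trig_closure_add:
  assumes "f \<in> trig_closure" "h \<in> trig_closure"
  shows "(\<lambda>g. f g + h g) \<in> trig_closure"
  unfolding trig_closure_def
proof (safe intro!: L2_add)
  show L: "f \<in> L2" "h \<in> L2" using assms by (auto simp: trig_closure_def)
  fix e :: real assume e: "e > 0"
  hence e4: "e / 4 > 0" by simp
  obtain p where p: "p \<in> trig" "sqnorm (\<lambda>g. f g - p g) < e / 4"
    using trig_closureE[OF assms(1) e4] .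
  obtain q where q: "q \<in> trig" "sqnorm (\<lambda>g. h g - q g) < e / 4"
    using trig_closureE[OF assms(2) e4] .
  have "sqnorm (\<lambda>g. (f g - p g) + (h g - q g)) \<le> 2 * sqnorm (\<lambda>g. f g - p g) + 2 * sqnorm (\<lambda>g. h g - q g)"
    by (intro L2_add L2_diff L trig_L2 p q)
  also have "\<dots> < e" using p q by simp
  finally show "\<exists>p\<in>trig. sqnorm (\<lambda>g. f g + h g - p g) < e"
    by (intro bexI[OF _ trig_add[OF p(1) q(1)]]) (simp add: algebra_simps)
qed

lemma trig_closure_cmult:
  assumes "f \<in> trig_closure"
  shows "(\<lambda>g. c * f g) \<in> trig_closure"
  unfolding trig_closure_def
proof (safe intro!: L2_cmult)
  show "f \<in> L2" using assms by (auto simp: trig_closure_def)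
  fix e :: real assume e: "e > 0"
  have "e / ((cmod c)\<^sup>2 + 1) > 0" using e by (intro divide_pos_pos add_nonneg_pos) auto
  then obtain p where p: "p \<in> trig" "sqnorm (\<lambda>g. f g - p g) < e / ((cmod c)\<^sup>2 + 1)"
    using assms by (auto simp: trig_closure_def)
  have pos: "(cmod c)\<^sup>2 + 1 > 0" by (intro add_nonneg_pos) auto
  have "sqnorm (\<lambda>g. c * f g - c * p g) = (cmod c)\<^sup>2 * sqnorm (\<lambda>g. f g - p g)"
    by (simp add: sqnorm_cmult flip: right_diff_distrib)
  also have "\<dots> \<le> ((cmod c)\<^sup>2 + 1) * sqnorm (\<lambda>g. f g - p g)" by (intro mult_right_mono) auto
  also have "\<dots> < e" using p pos by (simp add: field_simps)
  finally show "\<exists>p\<in>trig. sqnorm (\<lambda>g. c * f g - p g) < e"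
    by (intro bexI[OF _ trig_cmult[OF p(1)]])
qed

lemma L2_cong: "(\<And>g. g \<in> SU2 \<Longrightarrow> f g = h g) \<Longrightarrow> f \<in> L2 \<longleftrightarrow> h \<in> L2"
  unfolding L2_def mem_Collect_eq
  by (intro conj_cong measurable_cong Bochner_Integration.integrable_cong) auto

lemma sqnorm_cong: "(\<And>g. g \<in> SU2 \<Longrightarrow> f g = h g) \<Longrightarrow> sqnorm f = sqnorm h"
  unfolding sqnorm_def by (intro Bochner_Integration.integral_cong) auto

lemma trig_closure_cong:
  assumes "f \<in> trig_closure" "\<And>g. g \<in> SU2 \<Longrightarrow> h g = f g"
  shows "h \<in> trig_closure"
proof -
  have "sqnorm (\<lambda>g. h g - p g) = sqnorm (\<lambda>g. f g - p g)" for p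
    by (rule sqnorm_cong) (simp add: assms(2))
  thus ?thesis using assms(1) L2_cong[OF assms(2)] by (simp add: trig_closure_def)
qed

lemma trig_closure_zero: "(\<lambda>_. 0) \<in> trig_closure"
  unfolding trig_closure_def using L2_zero trig_zero by (auto intro!: bexI[of _ "\<lambda>_. 0"] simp: sqnorm_def)

lemma trig_closure_sum:
  "finite A \<Longrightarrow> (\<And>i. i \<in> A \<Longrightarrow> f i \<in> trig_closure) \<Longrightarrow> (\<lambda>g. \<Sum>i\<in>A. f i g) \<in> trig_closure"
  by (induction A rule: finite_induct) (auto intro: trig_closure_zero trig_closure_add)

lemma trig_closure_limit:
  assumes "f \<in> L2" "\<And>e. e > 0 \<Longrightarrow> \<exists>h\<in>trig_closure. sqnorm (\<lambda>g. f g - h g) < e"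
  shows "f \<in> trig_closure"
  unfolding trig_closure_def
proof (safe intro!: assms(1))
  fix e :: real assume e: "e > 0"
  then obtain h where h: "h \<in> trig_closure" "sqnorm (\<lambda>g. f g - h g) < e / 4"
    using assms(2)[of "e / 4"] by auto
  have e4: "e / 4 > 0" using e by simp
  obtain p where p: "p \<in> trig" "sqnorm (\<lambda>g. h g - p g) < e / 4"
    using trig_closureE[OF h(1) e4] .
  have "sqnorm (\<lambda>g. f g - p g) \<le> 2 * sqnorm (\<lambda>g. f g - h g) + 2 * sqnorm (\<lambda>g. h g - p g)"
    using h(1) trig_L2[OF p(1)] by (intro sqnorm_triangle assms(1)) (auto simp: trig_closure_def)
  also have "\<dots> < e" using h p by simp
  finally show "\<exists>p\<in>trig. sqnorm (\<lambda>g. f g - p g) < e" using p(1) by blast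
qed

lemma trig_closure_continuous:
  fixes f :: "complex^2^2 \<Rightarrow> real"
  assumes f: "continuous_on SU2 f"
  shows "(\<lambda>g. complex_of_real (f g)) \<in> trig_closure"
  unfolding trig_closure_def
proof (safe intro!: L2_continuous continuous_intros f)
  fix e :: real assume e: "e > 0"
  \<comment> \<open>The total volume is \<open>16 * pi\<^sup>2\<close>, so a uniform error below d
    costs at most e / 2 in the square norm.\<close>
  define d where "d = sqrt (e / (32 * pi\<^sup>2))"
  have d: "d > 0" "d\<^sup>2 = e / (32 * pi\<^sup>2)" using e by (auto simp: d_def)
  obtain p where p: "real_polynomial_function p" "\<And>g. g \<in> SU2 \<Longrightarrow> \<bar>f g - p g\<bar> < d"
    using Stone_Weierstrass_real_polynomial_function[OF compact_SU2 f d(1)] by blast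
  have L: "(\<lambda>g. complex_of_real (f g) - of_real (p g)) \<in> L2"
    by (intro L2_diff trig_L2[OF trig_polynomial[OF p(1)]] L2_continuous continuous_intros f)
  have "sqnorm (\<lambda>g. complex_of_real (f g) - of_real (p g)) \<le> (\<integral>g. d\<^sup>2 \<partial>su2_volume)"
    unfolding sqnorm_def
  proof (intro integral_mono L2_integrable[OF L])
    fix g assume "g \<in> space su2_volume"
    hence "\<bar>f g - p g\<bar> \<le> d" using p(2)[of g] by simp
    hence "\<bar>f g - p g\<bar>\<^sup>2 \<le> d\<^sup>2" by (intro power_mono) auto
    thus "(cmod (complex_of_real (f g) - of_real (p g)))\<^sup>2 \<le> d\<^sup>2"
      by (simp flip: of_real_diff)
  qed simp
  also have "\<dots> = e / 2" by (simp add: measure_su2_volume d)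
  also have "\<dots> < e" using e by simp
  finally show "\<exists>p\<in>trig. sqnorm (\<lambda>g. complex_of_real (f g) - p g) < e"
    by (intro bexI[OF _ trig_polynomial[OF p(1)]])
qed

text \<open>Regularity encloses A between a compact K and an open U whose measures differ by less
  than e. A Urysohn function that is 1 on K and 0 off U differs from the indicator only on U - K,
  and there by at most 1.\<close>

lemma trig_closure_indicator:
  assumes A: "A \<in> sets su2_volume"
  shows "(\<lambda>g. complex_of_real (indicator A g)) \<in> trig_closure"
proof (rule trig_closure_limit)
  let ?f = "\<lambda>g. complex_of_real (indicator A g)"
  have [measurable]: "A \<in> sets su2_volume" by fact
  have meas: "?f \<in> borel_measurable su2_volume" by measurable
  have "integrable su2_volume (\<lambda>g. (cmod (?f g))\<^sup>2)"
    by (rule su2.integrable_const_bound[of _ 1]) (auto simp: indicator_def)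
  thus "?f \<in> L2" using meas by (simp add: L2_def)
  fix e :: real assume e: "e > 0"
  \<comment> \<open>Regularity is stated for finite Borel measures on a whole type, so the volume is
    pushed forward to the space of all matrices.\<close>
  define \<nu> where "\<nu> = distr su2_volume borel (\<lambda>g. g)"
  have idm: "(\<lambda>g. g) \<in> borel_measurable su2_volume"
    by (intro borel_measurable_su2_volumeI continuous_intros)
  have fin: "emeasure \<nu> (space \<nu>) \<noteq> \<infinity>"
    using idm by (simp add: \<nu>_def emeasure_distr su2_volume_total)
  have AB: "A \<in> sets borel" "A \<subseteq> SU2"
    using A SU2_borel by (auto simp: sets_su2_volume sets_restrict_space_iff)
  have em: "emeasure \<nu> B = emeasure su2_volume (B \<inter> SU2)" if "B \<in> sets borel" for B
    using idm that by (simp add: \<nu>_def emeasure_distr)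
  interpret \<nu>: finite_measure \<nu> using fin by (intro finite_measureI) auto
  have sb: "sets \<nu> = sets borel" by (simp add: \<nu>_def)
  obtain K where K: "K \<subseteq> A" "compact K" "measure \<nu> A < measure \<nu> K + e / 2"
  proof -
    have "\<exists>K. K \<subseteq> A \<and> compact K \<and> measure \<nu> A < measure \<nu> K + e / 2"
    proof (rule ccontr)
      assume "\<not> ?thesis"
      hence *: "measure \<nu> K \<le> measure \<nu> A - e / 2" if "K \<subseteq> A" "compact K" for K
        using that by force
      have "emeasure \<nu> A \<le> ennreal (measure \<nu> A - e / 2)"
        unfolding inner_regular[OF sb fin AB(1)]
        by (rule SUP_least) (auto simp: \<nu>.emeasure_eq_measure intro!: ennreal_leI *)
      moreover have "0 \<le> measure \<nu> A - e / 2" using *[of "{}"] by simp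
      ultimately show False using e by (simp add: \<nu>.emeasure_eq_measure ennreal_le_iff)
    qed
    thus ?thesis using that by blast
  qed
  obtain U where U: "A \<subseteq> U" "open U" "measure \<nu> U < measure \<nu> A + e / 2"
  proof -
    have "(INF U\<in>{U. A \<subseteq> U \<and> open U}. emeasure \<nu> U) < emeasure \<nu> A + ennreal (e / 2)"
      unfolding outer_regular[OF sb fin AB(1), symmetric]
      using e by (simp add: \<nu>.emeasure_eq_measure ennreal_less_iff flip: ennreal_plus)
    then obtain U where "A \<subseteq> U" "open U" "emeasure \<nu> U < emeasure \<nu> A + ennreal (e / 2)"
      by (auto simp: INF_less_iff)
    thus ?thesis using e that
      by (simp add: \<nu>.emeasure_eq_measure ennreal_less_iff flip: ennreal_plus)
  qed
  have KU: "closed K" "closed (- U)" "K \<inter> - U = {}"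
    using K U by (auto intro: compact_imp_closed)
  obtain h :: "complex^2^2 \<Rightarrow> real" where h: "continuous_on UNIV h" "\<And>x. h x \<in> closed_segment 1 0"
    "\<And>x. x \<in> K \<Longrightarrow> h x = 1" "\<And>x. x \<in> - U \<Longrightarrow> h x = 0"
    using Urysohn[OF KU, of 1 0] by metis
  have h01: "0 \<le> h x" "h x \<le> 1" for x
    using h(2)[of x] by (auto simp: closed_segment_eq_real_ivl)
  have KUm: "U - K \<in> sets borel" using K(2) U(2) by (intro sets.Diff borel_open borel_compact)
  hence KUs: "(U - K) \<inter> SU2 \<in> sets su2_volume"
    using SU2_borel by (auto simp: sets_su2_volume sets_restrict_space_iff)
  have hL: "(\<lambda>g. ?f g - complex_of_real (h g)) \<in> L2"
    using h(1) by (intro L2_diff \<open>?f \<in> L2\<close> L2_continuous continuous_intros) (auto intro: continuous_on_subset)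
  have "sqnorm (\<lambda>g. ?f g - complex_of_real (h g)) \<le> (\<integral>g. indicator ((U - K) \<inter> SU2) g \<partial>su2_volume)"
    unfolding sqnorm_def
  proof (intro integral_mono L2_integrable[OF hL])
    show "integrable su2_volume (indicator ((U - K) \<inter> SU2) :: _ \<Rightarrow> real)"
      using KUs by (intro integrable_real_indicator) (auto simp: su2.emeasure_eq_measure)
    fix g assume g: "g \<in> space su2_volume"
    have "\<bar>indicator A g - h g\<bar>\<^sup>2 \<le> indicator ((U - K) \<inter> SU2) g"
    proof (cases "g \<in> U - K")
      case True
      have "\<bar>indicator A g - h g\<bar> \<le> 1" using h01[of g] by (auto simp: indicator_def)
      hence "\<bar>indicator A g - h g\<bar>\<^sup>2 \<le> 1" by (intro power_le_one) auto
      thus ?thesis using True g by simp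
    next
      case False
      then consider "g \<in> K" | "g \<in> - U" by auto
      hence "indicator A g = h g"
      proof cases
        case 1
        hence "g \<in> A" using K(1) by auto
        thus ?thesis using h(3)[OF 1] by simp
      next
        case 2
        hence "g \<notin> A" using U(1) by auto
        thus ?thesis using h(4)[OF 2] by simp
      qed
      thus ?thesis by simp
    qed
    thus "(cmod (?f g - complex_of_real (h g)))\<^sup>2 \<le> indicator ((U - K) \<inter> SU2) g"
      unfolding of_real_diff[symmetric] norm_of_real .
  qed
  also have "\<dots> = measure \<nu> (U - K)"
    using KUs em[OF KUm] by (simp add: measure_def)
  also have "\<dots> = measure \<nu> U - measure \<nu> K"
    using K U by (intro \<nu>.finite_measure_Diff) (auto simp: sb borel_compact)
  also have "\<dots> < e" using K(3) U(3) by simp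
  finally have *: "sqnorm (\<lambda>g. ?f g - complex_of_real (h g)) < e" .
  have "(\<lambda>g. complex_of_real (h g)) \<in> trig_closure"
    using h(1) by (intro trig_closure_continuous) (auto intro: continuous_on_subset)
  with * show "\<exists>h\<in>trig_closure. sqnorm (\<lambda>g. ?f g - h g) < e"
    by (rule bexI[of "\<lambda>h. sqnorm (\<lambda>g. ?f g - h g) < e"])
qed

text \<open>The simple functions converging to f pointwise can be bounded by 2 |f|. The squared
  error is then at most (2 + 2 * 4) times the square of |f|, and dominated convergence turns
  pointwise convergence into convergence in \<open>L2\<close>.\<close>

lemma trig_dense:
  assumes f: "f \<in> L2" and e: "e > 0"
  shows "\<exists>p\<in>trig. sqnorm (\<lambda>g. f g - p g) < e"
proof -
  note fm[measurable] = L2_measurable[OF f]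
  from borel_measurable_implies_sequence_metric[OF fm, of 0] obtain s where
    "(\<forall>i. simple_function su2_volume (s i)) \<and> (\<forall>g\<in>space su2_volume. (\<lambda>i. s i g) \<longlonglongrightarrow> f g) \<and>
     (\<forall>i. \<forall>g\<in>space su2_volume. dist (s i g) 0 \<le> 2 * dist (f g) 0)" ..
  hence s: "\<And>i. simple_function su2_volume (s i)"
    "\<And>g. g \<in> SU2 \<Longrightarrow> (\<lambda>i. s i g) \<longlonglongrightarrow> f g" "\<And>i g. g \<in> SU2 \<Longrightarrow> cmod (s i g) \<le> 2 * cmod (f g)"
    by simp_all
  have sm[measurable]: "s i \<in> borel_measurable su2_volume" for i
    using s(1) by (rule borel_measurable_simple_function)
  have bd: "(cmod (f g - s i g))\<^sup>2 \<le> 10 * (cmod (f g))\<^sup>2" if "g \<in> SU2" for g i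
  proof -
    have "(cmod (f g + - s i g))\<^sup>2 \<le> 2 * (cmod (f g))\<^sup>2 + 2 * (cmod (- s i g))\<^sup>2" by (rule cmod_add_square_le)
    moreover have "(cmod (s i g))\<^sup>2 \<le> (2 * cmod (f g))\<^sup>2" using s(3)[OF that] by (intro power_mono) auto
    ultimately show ?thesis by (simp add: power_mult_distrib)
  qed
  have sc: "s i \<in> trig_closure" for i
  proof -
    have "(\<lambda>g. \<Sum>y\<in>s i ` SU2. y * complex_of_real (indicator (s i -` {y} \<inter> SU2) g)) \<in> trig_closure"
    proof (intro trig_closure_sum trig_closure_cmult trig_closure_indicator)
      show "finite (s i ` SU2)" using s(1)[of i] by (simp add: simple_function_def)
      fix y assume "y \<in> s i ` SU2"
      thus "s i -` {y} \<inter> SU2 \<in> sets su2_volume" using s(1)[of i] by (auto simp: simple_function_def)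
    qed
    thus ?thesis
    proof (rule trig_closure_cong)
      fix g assume g: "g \<in> SU2"
      have "(\<Sum>y\<in>s i ` SU2. y * complex_of_real (indicator (s i -` {y} \<inter> SU2) g)) = (\<Sum>y\<in>s i ` SU2. if y = s i g then y else 0)"
        using g by (intro sum.cong) (auto simp: indicator_def)
      also have "\<dots> = s i g" using s(1)[of i] g by (subst sum.delta) (auto simp: simple_function_def)
      finally show "s i g = (\<Sum>y\<in>s i ` SU2. y * complex_of_real (indicator (s i -` {y} \<inter> SU2) g))" ..
    qed
  qed
  have lim: "(\<lambda>i. sqnorm (\<lambda>g. f g - s i g)) \<longlonglongrightarrow> (\<integral>g. 0 \<partial>su2_volume)"
    unfolding sqnorm_def
  proof (rule integral_dominated_convergence)
    show "integrable su2_volume (\<lambda>g. 10 * (cmod (f g))\<^sup>2)" using L2_integrable[OF f] by simp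
    show "AE g in su2_volume. (\<lambda>i. (cmod (f g - s i g))\<^sup>2) \<longlonglongrightarrow> 0"
    proof (rule AE_I2)
      fix g assume "g \<in> space su2_volume"
      hence "(\<lambda>i. (cmod (f g - s i g))\<^sup>2) \<longlonglongrightarrow> (cmod (f g - f g))\<^sup>2"
        using s(2)[of g] by (intro tendsto_intros) auto
      thus "(\<lambda>i. (cmod (f g - s i g))\<^sup>2) \<longlonglongrightarrow> 0" by simp
    qed
  qed (use bd in auto)
  have "f \<in> trig_closure"
  proof (rule trig_closure_limit[OF f])
    fix e :: real assume "e > 0"
    with lim have "\<forall>\<^sub>F i in sequentially. sqnorm (\<lambda>g. f g - s i g) < e"
      by (simp add: order_tendsto_iff)
    then obtain i where "sqnorm (\<lambda>g. f g - s i g) < e" by (auto simp: eventually_sequentially)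
    thus "\<exists>h\<in>trig_closure. sqnorm (\<lambda>g. f g - h g) < e" using sc by blast
  qed
  thus ?thesis using e by (auto simp: trig_closure_def)
qed

section \<open>Coefficients and Parseval's identity\<close>

text \<open>The value 0 outside \<open>hidx\<close> makes the coefficients a function on a whole
  countable type, which carries its own Borel sets.\<close>

definition hcoeff :: "(complex^2^2 \<Rightarrow> complex) \<Rightarrow> nat \<times> nat \<times> nat \<Rightarrow> complex" where
  "hcoeff f i = (if i \<in> hidx then \<integral>g. f g * cnj (hharm i g) \<partial>su2_volume else 0)"

text \<open>Completing the square in the \<open>b i\<close>. The formula yields at once that the
  Fourier coefficients give the best approximation, Bessel's inequality, and continuity of the
  distance in the \<open>b i\<close>.\<close>

lemma sqnorm_diff_trig:
  assumes f: "f \<in> L2"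
  shows "sqnorm (\<lambda>g. f g - (\<Sum>i\<in>hidx_upto N. b i * hharm i g))
    = sqnorm f - (\<Sum>i\<in>hidx_upto N. (cmod (hcoeff f i))\<^sup>2) + (\<Sum>i\<in>hidx_upto N. (cmod (hcoeff f i - b i))\<^sup>2)"
proof -
  let ?J = "hidx_upto N"
  let ?p = "\<lambda>g. \<Sum>i\<in>?J. b i * hharm i g"
  have J: "i \<in> ?J \<Longrightarrow> i \<in> hidx" for i using hidx_upto_subset by blast
  have pL: "?p \<in> L2" by (intro L2_sum L2_cmult L2_hharm J) simp
  have fp: "(\<integral>g. f g * cnj (?p g) \<partial>su2_volume) = (\<Sum>i\<in>?J. cnj (b i) * hcoeff f i)"
  proof -
    have "(\<integral>g. f g * cnj (?p g) \<partial>su2_volume) = (\<integral>g. (\<Sum>i\<in>?J. cnj (b i) * (f g * cnj (hharm i g))) \<partial>su2_volume)"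
      by (simp add: sum_distrib_left mult_ac)
    also have "\<dots> = (\<Sum>i\<in>?J. \<integral>g. cnj (b i) * (f g * cnj (hharm i g)) \<partial>su2_volume)"
      by (intro Bochner_Integration.integral_sum integrable_mult_right integrable_L2_mult f L2_hharm J)
    finally show ?thesis by (simp add: hcoeff_def J)
  qed
  have hp: "(\<integral>g. hharm i g * cnj (?p g) \<partial>su2_volume) = cnj (b i)" if "i \<in> ?J" for i
  proof -
    have "(\<integral>g. hharm i g * cnj (?p g) \<partial>su2_volume) = (\<integral>g. (\<Sum>j\<in>?J. cnj (b j) * (hharm i g * cnj (hharm j g))) \<partial>su2_volume)"
      by (simp add: sum_distrib_left mult_ac)
    also have "\<dots> = (\<Sum>j\<in>?J. \<integral>g. cnj (b j) * (hharm i g * cnj (hharm j g)) \<partial>su2_volume)"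
      by (intro Bochner_Integration.integral_sum integrable_mult_right integrable_L2_mult L2_hharm J that)
    also have "\<dots> = (\<Sum>j\<in>?J. if j = i then cnj (b j) else 0)"
      using that by (intro sum.cong refl) (simp add: hharm_orthonormal J)
    finally show ?thesis using that by simp
  qed
  have pp: "(\<integral>g. ?p g * cnj (?p g) \<partial>su2_volume) = (\<Sum>i\<in>?J. b i * cnj (b i))"
  proof -
    have "(\<integral>g. ?p g * cnj (?p g) \<partial>su2_volume) = (\<integral>g. (\<Sum>i\<in>?J. b i * (hharm i g * cnj (?p g))) \<partial>su2_volume)"
      by (simp only: sum_distrib_right mult.assoc)
    also have "\<dots> = (\<Sum>i\<in>?J. \<integral>g. b i * (hharm i g * cnj (?p g)) \<partial>su2_volume)"
      by (intro Bochner_Integration.integral_sum integrable_mult_right integrable_L2_mult L2_hharm J pL)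
    also have "\<dots> = (\<Sum>i\<in>?J. b i * cnj (b i))"
      by (intro sum.cong refl) (simp only: integral_mult_right_zero hp)
    finally show ?thesis .
  qed
  have pf: "(\<integral>g. ?p g * cnj (f g) \<partial>su2_volume) = cnj (\<Sum>i\<in>?J. cnj (b i) * hcoeff f i)"
    unfolding fp[symmetric] Bochner_Integration.integral_cnj[symmetric] by (simp add: mult.commute)
  have sq: "complex_of_real (sqnorm h) = (\<integral>g. h g * cnj (h g) \<partial>su2_volume)" for h
    unfolding sqnorm_def by (simp only: complex_norm_square[symmetric] integral_complex_of_real)
  have "complex_of_real (sqnorm (\<lambda>g. f g - ?p g)) = (\<integral>g. f g * cnj (f g) - f g * cnj (?p g) - ?p g * cnj (f g) + ?p g * cnj (?p g) \<partial>su2_volume)"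
    unfolding sq by (intro Bochner_Integration.integral_cong refl) (simp only: complex_cnj_diff, simp only: algebra_simps)
  also have "\<dots> = (\<integral>g. f g * cnj (f g) \<partial>su2_volume) - (\<integral>g. f g * cnj (?p g) \<partial>su2_volume)
      - (\<integral>g. ?p g * cnj (f g) \<partial>su2_volume) + (\<integral>g. ?p g * cnj (?p g) \<partial>su2_volume)"
    using integrable_L2_mult[OF f f] integrable_L2_mult[OF f pL] integrable_L2_mult[OF pL f] integrable_L2_mult[OF pL pL]
    by (simp only: Bochner_Integration.integral_add Bochner_Integration.integral_diff
        Bochner_Integration.integrable_add Bochner_Integration.integrable_diff)
  also have "\<dots> = complex_of_real (sqnorm f) - (\<Sum>i\<in>?J. hcoeff f i * cnj (hcoeff f i))
     + (\<Sum>i\<in>?J. (hcoeff f i - b i) * cnj (hcoeff f i - b i))"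
    unfolding fp pf pp sq by (simp add: sum.distrib sum_subtractf algebra_simps)
  also have "\<dots> = complex_of_real (sqnorm f - (\<Sum>i\<in>?J. (cmod (hcoeff f i))\<^sup>2) + (\<Sum>i\<in>?J. (cmod (hcoeff f i - b i))\<^sup>2))"
    by (simp only: complex_norm_square of_real_sum of_real_add of_real_diff)
  finally show ?thesis by (simp only: of_real_eq_iff)
qed

definition psum :: "nat \<Rightarrow> (nat \<times> nat \<times> nat \<Rightarrow> complex) \<Rightarrow> complex^2^2 \<Rightarrow> complex" where
  "psum N a g = (\<Sum>i\<in>hidx_upto N. a i * hharm i g)"

lemma psum_L2: "psum N a \<in> L2"
  unfolding psum_def[abs_def] using hidx_upto_subset by (intro L2_sum L2_cmult L2_hharm) auto

lemma sqnorm_diff_psum: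
  "f \<in> L2 \<Longrightarrow> sqnorm (\<lambda>g. f g - psum N (hcoeff f) g) = sqnorm f - (\<Sum>i\<in>hidx_upto N. (cmod (hcoeff f i))\<^sup>2)"
  by (simp add: psum_def sqnorm_diff_trig)

text \<open>By density some element of the span is close to f, and from its degree on the partial
  sums, being best approximations, are at least as close.\<close>

lemma psum_tendsto:
  assumes f: "f \<in> L2"
  shows "(\<lambda>N. sqnorm (\<lambda>g. f g - psum N (hcoeff f) g)) \<longlonglongrightarrow> 0"
proof (rule LIMSEQ_I)
  fix e :: real assume "e > 0"
  then obtain p where p: "p \<in> trig" "sqnorm (\<lambda>g. f g - p g) < e" using trig_dense[OF f] by blast
  obtain N0 where N0: "\<And>N. N0 \<le> N \<Longrightarrow> \<exists>b. \<forall>g\<in>SU2. p g = (\<Sum>i\<in>hidx_upto N. b i * hharm i g)"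
    using trig_upto[OF p(1)] by blast
  show "\<exists>N0. \<forall>N\<ge>N0. norm (sqnorm (\<lambda>g. f g - psum N (hcoeff f) g) - 0) < e"
  proof (intro exI allI impI)
    fix N assume "N0 \<le> N"
    then obtain b where b: "\<forall>g\<in>SU2. p g = (\<Sum>i\<in>hidx_upto N. b i * hharm i g)" using N0 by blast
    have "sqnorm (\<lambda>g. f g - psum N (hcoeff f) g) \<le> sqnorm (\<lambda>g. f g - (\<Sum>i\<in>hidx_upto N. b i * hharm i g))"
      unfolding sqnorm_diff_psum[OF f] sqnorm_diff_trig[OF f] by (simp add: sum_nonneg)
    also have "\<dots> = sqnorm (\<lambda>g. f g - p g)"
      unfolding sqnorm_def using b by (intro Bochner_Integration.integral_cong) auto
    also have "\<dots> < e" by fact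
    finally show "norm (sqnorm (\<lambda>g. f g - psum N (hcoeff f) g) - 0) < e" by simp
  qed
qed

lemma parseval:
  assumes "f \<in> L2"
  shows "(\<lambda>N. \<Sum>i\<in>hidx_upto N. (cmod (hcoeff f i))\<^sup>2) \<longlonglongrightarrow> sqnorm f"
  using tendsto_diff[OF tendsto_const[of "sqnorm f"] psum_tendsto[OF assms]]
  by (simp add: sqnorm_diff_psum[OF assms])

section \<open>The Borel sets of the function space\<close>

lemma hcoeff_outside [simp]: "i \<notin> hidx \<Longrightarrow> hcoeff f i = 0"
  by (simp add: hcoeff_def)

lemma hcoeff_cong: "(\<And>g. g \<in> SU2 \<Longrightarrow> f g = h g) \<Longrightarrow> hcoeff f = hcoeff h"
  by (auto simp: hcoeff_def fun_eq_iff intro!: Bochner_Integration.integral_cong)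

lemma hcoeff_diff:
  assumes "f \<in> L2" "h \<in> L2"
  shows "hcoeff (\<lambda>g. f g - h g) i = hcoeff f i - hcoeff h i"
proof (cases "i \<in> hidx")
  case True
  have "(\<integral>g. (f g - h g) * cnj (hharm i g) \<partial>su2_volume)
      = (\<integral>g. f g * cnj (hharm i g) - h g * cnj (hharm i g) \<partial>su2_volume)"
    by (simp only: left_diff_distrib)
  also have "\<dots> = (\<integral>g. f g * cnj (hharm i g) \<partial>su2_volume) - (\<integral>g. h g * cnj (hharm i g) \<partial>su2_volume)"
    by (intro Bochner_Integration.integral_diff integrable_L2_mult assms L2_hharm True)
  finally show ?thesis using True by (simp add: hcoeff_def)
qed simp

lemma bessel_single:
  assumes "f \<in> L2"
  shows "(cmod (hcoeff f i))\<^sup>2 \<le> sqnorm f"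
proof (cases "i \<in> hidx")
  case True
  hence i: "i \<in> hidx_upto (fst i)" by (simp add: hidx_upto_def)
  have "(cmod (hcoeff f i))\<^sup>2 \<le> (\<Sum>j\<in>hidx_upto (fst i). (cmod (hcoeff f j))\<^sup>2)"
    by (rule member_le_sum[OF i]) auto
  also have "\<dots> \<le> sqnorm f"
    using sqnorm_diff_psum[OF assms, of "fst i"] sqnorm_nonneg[of "\<lambda>g. f g - psum (fst i) (hcoeff f) g"] by linarith
  finally show ?thesis .
qed simp

lemma L2_openI:
  assumes "U \<subseteq> L2" "\<And>f. f \<in> U \<Longrightarrow> \<exists>e>0. \<forall>h\<in>L2. sqnorm (\<lambda>g. f g - h g) < e \<longrightarrow> h \<in> U"
  shows "L2_open U"
  unfolding L2_open_def
proof (safe)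
  fix f assume "f \<in> U"
  then obtain e where e: "e > 0" "\<forall>h\<in>L2. sqnorm (\<lambda>g. f g - h g) < e \<longrightarrow> h \<in> U" using assms(2) by blast
  show "\<exists>\<epsilon>>0. \<forall>h\<in>L2. L2_dist f h < \<epsilon> \<longrightarrow> h \<in> U"
    using e by (intro exI[of _ "sqrt e"]) (simp add: L2_dist_eq)
qed (use assms(1) in blast)

lemma L2_openD:
  assumes "L2_open U" "f \<in> U"
  obtains e where "e > 0" "\<And>h. h \<in> L2 \<Longrightarrow> sqnorm (\<lambda>g. f g - h g) < e \<Longrightarrow> h \<in> U"
proof -
  obtain e where e: "e > 0" "\<forall>h\<in>L2. L2_dist f h < e \<longrightarrow> h \<in> U"
    using assms unfolding L2_open_def by blast
  have "h \<in> U" if "h \<in> L2" "sqnorm (\<lambda>g. f g - h g) < e\<^sup>2" for h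
  proof -
    have "sqrt (sqnorm (\<lambda>g. f g - h g)) < e"
      using that(2) e(1) by (intro real_less_lsqrt) auto
    thus ?thesis using e(2) that(1) by (simp add: L2_dist_eq)
  qed
  thus ?thesis using e(1) that[of "e\<^sup>2"] by simp
qed

lemma L2_open_subset: "L2_open U \<Longrightarrow> U \<subseteq> L2"
  by (simp add: L2_open_def)

lemma space_L2_borel [simp]: "space L2_borel = L2"
  unfolding L2_borel_def by (rule space_measure_of) (auto dest: L2_open_subset)

lemma sets_L2_borel: "sets L2_borel = sigma_sets L2 {U. L2_open U}"
  unfolding L2_borel_def by (rule sets_measure_of) (auto dest: L2_open_subset)

text \<open>For a countable index type the Borel sets of the product topology form the product
  sigma-algebra, so coordinates suffice.\<close>

lemma borel_measurable_family:
  fixes f :: "'a \<Rightarrow> 'i::countable \<Rightarrow> complex"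
  assumes "\<And>i. (\<lambda>x. f x i) \<in> borel_measurable M"
  shows "f \<in> borel_measurable M"
proof -
  have "f \<in> M \<rightarrow>\<^sub>M Pi\<^sub>M UNIV (\<lambda>_. borel)"
    using assms by (intro measurable_PiM_single') auto
  thus ?thesis using measurable_cong_sets[OF refl sets_PiM_equal_borel] by blast
qed

lemma borel_measurable_coordinate: "(\<lambda>a :: 'i \<Rightarrow> complex. a i) \<in> borel_measurable borel"
  by (intro borel_measurable_continuous_onI continuous_on_product_coordinates)

text \<open>By Bessel's inequality for a difference each coefficient is Lipschitz with constant 1,
  hence preimages of open sets are open in \<open>L2\<close>.\<close>

lemma hcoeff_measurable: "hcoeff \<in> L2_borel \<rightarrow>\<^sub>M borel"
proof (rule borel_measurable_family, rule borel_measurableI)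
  fix i and S :: "complex set" assume S: "open S"
  have "L2_open ((\<lambda>f. hcoeff f i) -` S \<inter> L2)"
  proof (rule L2_openI)
    fix f assume f: "f \<in> (\<lambda>f. hcoeff f i) -` S \<inter> L2"
    then obtain e where e: "e > 0" "ball (hcoeff f i) e \<subseteq> S"
      using S by (auto simp: open_contains_ball)
    have "h \<in> (\<lambda>f. hcoeff f i) -` S \<inter> L2" if h: "h \<in> L2" "sqnorm (\<lambda>g. f g - h g) < e\<^sup>2" for h
    proof -
      have "(cmod (hcoeff f i - hcoeff h i))\<^sup>2 \<le> sqnorm (\<lambda>g. f g - h g)"
        using bessel_single[OF L2_diff(1)[of f h], of i] f h by (simp add: hcoeff_diff)
      hence "(cmod (hcoeff f i - hcoeff h i))\<^sup>2 < e\<^sup>2" using h by simp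
      hence "cmod (hcoeff f i - hcoeff h i) < e" by (rule power2_less_imp_less[OF _ less_imp_le[OF e(1)]])
      hence "hcoeff h i \<in> ball (hcoeff f i) e" by (simp add: dist_norm)
      thus ?thesis using e(2) h(1) by blast
    qed
    thus "\<exists>e>0. \<forall>h\<in>L2. sqnorm (\<lambda>g. f g - h g) < e \<longrightarrow> h \<in> (\<lambda>f. hcoeff f i) -` S \<inter> L2"
      using zero_less_power[OF e(1), of 2] by blast
  qed simp
  thus "(\<lambda>f. hcoeff f i) -` S \<inter> space L2_borel \<in> sets L2_borel"
    unfolding space_L2_borel sets_L2_borel by (intro sigma_sets.Basic) simp
qed

text \<open>An open set \<open>U\<close> consists of the \<open>f\<close> that are, for some \<open>N\<close> and \<open>r\<close>, \<open>r\<close>-close to their partial sum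
  of degree \<open>N\<close> while \<open>U\<close> contains the \<open>r\<close>-neighbourhood of that sum. Both conditions concern the
  coefficients only: the first by Parseval, the second because it is a closed condition on finitely many of them.\<close>

lemma L2_borel_vimage:
  assumes "A \<in> sets L2_borel"
  obtains B where "B \<in> sets borel" "A = hcoeff -` B \<inter> L2"
proof -
  have "sigma_sets L2 {U. L2_open U} \<subseteq> sets (vimage_algebra L2 hcoeff borel)"
  proof (rule sets.sigma_sets_subset'[where M = "vimage_algebra L2 hcoeff borel", simplified])
    show "{U. L2_open U} \<subseteq> sets (vimage_algebra L2 hcoeff borel)"
    proof safe
      fix U assume U: "L2_open U"
      define S where "S N a = (\<Sum>i\<in>hidx_upto N. (cmod (a i))\<^sup>2)" for N and a :: "nat \<times> nat \<times> nat \<Rightarrow> complex"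
      \<comment> \<open>For a vector that is not square summable \<open>lim\<close> may be
        arbitrary. Only coefficient vectors of functions in \<open>L2\<close> are inserted, and for
        them the difference is the squared distance to the partial sum.\<close>
      define P where "P k N = {a. lim (\<lambda>M. S M a) - S N a < inverse (real (Suc k))}" for k N
      define Q where "Q k N = {a. \<forall>h\<in>L2. sqnorm (\<lambda>g. h g - psum N a g) < inverse (real (Suc k)) \<longrightarrow> h \<in> U}" for k N
      note [measurable] = borel_measurable_coordinate
      have S_meas[measurable]: "S N \<in> borel_measurable borel" for N
        unfolding S_def by measurable
      have P: "P k N \<in> sets borel" for k N
        unfolding P_def by measurable
      have Q: "Q k N \<in> sets borel" for k N
      proof -
        \<comment> \<open>The union is uncountable, so its members have to be open and not merely
          Borel.\<close>
        have "- Q k N = (\<Union>h\<in>L2 - U. {a. sqnorm (\<lambda>g. h g - psum N a g) < inverse (real (Suc k))})"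
          by (auto simp: Q_def)
        moreover have "open {a. sqnorm (\<lambda>g. h g - psum N a g) < inverse (real (Suc k))}" if "h \<in> L2" for h
          unfolding psum_def sqnorm_diff_trig[OF that]
          by (intro open_Collect_less continuous_intros continuous_on_product_coordinates)
        ultimately have "open (- Q k N)" by auto
        thus ?thesis by (simp add: closed_def borel_closed)
      qed
      have lim: "lim (\<lambda>M. S M (hcoeff f)) = sqnorm f" if "f \<in> L2" for f
        unfolding S_def by (intro limI parseval that)
      have P_iff: "hcoeff f \<in> P k N \<longleftrightarrow> sqnorm (\<lambda>g. f g - psum N (hcoeff f) g) < inverse (real (Suc k))"
        if "f \<in> L2" for f k N
        unfolding P_def mem_Collect_eq lim[OF that] sqnorm_diff_psum[OF that] unfolding S_def ..
      have "U = hcoeff -` (\<Union>k. \<Union>N. P k N \<inter> Q k N) \<inter> L2"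
      proof (intro equalityI subsetI)
        fix f assume f: "f \<in> U"
        hence fL: "f \<in> L2" using U L2_open_subset by blast
        obtain e where e: "e > 0" "\<And>h. h \<in> L2 \<Longrightarrow> sqnorm (\<lambda>g. f g - h g) < e \<Longrightarrow> h \<in> U"
          using L2_openD[OF U f] by blast
        \<comment> \<open>Both distances in the triangle estimate carry a factor 2, so a radius
          below e / 4 keeps the neighbourhood of the partial sum inside U.\<close>
        obtain k where k: "inverse (real (Suc k)) < e / 4"
          using reals_Archimedean[of "e / 4"] e(1) by auto
        have "\<forall>\<^sub>F N in sequentially. sqnorm (\<lambda>g. f g - psum N (hcoeff f) g) < inverse (real (Suc k))"
          using psum_tendsto[OF fL] by (rule order_tendstoD) simp
        then obtain N where N: "sqnorm (\<lambda>g. f g - psum N (hcoeff f) g) < inverse (real (Suc k))"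
          by (auto simp: eventually_sequentially)
        have "hcoeff f \<in> Q k N"
          unfolding Q_def
        proof safe
          fix h assume h: "h \<in> L2" "sqnorm (\<lambda>g. h g - psum N (hcoeff f) g) < inverse (real (Suc k))"
          have "sqnorm (\<lambda>g. f g - h g) \<le> 2 * sqnorm (\<lambda>g. f g - psum N (hcoeff f) g) + 2 * sqnorm (\<lambda>g. psum N (hcoeff f) g - h g)"
            by (rule sqnorm_triangle[OF fL psum_L2 h(1)])
          also have "\<dots> < e" using N h(2) k sqnorm_diff_commute[of h "psum N (hcoeff f)"] by simp
          finally show "h \<in> U" using e(2) h(1) by blast
        qed
        thus "f \<in> hcoeff -` (\<Union>k. \<Union>N. P k N \<inter> Q k N) \<inter> L2" using N fL P_iff[OF fL] by auto
      next
        fix f assume "f \<in> hcoeff -` (\<Union>k. \<Union>N. P k N \<inter> Q k N) \<inter> L2"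
        then obtain k N where f: "f \<in> L2" "hcoeff f \<in> P k N" "hcoeff f \<in> Q k N" by auto
        \<comment> \<open>\<open>P\<close> places f itself in the neighbourhood that
          \<open>Q\<close> puts inside U.\<close>
        thus "f \<in> U" using P_iff[OF f(1)] by (auto simp: Q_def)
      qed
      moreover have "(\<Union>k. \<Union>N. P k N \<inter> Q k N) \<in> sets borel" using P Q by auto
      ultimately show "U \<in> sets (vimage_algebra L2 hcoeff borel)"
        by (auto simp: sets_vimage_algebra2)
    qed
    show "L2 \<in> sets (vimage_algebra L2 hcoeff borel)"
      using sets.top[of "vimage_algebra L2 hcoeff borel"] by simp
  qed
  hence "A \<in> sets (vimage_algebra L2 hcoeff borel)" using assms by (auto simp: sets_L2_borel)
  thus ?thesis using that by (auto simp: sets_vimage_algebra2)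
qed

section \<open>Measurability and laws in \<open>L2\<close> through coefficients\<close>

lemma measurable_L2_borelI:
  assumes "\<And>\<omega>. \<omega> \<in> space M \<Longrightarrow> F \<omega> \<in> L2" "\<And>i. (\<lambda>\<omega>. hcoeff (F \<omega>) i) \<in> borel_measurable M"
  shows "F \<in> M \<rightarrow>\<^sub>M L2_borel"
proof (rule measurableI)
  fix A assume "A \<in> sets L2_borel"
  then obtain B where B: "B \<in> sets borel" "A = hcoeff -` B \<inter> L2" by (rule L2_borel_vimage)
  have "(\<lambda>\<omega>. hcoeff (F \<omega>)) \<in> borel_measurable M" by (rule borel_measurable_family[OF assms(2)])
  from measurable_sets[OF this B(1)] have "(\<lambda>\<omega>. hcoeff (F \<omega>)) -` B \<inter> space M \<in> sets M" .
  moreover have "F -` A \<inter> space M = (\<lambda>\<omega>. hcoeff (F \<omega>)) -` B \<inter> space M"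
    using assms(1) by (auto simp: B(2))
  ultimately show "F -` A \<inter> space M \<in> sets M" by simp
qed (use assms in simp)

lemma distr_L2_borel_eqI:
  assumes F: "F \<in> M \<rightarrow>\<^sub>M L2_borel" and G: "G \<in> M \<rightarrow>\<^sub>M L2_borel"
    and eq: "distr M borel (\<lambda>\<omega>. hcoeff (F \<omega>)) = distr M borel (\<lambda>\<omega>. hcoeff (G \<omega>))"
  shows "distr M L2_borel F = distr M L2_borel G"
proof (rule measure_eqI)
  fix A assume "A \<in> sets (distr M L2_borel F)"
  hence A: "A \<in> sets L2_borel" by simp
  then obtain B where B: "B \<in> sets borel" "A = hcoeff -` B \<inter> L2" by (rule L2_borel_vimage)
  have *: "emeasure (distr M L2_borel H) A = emeasure (distr M borel (\<lambda>\<omega>. hcoeff (H \<omega>))) B"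
    if H: "H \<in> M \<rightarrow>\<^sub>M L2_borel" for H
  proof -
    have "H -` A \<inter> space M = (\<lambda>\<omega>. hcoeff (H \<omega>)) -` B \<inter> space M"
      using measurable_space[OF H] by (auto simp: B(2))
    thus ?thesis using A B(1) H measurable_compose[OF H hcoeff_measurable] by (simp add: emeasure_distr)
  qed
  show "emeasure (distr M L2_borel F) A = emeasure (distr M L2_borel G) A"
    by (simp only: *[OF F] *[OF G] eq)
qed simp

text \<open>Finite measures on an infinite product agree if they agree on the cylinders over
  finitely many indices, and each side of such a cylinder is a preimage under
  \<open>hcoeff\<close>.\<close>

lemma distr_PiM_L2_borel_eqI:
  fixes F G :: "'w \<Rightarrow> 'i \<Rightarrow> complex^2^2 \<Rightarrow> complex"
  assumes "finite_measure M"
    and F: "F \<in> M \<rightarrow>\<^sub>M (\<Pi>\<^sub>M i\<in>UNIV. L2_borel)" and G: "G \<in> M \<rightarrow>\<^sub>M (\<Pi>\<^sub>M i\<in>UNIV. L2_borel)"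
    and eq: "distr M (\<Pi>\<^sub>M i\<in>UNIV. borel) (\<lambda>\<omega> i. hcoeff (F \<omega> i)) = distr M (\<Pi>\<^sub>M i\<in>UNIV. borel) (\<lambda>\<omega> i. hcoeff (G \<omega> i))"
  shows "distr M (\<Pi>\<^sub>M i\<in>UNIV. L2_borel) F = distr M (\<Pi>\<^sub>M i\<in>UNIV. L2_borel) G"
proof (rule measure_eqI_PiM_infinite)
  interpret finite_measure M by fact
  show "finite_measure (distr M (\<Pi>\<^sub>M i\<in>UNIV. L2_borel) F)" using F by (rule finite_measure_distr)
  fix A :: "'i \<Rightarrow> _ set" and J :: "'i set"
  assume J: "finite J" "\<And>i. i \<in> J \<Longrightarrow> A i \<in> sets L2_borel"
  have "\<exists>B. \<forall>i\<in>J. B i \<in> sets borel \<and> A i = hcoeff -` B i \<inter> L2"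
    using J(2) L2_borel_vimage by (intro bchoice) metis
  then obtain B where B: "\<And>i. i \<in> J \<Longrightarrow> B i \<in> sets borel" "\<And>i. i \<in> J \<Longrightarrow> A i = hcoeff -` B i \<inter> L2" by blast
  let ?A = "prod_emb UNIV (\<lambda>_. L2_borel) J (Pi\<^sub>E J A)" and ?B = "prod_emb UNIV (\<lambda>_. borel) J (Pi\<^sub>E J B)"
  have A_meas: "?A \<in> sets (\<Pi>\<^sub>M i\<in>UNIV. L2_borel)" using J by (intro sets_PiM_I) auto
  have B_meas: "?B \<in> sets (\<Pi>\<^sub>M i\<in>UNIV. borel)" using J B by (intro sets_PiM_I) auto
  have *: "emeasure (distr M (\<Pi>\<^sub>M i\<in>UNIV. L2_borel) H) ?A = emeasure (distr M (\<Pi>\<^sub>M i\<in>UNIV. borel) (\<lambda>\<omega> i. hcoeff (H \<omega> i))) ?B"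
    if H: "H \<in> M \<rightarrow>\<^sub>M (\<Pi>\<^sub>M i\<in>UNIV. L2_borel)" for H :: "'w \<Rightarrow> 'i \<Rightarrow> complex^2^2 \<Rightarrow> complex"
  proof -
    have HL: "H \<omega> i \<in> L2" if "\<omega> \<in> space M" for \<omega> i
      using measurable_space[OF H that] by (auto simp: space_PiM)
    have Hi: "(\<lambda>\<omega>. hcoeff (H \<omega> i)) \<in> borel_measurable M" for i
      using measurable_compose[OF measurable_compose[OF H measurable_component_singleton[of i]] hcoeff_measurable] by simp
    have Hc: "(\<lambda>\<omega> i. hcoeff (H \<omega> i)) \<in> M \<rightarrow>\<^sub>M (\<Pi>\<^sub>M i\<in>UNIV. borel)"
      by (intro measurable_PiM_single') (auto simp: Hi)
    have "H -` ?A \<inter> space M = (\<lambda>\<omega> i. hcoeff (H \<omega> i)) -` ?B \<inter> space M"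
    proof -
      have "H \<omega> \<in> ?A \<longleftrightarrow> (\<lambda>i. hcoeff (H \<omega> i)) \<in> ?B" if \<omega>: "\<omega> \<in> space M" for \<omega>
      proof -
        have "H \<omega> j \<in> A j \<longleftrightarrow> hcoeff (H \<omega> j) \<in> B j" if "j \<in> J" for j
          using HL[OF \<omega>] B(2)[OF that] by simp
        thus ?thesis using HL[OF \<omega>] by (simp add: prod_emb_iff PiE_iff)
      qed
      thus ?thesis by blast
    qed
    thus ?thesis using H Hc A_meas B_meas by (simp add: emeasure_distr)
  qed
  show "emeasure (distr M (\<Pi>\<^sub>M i\<in>UNIV. L2_borel) F) ?A = emeasure (distr M (\<Pi>\<^sub>M i\<in>UNIV. L2_borel) G) ?A"
    by (simp only: *[OF F] *[OF G] eq)
qed auto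

section \<open>Components and translations\<close>

definition hdeg :: "nat \<Rightarrow> (nat \<times> nat \<times> nat) set" where
  "hdeg n = {i \<in> hidx. fst i = n}"

text \<open>Taking a coefficient vector instead of a field as argument makes the value at a fixed
  point a Borel function of that vector.\<close>

definition proj :: "nat \<Rightarrow> (nat \<times> nat \<times> nat \<Rightarrow> complex) \<Rightarrow> complex^2^2 \<Rightarrow> complex" where
  "proj n a g = (\<Sum>i\<in>hdeg n. a i * hharm i g)"

lemma hdeg_eq: "hdeg n = (\<lambda>(m, s). (n, m, s)) ` ({..n} \<times> {..n})"
  by (auto simp: hdeg_def hidx_def)

lemma finite_hdeg [simp]: "finite (hdeg n)"
  by (simp add: hdeg_eq)

lemma sum_hdeg: "(\<Sum>i\<in>hdeg n. u i) = (\<Sum>m\<le>n. \<Sum>s\<le>n. u (n, m, s))"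
  unfolding hdeg_eq sum.cartesian_product by (subst sum.reindex) (auto simp: inj_on_def case_prod_beta)

lemma hdeg_hidx: "i \<in> hdeg n \<Longrightarrow> i \<in> hidx"
  by (simp add: hdeg_def)

lemma component_eq_proj: "component X n \<omega> g = proj n (hcoeff (X \<omega>)) g"
  unfolding component_def proj_def sum_hdeg coefficient_def
  by (intro sum.cong refl) (simp add: hcoeff_def hidx_def hharm_def)

lemma continuous_on_proj: "continuous_on S (proj n a)"
  unfolding proj_def[abs_def] by (intro continuous_intros continuous_on_hharm hdeg_hidx)

lemma proj_L2: "proj n a \<in> L2"
  by (intro L2_continuous continuous_on_proj)

lemma hcoeff_proj: "hcoeff (proj n a) i = (if i \<in> hdeg n then a i else 0)"
proof (cases "i \<in> hidx")
  case True
  have "(\<integral>g. proj n a g * cnj (hharm i g) \<partial>su2_volume) = (\<integral>g. (\<Sum>j\<in>hdeg n. a j * (hharm j g * cnj (hharm i g))) \<partial>su2_volume)"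
    by (simp add: proj_def sum_distrib_right mult.assoc)
  also have "\<dots> = (\<Sum>j\<in>hdeg n. \<integral>g. a j * (hharm j g * cnj (hharm i g)) \<partial>su2_volume)"
    by (intro Bochner_Integration.integral_sum integrable_mult_right integrable_L2_mult L2_hharm True hdeg_hidx)
  also have "\<dots> = (\<Sum>j\<in>hdeg n. if j = i then a j else 0)"
    by (intro sum.cong refl) (simp add: hharm_orthonormal True hdeg_hidx)
  finally show ?thesis using True by (simp add: hcoeff_def)
qed (auto dest: hdeg_hidx)

lemma proj_hcoeff_proj: "proj n (hcoeff (proj n a)) = proj n a"
  by (simp add: proj_def hcoeff_proj fun_eq_iff cong: sum.cong)

section \<open>Translations and the projections to a degree\<close>

text \<open>One form for left, right and two-sided translations, so that each fact about
  translations is proved once.\<close>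

definition su2_translation :: "(complex^2^2 \<Rightarrow> complex^2^2) \<Rightarrow> bool" where
  "su2_translation \<tau> \<longleftrightarrow> (\<exists>k\<in>SU2. \<exists>k'\<in>SU2. \<forall>h\<in>SU2. \<tau> h = k ** h ** k')"

lemma su2_translation_left: "k \<in> SU2 \<Longrightarrow> su2_translation (\<lambda>h. k ** h)"
  unfolding su2_translation_def using SU2_one by (metis matrix_mul_rid)

lemma su2_translation_right: "k \<in> SU2 \<Longrightarrow> su2_translation (\<lambda>h. h ** k)"
  unfolding su2_translation_def using SU2_one by (metis matrix_mul_lid)

lemma su2_translation_SU2: "su2_translation \<tau> \<Longrightarrow> g \<in> SU2 \<Longrightarrow> \<tau> g \<in> SU2"
  by (auto simp: su2_translation_def SU2_mult)

lemma su2_translation_measurable: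
  assumes "su2_translation \<tau>" shows "\<tau> \<in> su2_volume \<rightarrow>\<^sub>M su2_volume"
proof -
  obtain k k' where k: "k \<in> SU2" "k' \<in> SU2" "\<And>h. h \<in> SU2 \<Longrightarrow> \<tau> h = k ** h ** k'"
    using assms by (auto simp: su2_translation_def)
  have "(\<lambda>h. k ** h ** k') \<in> su2_volume \<rightarrow>\<^sub>M su2_volume"
    using measurable_compose[OF translation_measurable(1)[OF k(1)] translation_measurable(2)[OF k(2)]] .
  thus ?thesis using k(3) by (subst measurable_cong) auto
qed

lemma su2_translation_preserves:
  assumes "su2_translation \<tau>" shows "distr su2_volume su2_volume \<tau> = su2_volume"
proof -
  obtain k k' where k: "k \<in> SU2" "k' \<in> SU2" "\<And>h. h \<in> SU2 \<Longrightarrow> \<tau> h = k ** h ** k'"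
    using assms by (auto simp: su2_translation_def)
  have "distr su2_volume su2_volume \<tau> = distr su2_volume su2_volume ((\<lambda>h. h ** k') \<circ> (\<lambda>h. k ** h))"
    by (rule distr_cong) (simp_all add: k)
  also have "\<dots> = distr (distr su2_volume su2_volume (\<lambda>h. k ** h)) su2_volume (\<lambda>h. h ** k')"
    by (rule distr_distr[symmetric]) (intro translation_measurable k)+
  finally show ?thesis by (simp add: left_translation_preserves right_translation_preserves k)
qed

lemma integral_su2_translation:
  fixes f :: "complex^2^2 \<Rightarrow> 'a::{banach, second_countable_topology}"
  assumes "su2_translation \<tau>" "f \<in> borel_measurable su2_volume"
  shows "(\<integral>g. f (\<tau> g) \<partial>su2_volume) = (\<integral>g. f g \<partial>su2_volume)"
  using integral_distr[OF su2_translation_measurable[OF assms(1)] assms(2)]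
  by (simp add: su2_translation_preserves[OF assms(1)])

lemma L2_translate:
  assumes \<tau>: "su2_translation \<tau>" and f: "f \<in> L2"
  shows "(\<lambda>g. f (\<tau> g)) \<in> L2"
proof -
  have "integrable (distr su2_volume su2_volume \<tau>) (\<lambda>g. (cmod (f g))\<^sup>2)"
    using L2_integrable[OF f] by (simp add: su2_translation_preserves[OF \<tau>])
  hence "integrable su2_volume (\<lambda>g. (cmod (f (\<tau> g)))\<^sup>2)"
    by (rule integrable_distr[OF su2_translation_measurable[OF \<tau>]])
  thus ?thesis
    using measurable_compose[OF su2_translation_measurable[OF \<tau>] L2_measurable[OF f]] by (simp add: L2_def)
qed

lemma SU2_inv_mult:
  assumes "g \<in> SU2" "h \<in> SU2"
  shows "matrix_inv (g ** h) = matrix_inv h ** matrix_inv g"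
proof -
  have "matrix_inv (g ** h) ** (g ** h) ** (matrix_inv h ** matrix_inv g) = matrix_inv h ** matrix_inv g"
    using SU2_inv(2)[OF SU2_mult[OF assms]] by simp
  moreover have "(g ** h) ** (matrix_inv h ** matrix_inv g) = mat 1"
    using SU2_inv(3)[OF assms(1)] SU2_inv(3)[OF assms(2)] by (metis matrix_mul_assoc matrix_mul_rid)
  ultimately show ?thesis by (metis matrix_mul_assoc matrix_mul_rid)
qed

text \<open>The kernel of the projection is a multiple of the character at \<open>g h\<inverse>\<close>, which is also its value at
  \<open>h\<inverse> g\<close>; hence it is bi-invariant.\<close>

lemma kernel_translation:
  assumes \<tau>: "su2_translation \<tau>" and gh: "g \<in> SU2" "h \<in> SU2"
  shows "(\<Sum>i\<in>hdeg n. hharm i (\<tau> g) * cnj (hharm i (\<tau> h))) = (\<Sum>i\<in>hdeg n. hharm i g * cnj (hharm i h))"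
proof -
  define K where "K g h = (\<Sum>i\<in>hdeg n. hharm i g * cnj (hharm i h))" for g h
  define ch where "ch g = (\<Sum>m\<le>n. wigner_D n m m g)" for g
  let ?c = "complex_of_real (sqrt (real (n + 1)) / (4 * pi))"
  have K: "K g h = ?c * ?c * ch (g ** matrix_inv h)" "K g h = ?c * ?c * ch (matrix_inv h ** g)"
    if "g \<in> SU2" "h \<in> SU2" for g h
  proof -
    have "K g h = ?c * ?c * (\<Sum>m\<le>n. \<Sum>s\<le>n. wigner_D n m s g * wigner_D n s m (matrix_inv h))"
      unfolding K_def sum_hdeg sum_distrib_left hharm_wigner complex_cnj_mult complex_cnj_complex_of_real
      by (intro sum.cong refl) (simp add: wigner_inv[OF that(2)] mult_ac)
    moreover have "(\<Sum>m\<le>n. \<Sum>s\<le>n. wigner_D n m s g * wigner_D n s m (matrix_inv h)) = ch (g ** matrix_inv h)"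
      unfolding ch_def using that by (intro sum.cong refl) (simp add: wigner_mult SU2_inv)
    moreover have "(\<Sum>m\<le>n. \<Sum>s\<le>n. wigner_D n m s g * wigner_D n s m (matrix_inv h)) = ch (matrix_inv h ** g)"
      unfolding ch_def using that by (subst sum.swap, intro sum.cong refl) (simp add: wigner_mult SU2_inv mult.commute)
    ultimately show "K g h = ?c * ?c * ch (g ** matrix_inv h)" "K g h = ?c * ?c * ch (matrix_inv h ** g)" by simp_all
  qed
  have right: "K (g ** k) (h ** k) = K g h" if "k \<in> SU2" "g \<in> SU2" "h \<in> SU2" for k g h
  proof -
    have "(g ** k) ** matrix_inv (h ** k) = g ** matrix_inv h"
    proof -
      have "(g ** k) ** matrix_inv (h ** k) = g ** (k ** matrix_inv k) ** matrix_inv h"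
        using that by (simp only: SU2_inv_mult matrix_mul_assoc)
      thus ?thesis using that by (simp add: SU2_inv)
    qed
    thus ?thesis using that by (simp add: K(1) SU2_mult)
  qed
  have left: "K (k ** g) (k ** h) = K g h" if "k \<in> SU2" "g \<in> SU2" "h \<in> SU2" for k g h
  proof -
    have "matrix_inv (k ** h) ** (k ** g) = matrix_inv h ** g"
    proof -
      have "matrix_inv (k ** h) ** (k ** g) = matrix_inv h ** (matrix_inv k ** k) ** g"
        using that by (simp only: SU2_inv_mult matrix_mul_assoc)
      thus ?thesis using that by (simp add: SU2_inv)
    qed
    thus ?thesis using that by (simp add: K(2) SU2_mult)
  qed
  obtain k k' where k: "k \<in> SU2" "k' \<in> SU2" "\<And>h. h \<in> SU2 \<Longrightarrow> \<tau> h = k ** h ** k'"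
    using \<tau> by (auto simp: su2_translation_def)
  have "K (\<tau> g) (\<tau> h) = K g h" using gh k by (simp add: right left SU2_mult)
  thus ?thesis by (simp add: K_def)
qed

lemma proj_hcoeff_integral:
  assumes "f \<in> L2"
  shows "proj n (hcoeff f) g = (\<integral>h. f h * (\<Sum>i\<in>hdeg n. hharm i g * cnj (hharm i h)) \<partial>su2_volume)"
proof -
  have "(\<integral>h. f h * (\<Sum>i\<in>hdeg n. hharm i g * cnj (hharm i h)) \<partial>su2_volume)
      = (\<integral>h. (\<Sum>i\<in>hdeg n. hharm i g * (f h * cnj (hharm i h))) \<partial>su2_volume)"
    by (simp add: sum_distrib_left mult_ac)
  also have "\<dots> = (\<Sum>i\<in>hdeg n. \<integral>h. hharm i g * (f h * cnj (hharm i h)) \<partial>su2_volume)"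
    by (intro Bochner_Integration.integral_sum integrable_mult_right integrable_L2_mult assms L2_hharm hdeg_hidx)
  also have "\<dots> = proj n (hcoeff f) g"
    unfolding proj_def by (intro sum.cong refl) (simp add: hcoeff_def hdeg_hidx)
  finally show ?thesis ..
qed

text \<open>Change of variables by \<tau> in the integral against the kernel, followed by the
  invariance of the kernel.\<close>

lemma proj_translate:
  assumes \<tau>: "su2_translation \<tau>" and f: "f \<in> L2" and g: "g \<in> SU2"
  shows "proj n (hcoeff f) (\<tau> g) = proj n (hcoeff (\<lambda>h. f (\<tau> h))) g"
proof -
  have "continuous_on SU2 (\<lambda>h. \<Sum>i\<in>hdeg n. hharm i (\<tau> g) * cnj (hharm i h))"
    by (intro continuous_intros continuous_on_hharm hdeg_hidx)
  hence m: "(\<lambda>h. f h * (\<Sum>i\<in>hdeg n. hharm i (\<tau> g) * cnj (hharm i h))) \<in> borel_measurable su2_volume"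
    by (intro borel_measurable_times L2_measurable f borel_measurable_su2_volumeI)
  have "proj n (hcoeff f) (\<tau> g) = (\<integral>h. f (\<tau> h) * (\<Sum>i\<in>hdeg n. hharm i (\<tau> g) * cnj (hharm i (\<tau> h))) \<partial>su2_volume)"
    unfolding proj_hcoeff_integral[OF f] by (rule integral_su2_translation[OF \<tau> m, symmetric])
  also have "\<dots> = (\<integral>h. f (\<tau> h) * (\<Sum>i\<in>hdeg n. hharm i g * cnj (hharm i h)) \<partial>su2_volume)"
    using g by (intro Bochner_Integration.integral_cong refl) (simp add: kernel_translation[OF \<tau>])
  also have "\<dots> = proj n (hcoeff (\<lambda>h. f (\<tau> h))) g"
    by (rule proj_hcoeff_integral[OF L2_translate[OF \<tau> f], symmetric])
  finally show ?thesis .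
qed

section \<open>Random fields\<close>

lemma random_field_measurable_section:
  assumes "random_field M X" "\<omega> \<in> space M"
  shows "X \<omega> \<in> borel_measurable su2_volume"
  using measurable_Pair2[OF assms(1)[unfolded random_field_def] assms(2)] by simp

lemma hcoeff_field_measurable:
  assumes "random_field M X"
  shows "(\<lambda>\<omega>. hcoeff (X \<omega>) i) \<in> borel_measurable M"
proof (cases "i \<in> hidx")
  case True
  have X: "(\<lambda>p. X (fst p) (snd p)) \<in> borel_measurable (M \<Otimes>\<^sub>M su2_volume)"
    using assms by (simp add: random_field_def case_prod_beta)
  have h: "hharm i \<in> borel_measurable su2_volume"
    by (intro borel_measurable_su2_volumeI continuous_on_hharm True)
  have "(\<lambda>p. X (fst p) (snd p) * cnj (hharm i (snd p))) \<in> borel_measurable (M \<Otimes>\<^sub>M su2_volume)"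
    by (intro borel_measurable_times X borel_measurable_cnj measurable_compose[OF measurable_snd h])
  hence "(\<lambda>\<omega>. \<integral>g. X \<omega> g * cnj (hharm i g) \<partial>su2_volume) \<in> borel_measurable M"
    by (intro su2.borel_measurable_lebesgue_integral) (simp add: case_prod_beta)
  thus ?thesis using True by (simp add: hcoeff_def)
qed simp

lemma L2_version_L2: "L2_version f \<in> L2"
  by (simp add: L2_version_def L2_zero)

text \<open>Sections of the field are measurable, so membership in \<open>L2\<close> is finiteness
  of a nonnegative integral, and that integral is measurable in the outcome by Tonelli.\<close>

lemma field_in_L2_sets:
  assumes "random_field M X"
  shows "{\<omega> \<in> space M. X \<omega> \<in> L2} \<in> sets M"
proof -
  have X[measurable]: "(\<lambda>p. X (fst p) (snd p)) \<in> borel_measurable (M \<Otimes>\<^sub>M su2_volume)"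
    using assms by (simp add: random_field_def case_prod_beta)
  have "(\<lambda>p. ennreal ((cmod (X (fst p) (snd p)))\<^sup>2)) \<in> borel_measurable (M \<Otimes>\<^sub>M su2_volume)" by measurable
  hence [measurable]: "(\<lambda>\<omega>. \<integral>\<^sup>+g. ennreal ((cmod (X \<omega> g))\<^sup>2) \<partial>su2_volume) \<in> borel_measurable M"
    by (intro su2.borel_measurable_nn_integral) (simp add: case_prod_beta)
  have "{\<omega> \<in> space M. X \<omega> \<in> L2} = {\<omega> \<in> space M. (\<integral>\<^sup>+g. ennreal ((cmod (X \<omega> g))\<^sup>2) \<partial>su2_volume) < \<infinity>}"
    using random_field_measurable_section[OF assms] by (auto simp: L2_def integrable_iff_bounded)
  thus ?thesis by simp
qed

lemma L2_version_measurable: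
  assumes X: "random_field M X"
  shows "(\<lambda>\<omega>. L2_version (X \<omega>)) \<in> M \<rightarrow>\<^sub>M L2_borel"
proof (rule measurable_L2_borelI)
  fix i
  have "hcoeff (\<lambda>_. 0) i = 0" by (simp add: hcoeff_def)
  hence "hcoeff (L2_version (X \<omega>)) i = (if X \<omega> \<in> L2 then hcoeff (X \<omega>) i else 0)" for \<omega>
    by (simp add: L2_version_def)
  thus "(\<lambda>\<omega>. hcoeff (L2_version (X \<omega>)) i) \<in> borel_measurable M"
    using hcoeff_field_measurable[OF X] field_in_L2_sets[OF X] by (simp add: measurable_If)
qed (rule L2_version_L2)

lemma hcoeff_version_measurable:
  "random_field M X \<Longrightarrow> (\<lambda>\<omega>. hcoeff (L2_version (X \<omega>))) \<in> borel_measurable M"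
  by (rule measurable_compose[OF L2_version_measurable hcoeff_measurable])

lemma random_field_translate:
  assumes X: "random_field M X" and \<tau>: "su2_translation \<tau>"
  shows "random_field M (\<lambda>\<omega> h. X \<omega> (\<tau> h))"
proof -
  have "(\<lambda>p. (fst p, \<tau> (snd p))) \<in> M \<Otimes>\<^sub>M su2_volume \<rightarrow>\<^sub>M M \<Otimes>\<^sub>M su2_volume"
    using measurable_compose[OF measurable_snd su2_translation_measurable[OF \<tau>]]
    by (intro measurable_Pair) auto
  from measurable_compose[OF this X[unfolded random_field_def]] show ?thesis
    by (simp add: random_field_def case_prod_beta)
qed

lemma proj_measurable: "(\<lambda>a. proj n a g) \<in> borel_measurable borel"
  unfolding proj_def
  by (intro borel_measurable_sum borel_measurable_times borel_measurable_coordinate borel_measurable_const)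

lemma random_field_component:
  assumes "random_field M X"
  shows "random_field M (component X n)"
proof -
  have "(\<lambda>p. \<Sum>i\<in>hdeg n. hcoeff (X (fst p)) i * hharm i (snd p)) \<in> borel_measurable (M \<Otimes>\<^sub>M su2_volume)"
    by (intro borel_measurable_sum borel_measurable_times
        measurable_compose[OF measurable_fst hcoeff_field_measurable[OF assms]]
        measurable_compose[OF measurable_snd] borel_measurable_su2_volumeI continuous_on_hharm hdeg_hidx)
  thus ?thesis by (simp add: random_field_def case_prod_beta component_eq_proj proj_def)
qed

section \<open>Laws of a field and of its components\<close>

lemma law_eq_iff:
  assumes X: "random_field M X" and Y: "random_field M Y"
  shows "law M X = law M Y \<longleftrightarrow>
    distr M borel (\<lambda>\<omega>. hcoeff (L2_version (X \<omega>))) = distr M borel (\<lambda>\<omega>. hcoeff (L2_version (Y \<omega>)))"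
proof
  assume eq: "law M X = law M Y"
  have "distr M borel (\<lambda>\<omega>. hcoeff (L2_version (Z \<omega>))) = distr (law M Z) borel hcoeff"
    if "random_field M Z" for Z
    unfolding law_def using distr_distr[OF hcoeff_measurable L2_version_measurable[OF that]]
    by (simp add: o_def)
  thus "distr M borel (\<lambda>\<omega>. hcoeff (L2_version (X \<omega>))) = distr M borel (\<lambda>\<omega>. hcoeff (L2_version (Y \<omega>)))"
    using X Y eq by simp
qed (unfold law_def, rule distr_L2_borel_eqI[OF L2_version_measurable[OF X] L2_version_measurable[OF Y]])

lemma joint_law_eq_iff:
  assumes M: "finite_measure M" and X: "\<And>i. random_field M (X i)" and Y: "\<And>i. random_field M (Y i)"
  shows "joint_law M UNIV X = joint_law M UNIV Y \<longleftrightarrow>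
    distr M (\<Pi>\<^sub>M i\<in>UNIV. borel) (\<lambda>\<omega> i. hcoeff (L2_version (X i \<omega>))) =
    distr M (\<Pi>\<^sub>M i\<in>UNIV. borel) (\<lambda>\<omega> i. hcoeff (L2_version (Y i \<omega>)))"
proof -
  have meas: "(\<lambda>\<omega> i. L2_version (Z i \<omega>)) \<in> M \<rightarrow>\<^sub>M (\<Pi>\<^sub>M i\<in>UNIV. L2_borel)"
    if "\<And>i. random_field M (Z i)" for Z :: "'i \<Rightarrow> _"
    using L2_version_measurable[OF that] by (intro measurable_PiM_single') (auto simp: L2_version_L2)
  have hm: "(\<lambda>F i. hcoeff (F i)) \<in> (\<Pi>\<^sub>M i\<in>UNIV. L2_borel) \<rightarrow>\<^sub>M (\<Pi>\<^sub>M i\<in>(UNIV :: 'i set). borel)"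
  proof (rule measurable_PiM_single')
    fix i :: 'i
    show "(\<lambda>F. hcoeff (F i)) \<in> (\<Pi>\<^sub>M i\<in>UNIV. L2_borel) \<rightarrow>\<^sub>M borel"
      by (rule measurable_compose[where f = "\<lambda>F. F i" and N = L2_borel, OF _ hcoeff_measurable])
        (rule measurable_component_singleton, simp)
  qed auto
  have "distr M (\<Pi>\<^sub>M i\<in>UNIV. borel) (\<lambda>\<omega> i. hcoeff (L2_version (Z i \<omega>))) = distr (joint_law M UNIV Z) (\<Pi>\<^sub>M i\<in>UNIV. borel) (\<lambda>F i. hcoeff (F i))"
    if "\<And>i. random_field M (Z i)" for Z :: "'i \<Rightarrow> _"
    unfolding joint_law_def using distr_distr[OF hm meas[of Z]] that by (simp add: o_def restrict_def)
  note fwd = this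
  show ?thesis
  proof
    assume "joint_law M UNIV X = joint_law M UNIV Y"
    thus "distr M (\<Pi>\<^sub>M i\<in>UNIV. borel) (\<lambda>\<omega> i. hcoeff (L2_version (X i \<omega>))) =
      distr M (\<Pi>\<^sub>M i\<in>UNIV. borel) (\<lambda>\<omega> i. hcoeff (L2_version (Y i \<omega>)))"
      by (simp only: fwd[of X, OF X] fwd[of Y, OF Y])
  next
    assume "distr M (\<Pi>\<^sub>M i\<in>UNIV. borel) (\<lambda>\<omega> i. hcoeff (L2_version (X i \<omega>))) =
      distr M (\<Pi>\<^sub>M i\<in>UNIV. borel) (\<lambda>\<omega> i. hcoeff (L2_version (Y i \<omega>)))"
    from distr_PiM_L2_borel_eqI[OF M meas[of X, OF X] meas[of Y, OF Y] this]
    show "joint_law M UNIV X = joint_law M UNIV Y" by (simp add: joint_law_def restrict_def)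
  qed
qed

text \<open>The coefficient vector of the component of degree n, in terms of that of the
  field.\<close>

definition restrict_degree :: "nat \<Rightarrow> (nat \<times> nat \<times> nat \<Rightarrow> complex) \<Rightarrow> nat \<times> nat \<times> nat \<Rightarrow> complex" where
  "restrict_degree n a i = (if i \<in> hdeg n then a i else 0)"

text \<open>Splitting a vector by degree loses nothing: entry i is recovered from the piece with
  number \<open>fst i\<close>, provided that the vector vanishes outside \<open>hidx\<close>. Both
  maps are measurable, so equality of laws passes either way.\<close>

lemma distr_restrict_degree_iff:
  fixes a b :: "'w \<Rightarrow> nat \<times> nat \<times> nat \<Rightarrow> complex"
  assumes a: "a \<in> borel_measurable M" and b: "b \<in> borel_measurable M"
    and a0: "\<And>\<omega> i. i \<notin> hidx \<Longrightarrow> a \<omega> i = 0" and b0: "\<And>\<omega> i. i \<notin> hidx \<Longrightarrow> b \<omega> i = 0"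
  shows "distr M (\<Pi>\<^sub>M n\<in>UNIV. borel) (\<lambda>\<omega> n. restrict_degree n (a \<omega>)) = distr M (\<Pi>\<^sub>M n\<in>UNIV. borel) (\<lambda>\<omega> n. restrict_degree n (b \<omega>))
    \<longleftrightarrow> distr M borel a = distr M borel b"
proof -
  let ?R = "\<lambda>a n. restrict_degree n a" and ?S = "\<lambda>(c :: nat \<Rightarrow> nat \<times> nat \<times> nat \<Rightarrow> complex) i. c (fst i) i"
  have R: "?R \<in> borel \<rightarrow>\<^sub>M (\<Pi>\<^sub>M n\<in>UNIV. borel)"
  proof (rule measurable_PiM_single')
    fix n
    show "(\<lambda>a. restrict_degree n a) \<in> borel_measurable borel"
    proof (rule borel_measurable_family)
      fix i show "(\<lambda>a. restrict_degree n a i) \<in> borel_measurable borel"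
        unfolding restrict_degree_def by (cases "i \<in> hdeg n") (simp_all add: borel_measurable_coordinate)
    qed
  qed auto
  have S: "?S \<in> (\<Pi>\<^sub>M n\<in>UNIV. borel) \<rightarrow>\<^sub>M borel"
  proof (rule borel_measurable_family)
    fix i :: "nat \<times> nat \<times> nat"
    have "(\<lambda>c :: nat \<Rightarrow> nat \<times> nat \<times> nat \<Rightarrow> complex. c (fst i)) \<in> (\<Pi>\<^sub>M n\<in>UNIV. borel) \<rightarrow>\<^sub>M borel"
      by (rule measurable_component_singleton) simp
    from measurable_compose[OF this borel_measurable_coordinate[of i]]
    show "(\<lambda>c :: nat \<Rightarrow> nat \<times> nat \<times> nat \<Rightarrow> complex. c (fst i) i) \<in> borel_measurable (\<Pi>\<^sub>M n\<in>UNIV. borel)" .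
  qed
  have SR: "?S (?R c) = c" if "\<And>i. i \<notin> hidx \<Longrightarrow> c i = 0" for c
    using that by (auto simp: restrict_degree_def hdeg_def fun_eq_iff)
  have 1: "distr M (\<Pi>\<^sub>M n\<in>UNIV. borel) (\<lambda>\<omega> n. restrict_degree n (c \<omega>)) = distr (distr M borel c) (\<Pi>\<^sub>M n\<in>UNIV. borel) ?R"
    if "c \<in> borel_measurable M" for c
    using distr_distr[OF R that] by (simp add: o_def)
  have 2: "distr M borel c = distr (distr M (\<Pi>\<^sub>M n\<in>UNIV. borel) (\<lambda>\<omega> n. restrict_degree n (c \<omega>))) borel ?S"
    if "c \<in> borel_measurable M" "\<And>\<omega> i. i \<notin> hidx \<Longrightarrow> c \<omega> i = 0" for c
    using distr_distr[OF S measurable_compose[OF that(1) R]] SR[of "c _"] that(2) by (simp add: o_def)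
  show ?thesis
  proof
    assume eq: "distr M (\<Pi>\<^sub>M n\<in>UNIV. borel) (\<lambda>\<omega> n. restrict_degree n (a \<omega>)) = distr M (\<Pi>\<^sub>M n\<in>UNIV. borel) (\<lambda>\<omega> n. restrict_degree n (b \<omega>))"
    have "distr M borel a = distr (distr M (\<Pi>\<^sub>M n\<in>UNIV. borel) (\<lambda>\<omega> n. restrict_degree n (a \<omega>))) borel ?S"
      by (rule 2[OF a a0])
    also have "\<dots> = distr M borel b" unfolding eq by (rule 2[OF b b0, symmetric])
    finally show "distr M borel a = distr M borel b" .
  next
    assume eq: "distr M borel a = distr M borel b"
    show "distr M (\<Pi>\<^sub>M n\<in>UNIV. borel) (\<lambda>\<omega> n. restrict_degree n (a \<omega>)) = distr M (\<Pi>\<^sub>M n\<in>UNIV. borel) (\<lambda>\<omega> n. restrict_degree n (b \<omega>))"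
      unfolding 1[OF a] 1[OF b] eq ..
  qed
qed

lemma AE_hcoeff_version:
  assumes "square_integrable_field M X"
  shows "AE \<omega> in M. hcoeff (L2_version (X \<omega>)) = hcoeff (X \<omega>)"
  using assms unfolding square_integrable_field_def
  by eventually_elim (simp add: L2_version_def)

lemma square_integrable_translate:
  assumes "square_integrable_field M X" "su2_translation \<tau>"
  shows "square_integrable_field M (\<lambda>\<omega> h. X \<omega> (\<tau> h))"
  using assms(1) unfolding square_integrable_field_def
  by eventually_elim (rule L2_translate[OF assms(2)])

text \<open>Both sides become statements on coefficient vectors. Fact \<open>2\<close> is where
  projection and translation are interchanged: almost surely the coefficients of the translated
  component are the degree n part of those of the translated field.\<close>

lemma law_translate_iff:
  assumes M: "prob_space M" and X: "random_field M X" and sq: "square_integrable_field M X"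
    and \<tau>: "su2_translation \<tau>"
  shows "law M (\<lambda>\<omega> h. X \<omega> (\<tau> h)) = law M X \<longleftrightarrow>
    joint_law M UNIV (\<lambda>n \<omega> h. component X n \<omega> (\<tau> h)) = joint_law M UNIV (component X)"
proof -
  interpret prob_space M by fact
  let ?Y = "\<lambda>\<omega> h. X \<omega> (\<tau> h)"
  let ?b = "\<lambda>\<omega>. hcoeff (L2_version (X \<omega>))" and ?a = "\<lambda>\<omega>. hcoeff (L2_version (?Y \<omega>))"
  note Y = random_field_translate[OF X \<tau>] and sqY = square_integrable_translate[OF sq \<tau>]
  note C = random_field_component[OF X]
  note CY = random_field_translate[OF C \<tau>]
  have hm: "(\<lambda>\<omega> n. hcoeff (L2_version (Z n \<omega>))) \<in> M \<rightarrow>\<^sub>M (\<Pi>\<^sub>M n\<in>UNIV. borel)"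
    if "\<And>n. random_field M (Z n)" for Z :: "nat \<Rightarrow> 'a \<Rightarrow> complex^2^2 \<Rightarrow> complex"
    using hcoeff_version_measurable[OF that] by (intro measurable_PiM_single') auto
  have rm: "(\<lambda>\<omega> n. restrict_degree n (hcoeff (L2_version (Z \<omega>)))) \<in> M \<rightarrow>\<^sub>M (\<Pi>\<^sub>M n\<in>UNIV. borel)"
    if "random_field M Z" for Z
  proof (rule measurable_PiM_single')
    fix n
    show "(\<lambda>\<omega>. restrict_degree n (hcoeff (L2_version (Z \<omega>)))) \<in> borel_measurable M"
    proof (rule borel_measurable_family)
      fix i
      show "(\<lambda>\<omega>. restrict_degree n (hcoeff (L2_version (Z \<omega>))) i) \<in> borel_measurable M"
        unfolding restrict_degree_def
        using measurable_compose[OF hcoeff_version_measurable[OF that] borel_measurable_coordinate[of i]]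
        by (cases "i \<in> hdeg n") simp_all
    qed
  qed auto
  have proj_version: "L2_version (proj n c) = proj n c" for n c
    by (simp add: L2_version_def proj_L2)
  have 1: "distr M (\<Pi>\<^sub>M n\<in>UNIV. borel) (\<lambda>\<omega> n. hcoeff (L2_version (component X n \<omega>)))
      = distr M (\<Pi>\<^sub>M n\<in>UNIV. borel) (\<lambda>\<omega> n. restrict_degree n (?b \<omega>))"
  proof (rule distr_cong_AE)
    show "AE \<omega> in M. (\<lambda>n. hcoeff (L2_version (component X n \<omega>))) = (\<lambda>n. restrict_degree n (?b \<omega>))"
      using AE_hcoeff_version[OF sq]
    proof eventually_elim
      fix \<omega> assume eq: "?b \<omega> = hcoeff (X \<omega>)"
      show "(\<lambda>n. hcoeff (L2_version (component X n \<omega>))) = (\<lambda>n. restrict_degree n (?b \<omega>))"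
      proof (intro ext)
        fix n i
        have "component X n \<omega> = proj n (hcoeff (X \<omega>))"
          by (rule ext) (rule component_eq_proj)
        thus "hcoeff (L2_version (component X n \<omega>)) i = restrict_degree n (?b \<omega>) i"
          by (simp add: proj_version hcoeff_proj restrict_degree_def eq)
      qed
    qed
  qed (auto intro: hm rm C X)
  have 2: "distr M (\<Pi>\<^sub>M n\<in>UNIV. borel) (\<lambda>\<omega> n. hcoeff (L2_version (\<lambda>h. component X n \<omega> (\<tau> h))))
      = distr M (\<Pi>\<^sub>M n\<in>UNIV. borel) (\<lambda>\<omega> n. restrict_degree n (?a \<omega>))"
  proof (rule distr_cong_AE)
    show "AE \<omega> in M. (\<lambda>n. hcoeff (L2_version (\<lambda>h. component X n \<omega> (\<tau> h)))) = (\<lambda>n. restrict_degree n (?a \<omega>))"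
      using AE_hcoeff_version[OF sqY] sq[unfolded square_integrable_field_def]
    proof eventually_elim
      fix \<omega> assume eq: "?a \<omega> = hcoeff (?Y \<omega>)" and L: "X \<omega> \<in> L2"
      have "hcoeff (L2_version (\<lambda>h. component X n \<omega> (\<tau> h))) = restrict_degree n (?a \<omega>)" for n
      proof -
        have C: "component X n \<omega> = proj n (hcoeff (X \<omega>))"
          by (rule ext) (rule component_eq_proj)
        have "L2_version (\<lambda>h. component X n \<omega> (\<tau> h)) = (\<lambda>h. component X n \<omega> (\<tau> h))"
          unfolding L2_version_def C using L2_translate[OF \<tau> proj_L2] by simp
        hence "hcoeff (L2_version (\<lambda>h. component X n \<omega> (\<tau> h))) = hcoeff (\<lambda>h. proj n (hcoeff (X \<omega>)) (\<tau> h))"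
          by (simp add: C)
        also have "\<dots> = hcoeff (proj n (hcoeff (?Y \<omega>)))"
          by (rule hcoeff_cong) (rule proj_translate[OF \<tau> L])
        also have "\<dots> = restrict_degree n (?a \<omega>)"
          by (simp add: hcoeff_proj restrict_degree_def eq fun_eq_iff)
        finally show ?thesis .
      qed
      thus "(\<lambda>n. hcoeff (L2_version (\<lambda>h. component X n \<omega> (\<tau> h)))) = (\<lambda>n. restrict_degree n (?a \<omega>))"
        by simp
    qed
  qed (auto intro: hm[of "\<lambda>n \<omega> h. component X n \<omega> (\<tau> h)"] rm CY Y)
  show ?thesis
    unfolding law_eq_iff[OF Y X] joint_law_eq_iff[OF finite_measure_axioms CY C] 1 2
    by (rule distr_restrict_degree_iff[symmetric])
      (auto intro: hcoeff_version_measurable X Y)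
qed

section \<open>Vanishing correlations\<close>

text \<open>Writes the value at the single point \<open>\<tau> g\<close> through the coefficients of
  the translated field, whose law invariance determines.\<close>

lemma component_translate_AE:
  assumes sq: "square_integrable_field M X" and \<tau>: "su2_translation \<tau>" and g: "g \<in> SU2"
  shows "AE \<omega> in M. component X n \<omega> (\<tau> g) = proj n (hcoeff (L2_version (\<lambda>h. X \<omega> (\<tau> h)))) g"
  using AE_hcoeff_version[OF square_integrable_translate[OF sq \<tau>]] sq[unfolded square_integrable_field_def]
  by eventually_elim (simp add: component_eq_proj proj_translate[OF \<tau> _ g])

text \<open>Both integrands are almost surely the same Borel function of coefficient vectors with
  equal laws. \<open>F\<close> is left open to cover means, products with or without conjugate, and
  also the real-valued norms that Fubini asks for.\<close>

lemma expectation_translate: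
  fixes F :: "complex \<Rightarrow> complex \<Rightarrow> 'b::{banach, second_countable_topology}"
  assumes X: "random_field M X" and sq: "square_integrable_field M X"
    and \<tau>: "su2_translation \<tau>" and inv: "law M (\<lambda>\<omega> h. X \<omega> (\<tau> h)) = law M X"
    and g: "g \<in> SU2" "g' \<in> SU2"
    and F: "(\<lambda>p. F (fst p) (snd p)) \<in> borel_measurable (borel \<Otimes>\<^sub>M borel)"
  shows "(\<integral>\<omega>. F (component X n \<omega> (\<tau> g)) (component X n' \<omega> (\<tau> g')) \<partial>M) = (\<integral>\<omega>. F (component X n \<omega> g) (component X n' \<omega> g') \<partial>M)"
    and "integrable M (\<lambda>\<omega>. F (component X n \<omega> (\<tau> g)) (component X n' \<omega> (\<tau> g'))) \<longleftrightarrow> integrable M (\<lambda>\<omega>. F (component X n \<omega> g) (component X n' \<omega> g'))"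
proof -
  let ?Y = "\<lambda>\<omega> h. X \<omega> (\<tau> h)"
  let ?b = "\<lambda>\<omega>. hcoeff (L2_version (X \<omega>))" and ?a = "\<lambda>\<omega>. hcoeff (L2_version (?Y \<omega>))"
  let ?H = "\<lambda>c. F (proj n c g) (proj n' c g')"
  note Y = random_field_translate[OF X \<tau>]
  note a = hcoeff_version_measurable[OF Y] and b = hcoeff_version_measurable[OF X]
  have H: "?H \<in> borel_measurable borel"
    using measurable_compose[OF measurable_Pair[OF proj_measurable[of n g] proj_measurable[of n' g']] F] by simp
  have eq: "distr M borel ?a = distr M borel ?b"
    using inv law_eq_iff[OF Y X] by simp
  have comp_meas: "(\<lambda>\<omega>. component X n \<omega> g) \<in> borel_measurable M" if "g \<in> SU2" for n g
    using measurable_compose[OF measurable_Pair1'[of g su2_volume M] ] random_field_component[OF X, of n] that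
    unfolding random_field_def by (auto dest: measurable_Pair1)
  have Fm: "(\<lambda>\<omega>. F (component X n \<omega> u) (component X n' \<omega> v)) \<in> borel_measurable M" if "u \<in> SU2" "v \<in> SU2" for u v
    using measurable_compose[OF measurable_Pair[OF comp_meas[OF that(1)] comp_meas[OF that(2)]] F] by simp
  have AEa: "AE \<omega> in M. F (component X n \<omega> (\<tau> g)) (component X n' \<omega> (\<tau> g')) = ?H (?a \<omega>)"
    using component_translate_AE[OF sq \<tau> g(1), of n] component_translate_AE[OF sq \<tau> g(2), of n']
    by eventually_elim simp
  have AEb: "AE \<omega> in M. F (component X n \<omega> g) (component X n' \<omega> g') = ?H (?b \<omega>)"
    using AE_hcoeff_version[OF sq] by eventually_elim (simp add: component_eq_proj)
  note \<tau>g = su2_translation_SU2[OF \<tau> g(1)] su2_translation_SU2[OF \<tau> g(2)]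
  have Ha: "(\<lambda>\<omega>. ?H (?a \<omega>)) \<in> borel_measurable M" and Hb: "(\<lambda>\<omega>. ?H (?b \<omega>)) \<in> borel_measurable M"
    using measurable_compose[OF a H] measurable_compose[OF b H] by auto
  have "(\<integral>\<omega>. F (component X n \<omega> (\<tau> g)) (component X n' \<omega> (\<tau> g')) \<partial>M) = (\<integral>\<omega>. ?H (?a \<omega>) \<partial>M)"
    by (rule integral_cong_AE[OF Fm[OF \<tau>g] Ha AEa])
  also have "\<dots> = (\<integral>c. ?H c \<partial>distr M borel ?a)" by (rule integral_distr[OF a H, symmetric])
  also have "\<dots> = (\<integral>\<omega>. ?H (?b \<omega>) \<partial>M)" unfolding eq by (rule integral_distr[OF b H])
  also have "\<dots> = (\<integral>\<omega>. F (component X n \<omega> g) (component X n' \<omega> g') \<partial>M)"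
    by (rule integral_cong_AE[OF Fm[OF g] Hb AEb, symmetric])
  finally show "(\<integral>\<omega>. F (component X n \<omega> (\<tau> g)) (component X n' \<omega> (\<tau> g')) \<partial>M) = (\<integral>\<omega>. F (component X n \<omega> g) (component X n' \<omega> g') \<partial>M)" .
  have "integrable M (\<lambda>\<omega>. F (component X n \<omega> (\<tau> g)) (component X n' \<omega> (\<tau> g'))) \<longleftrightarrow> integrable M (\<lambda>\<omega>. ?H (?a \<omega>))"
    by (rule integrable_cong_AE[OF Fm[OF \<tau>g] Ha AEa])
  also have "\<dots> \<longleftrightarrow> integrable (distr M borel ?a) ?H" by (rule integrable_distr_eq[OF a H, symmetric])
  also have "\<dots> \<longleftrightarrow> integrable M (\<lambda>\<omega>. ?H (?b \<omega>))" unfolding eq by (rule integrable_distr_eq[OF b H])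
  also have "\<dots> \<longleftrightarrow> integrable M (\<lambda>\<omega>. F (component X n \<omega> g) (component X n' \<omega> g'))"
    by (rule integrable_cong_AE[OF Fm[OF g] Hb AEb, symmetric])
  finally show "integrable M (\<lambda>\<omega>. F (component X n \<omega> (\<tau> g)) (component X n' \<omega> (\<tau> g'))) \<longleftrightarrow> integrable M (\<lambda>\<omega>. F (component X n \<omega> g) (component X n' \<omega> g'))" .
qed

text \<open>By invariance the expectation equals its average over the group, and by Fubini the average may be
  taken inside. If the integrand is not integrable, the Bochner integral is \<open>0\<close> by convention.\<close>

lemma expectation_eq_0:
  fixes F :: "complex \<Rightarrow> complex \<Rightarrow> complex"
  assumes M: "prob_space M" and X: "random_field M X" and sq: "square_integrable_field M X"
    and t: "\<And>k. k \<in> SU2 \<Longrightarrow> su2_translation (t k)"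
    and t_meas: "\<And>g. g \<in> SU2 \<Longrightarrow> (\<lambda>k. t k g) \<in> su2_volume \<rightarrow>\<^sub>M su2_volume"
    and inv: "\<And>k. k \<in> SU2 \<Longrightarrow> law M (\<lambda>\<omega> h. X \<omega> (t k h)) = law M X"
    and g: "g \<in> SU2" "g' \<in> SU2"
    and F: "(\<lambda>p. F (fst p) (snd p)) \<in> borel_measurable (borel \<Otimes>\<^sub>M borel)"
    and zero: "\<And>a. (\<integral>k. F (proj n a (t k g)) (proj n' a (t k g')) \<partial>su2_volume) = 0"
  shows "(\<integral>\<omega>. F (component X n \<omega> g) (component X n' \<omega> g') \<partial>M) = 0"
proof (cases "integrable M (\<lambda>\<omega>. F (component X n \<omega> g) (component X n' \<omega> g'))")
  case True
  interpret prob_space M by fact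
  interpret P: pair_sigma_finite su2_volume M
    by (intro pair_sigma_finite.intro su2.sigma_finite_measure_axioms sigma_finite_measure_axioms)
  let ?Q = "\<lambda>k \<omega>. F (component X n \<omega> (t k g)) (component X n' \<omega> (t k g'))"
  have comp: "(\<lambda>p. component X n (snd p) (t (fst p) g)) \<in> borel_measurable (su2_volume \<Otimes>\<^sub>M M)" if "g \<in> SU2" for n g
  proof -
    have "(\<lambda>p. (snd p, t (fst p) g)) \<in> su2_volume \<Otimes>\<^sub>M M \<rightarrow>\<^sub>M M \<Otimes>\<^sub>M su2_volume"
      using measurable_compose[OF measurable_fst t_meas[OF that]] by (intro measurable_Pair) auto
    from measurable_compose[OF this random_field_component[OF X, of n, unfolded random_field_def]]
    show ?thesis by simp
  qed
  have Q: "case_prod ?Q \<in> borel_measurable (su2_volume \<Otimes>\<^sub>M M)"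
    using measurable_compose[OF measurable_Pair[OF comp[OF g(1)] comp[OF g(2)]] F]
    by (simp add: case_prod_beta)
  have Fn: "(\<lambda>p. cmod (F (fst p) (snd p))) \<in> borel_measurable (borel \<Otimes>\<^sub>M borel)"
    by (rule measurable_compose[OF F borel_measurable_norm])
  have "integrable (su2_volume \<Otimes>\<^sub>M M) (case_prod ?Q)"
  proof (rule P.Fubini_integrable[OF Q])
    \<comment> \<open>By invariance the inner integral does not depend on k, and a constant is
      integrable over a finite volume.\<close>
    have "integrable su2_volume (\<lambda>k. \<integral>\<omega>. cmod (?Q k \<omega>) \<partial>M) \<longleftrightarrow>
        integrable su2_volume (\<lambda>k. \<integral>\<omega>. cmod (F (component X n \<omega> g) (component X n' \<omega> g')) \<partial>M)"
      using expectation_translate(1)[OF X sq t inv g Fn]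
      by (intro Bochner_Integration.integrable_cong) auto
    thus "integrable su2_volume (\<lambda>k. \<integral>\<omega>. norm (case (k, \<omega>) of (k, \<omega>) \<Rightarrow> ?Q k \<omega>) \<partial>M)" by simp
    show "AE k in su2_volume. integrable M (\<lambda>\<omega>. case (k, \<omega>) of (k, \<omega>) \<Rightarrow> ?Q k \<omega>)"
      using expectation_translate(2)[OF X sq t inv g F] True by (intro AE_I2) simp
  qed
  from P.Fubini_integral[OF this]
  have "(\<integral>k. (\<integral>\<omega>. ?Q k \<omega> \<partial>M) \<partial>su2_volume) = (\<integral>\<omega>. (\<integral>k. ?Q k \<omega> \<partial>su2_volume) \<partial>M)" ..
  \<comment> \<open>For every single outcome both components come from one coefficient vector, so
    \<open>zero\<close> applies to the inner average.\<close>
  also have "\<dots> = 0" by (simp add: component_eq_proj zero)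
  also have "(\<integral>k. (\<integral>\<omega>. ?Q k \<omega> \<partial>M) \<partial>su2_volume) = (\<integral>k. (\<integral>\<omega>. F (component X n \<omega> g) (component X n' \<omega> g') \<partial>M) \<partial>su2_volume)"
    by (rule Bochner_Integration.integral_cong[OF refl]) (simp add: expectation_translate(1)[OF X sq t inv g F])
  \<comment> \<open>The integrand is constant on the group, so the volume times the expectation is
    0.\<close>
  finally show ?thesis by (simp add: measure_su2_volume)
qed (rule not_integrable_integral_eq)

section \<open>Orthogonality of translated components\<close>

lemma proj_orthogonal:
  assumes "n \<noteq> n'"
  shows "(\<integral>g. proj n a g * cnj (proj n' b g) \<partial>su2_volume) = 0"
proof -
  have "(\<integral>g. proj n a g * cnj (proj n' b g) \<partial>su2_volume) = (\<integral>g. (\<Sum>i\<in>hdeg n'. cnj (b i) * (proj n a g * cnj (hharm i g))) \<partial>su2_volume)"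
    by (simp add: proj_def[of n'] sum_distrib_left mult_ac)
  also have "\<dots> = (\<Sum>i\<in>hdeg n'. \<integral>g. cnj (b i) * (proj n a g * cnj (hharm i g)) \<partial>su2_volume)"
    by (intro Bochner_Integration.integral_sum integrable_mult_right integrable_L2_mult L2_hharm hdeg_hidx proj_L2)
  also have "\<dots> = (\<Sum>i\<in>hdeg n'. cnj (b i) * hcoeff (proj n a) i)"
    by (intro sum.cong refl) (simp add: hcoeff_def hdeg_hidx)
  also have "\<dots> = 0"
    unfolding hcoeff_proj using assms by (intro sum.neutral) (auto simp: hdeg_def)
  finally show ?thesis .
qed

text \<open>Turns a product without conjugate into an inner product of the same two degrees, so that
  one orthogonality relation serves both equations in \<open>uncorrelated\<close>.\<close>

lemma cnj_proj: "\<exists>b. \<forall>g. cnj (proj n a g) = proj n b g"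
proof (intro exI allI)
  fix g
  have "cnj (proj n a g) = (\<Sum>m\<le>n. \<Sum>s\<le>n. cnj (a (n, m, s)) * (-1) ^ (m + s) * hharm (n, n - m, n - s) g)"
    unfolding proj_def sum_hdeg cnj_sum
    by (intro sum.cong refl) (simp add: hharm_wigner cnj_wigner)
  also have "\<dots> = (\<Sum>m\<le>n. \<Sum>s\<le>n. cnj (a (n, n - m, n - s)) * (-1) ^ ((n - m) + (n - s)) * hharm (n, m, s) g)"
    by (rule sum.reindex_bij_witness[of _ "\<lambda>m. n - m" "\<lambda>m. n - m"])
      (auto intro!: sum.reindex_bij_witness[of _ "\<lambda>m. n - m" "\<lambda>m. n - m"])
  also have "\<dots> = proj n (\<lambda>(k, m, s). cnj (a (n, n - m, n - s)) * (-1) ^ ((n - m) + (n - s))) g"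
    unfolding proj_def sum_hdeg split_conv ..
  finally show "cnj (proj n a g) = \<dots>" .
qed

text \<open>Makes the integral of a component an inner product with degree 0. The harmonic of degree
  0 is the constant \<open>1 / (4 * pi)\<close>.\<close>

lemma proj_const: "\<exists>b. \<forall>g. proj 0 b g = 1"
proof (intro exI allI)
  fix g :: "complex^2^2"
  have "wigner_D 0 0 0 g = 1" by (simp add: wigner_coeff)
  thus "proj 0 (\<lambda>_. of_real (4 * pi)) g = 1"
    by (simp add: proj_def sum_hdeg hharm_wigner)
qed

text \<open>As a function of the moving factor k this is a translate, from the other side, of an
  element of the degree n space, and translations map that space into itself.\<close>

lemma proj_orbit:
  assumes "g \<in> SU2"
  shows "\<exists>b. \<forall>k\<in>SU2. proj n a (k ** g) = proj n b k" "\<exists>b. \<forall>k\<in>SU2. proj n a (g ** k) = proj n b k"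
proof -
  have "proj n a (k ** g) = proj n (hcoeff (\<lambda>h. proj n a (h ** g))) k" if "k \<in> SU2" for k
    using proj_translate[OF su2_translation_right[OF assms] proj_L2 that, of n n a]
    by (simp only: proj_hcoeff_proj)
  thus "\<exists>b. \<forall>k\<in>SU2. proj n a (k ** g) = proj n b k" by blast
  have "proj n a (g ** k) = proj n (hcoeff (\<lambda>h. proj n a (g ** h))) k" if "k \<in> SU2" for k
    using proj_translate[OF su2_translation_left[OF assms] proj_L2 that, of n n a]
    by (simp only: proj_hcoeff_proj)
  thus "\<exists>b. \<forall>k\<in>SU2. proj n a (g ** k) = proj n b k" by blast
qed

text \<open>The orbit maps k \<mapsto> \<open>t k g\<close> preserve degrees, so the integrals
  reduce to inner products of different degrees, the constant 1 having degree 0.\<close>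

lemma translates_orthogonal:
  assumes orbit: "\<forall>n a. \<forall>g\<in>SU2. \<exists>b. \<forall>k\<in>SU2. proj n a (t k g) = proj n b k"
    and g: "g \<in> SU2" "g' \<in> SU2"
  shows "n \<noteq> n' \<Longrightarrow> (\<integral>k. proj n a (t k g) * proj n' a' (t k g') \<partial>su2_volume) = 0"
    and "n \<noteq> n' \<Longrightarrow> (\<integral>k. proj n a (t k g) * cnj (proj n' a' (t k g')) \<partial>su2_volume) = 0"
    and "n \<noteq> 0 \<Longrightarrow> (\<integral>k. proj n a (t k g) \<partial>su2_volume) = 0"
proof -
  obtain b where b: "\<And>k. k \<in> SU2 \<Longrightarrow> proj n a (t k g) = proj n b k" using orbit g(1) by metis
  obtain b' where b': "\<And>k. k \<in> SU2 \<Longrightarrow> proj n' a' (t k g') = proj n' b' k" using orbit g(2) by metis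
  obtain c where c: "\<And>k. cnj (proj n' b' k) = proj n' c k" using cnj_proj by metis
  obtain u where u: "\<And>k. proj 0 u k = 1" using proj_const by metis
  show "(\<integral>k. proj n a (t k g) * proj n' a' (t k g') \<partial>su2_volume) = 0" if "n \<noteq> n'"
  proof -
    have "(\<integral>k. proj n a (t k g) * proj n' a' (t k g') \<partial>su2_volume) = (\<integral>k. proj n b k * cnj (proj n' c k) \<partial>su2_volume)"
      by (intro Bochner_Integration.integral_cong refl) (simp add: b b' c[symmetric])
    thus ?thesis using proj_orthogonal[OF that] by simp
  qed
  show "(\<integral>k. proj n a (t k g) * cnj (proj n' a' (t k g')) \<partial>su2_volume) = 0" if "n \<noteq> n'"
  proof -
    have "(\<integral>k. proj n a (t k g) * cnj (proj n' a' (t k g')) \<partial>su2_volume) = (\<integral>k. proj n b k * cnj (proj n' b' k) \<partial>su2_volume)"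
      by (intro Bochner_Integration.integral_cong refl) (simp add: b b')
    thus ?thesis using proj_orthogonal[OF that] by simp
  qed
  show "(\<integral>k. proj n a (t k g) \<partial>su2_volume) = 0" if "n \<noteq> 0"
  proof -
    have "(\<integral>k. proj n a (t k g) \<partial>su2_volume) = (\<integral>k. proj n b k * cnj (proj 0 u k) \<partial>su2_volume)"
      by (intro Bochner_Integration.integral_cong refl) (simp add: b u)
    thus ?thesis using proj_orthogonal[OF that] by simp
  qed
qed

text \<open>All sides of the two equations are 0: the mixed moments by orthogonality, the products
  of means because one of two different degrees is positive and its mean vanishes.\<close>

lemma uncorrelated_components:
  assumes M: "prob_space M" and X: "random_field M X" and sq: "square_integrable_field M X"
    and t: "\<And>k. k \<in> SU2 \<Longrightarrow> su2_translation (t k)"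
    and t_meas: "\<And>g. g \<in> SU2 \<Longrightarrow> (\<lambda>k. t k g) \<in> su2_volume \<rightarrow>\<^sub>M su2_volume"
    and inv: "\<And>k. k \<in> SU2 \<Longrightarrow> law M (\<lambda>\<omega> h. X \<omega> (t k h)) = law M X"
    and orbit: "\<forall>n a. \<forall>g\<in>SU2. \<exists>b. \<forall>k\<in>SU2. proj n a (t k g) = proj n b k"
    and n: "n \<noteq> n'"
  shows "uncorrelated M (component X n) (component X n')"
  unfolding uncorrelated_def
proof (intro ballI conjI)
  fix g g' assume g: "g \<in> SU2" "g' \<in> SU2"
  have E0: "(\<integral>\<omega>. F (component X n \<omega> g) (component X n' \<omega> g') \<partial>M) = 0"
    if "g \<in> SU2" "g' \<in> SU2" "(\<lambda>p. F (fst p) (snd p)) \<in> borel_measurable (borel \<Otimes>\<^sub>M borel)"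
      "\<And>a. (\<integral>k. F (proj n a (t k g)) (proj n' a (t k g')) \<partial>su2_volume) = 0"
    for F :: "complex \<Rightarrow> complex \<Rightarrow> complex" and n n' g g'
    by (rule expectation_eq_0[where t = t]) (fact M X sq t t_meas inv that)+
  note orth = translates_orthogonal[OF orbit]
  have fst_m: "(\<lambda>p. fst p :: complex) \<in> borel_measurable (borel \<Otimes>\<^sub>M (borel :: complex measure))"
    and snd_m: "(\<lambda>p. snd p :: complex) \<in> borel_measurable ((borel :: complex measure) \<Otimes>\<^sub>M borel)" by auto
  \<comment> \<open>\<open>F\<close> ignores its second argument here, so n' and g' are filled in
    arbitrarily.\<close>
  have mean: "(\<integral>\<omega>. component X k \<omega> h \<partial>M) = 0" if "k \<noteq> 0" "h \<in> SU2" for k h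
    by (rule E0[where F = "\<lambda>u v. u" and n' = k and g' = h, OF that(2) that(2) fst_m])
      (rule orth(3)[OF that(2) that(2) that(1)])
  have "n \<noteq> 0 \<or> n' \<noteq> 0" using n by auto
  hence prod0: "(\<integral>\<omega>. component X n \<omega> g \<partial>M) = 0 \<or> (\<integral>\<omega>. component X n' \<omega> g' \<partial>M) = 0"
    using mean g by blast
  have "(\<integral>\<omega>. component X n \<omega> g * component X n' \<omega> g' \<partial>M) = 0"
    by (rule E0[where F = "\<lambda>u v. u * v", OF g borel_measurable_times[OF fst_m snd_m]]) (rule orth(1)[OF g n])
  thus "(\<integral>\<omega>. component X n \<omega> g * component X n' \<omega> g' \<partial>M) = (\<integral>\<omega>. component X n \<omega> g \<partial>M) * (\<integral>\<omega>. component X n' \<omega> g' \<partial>M)"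
    using prod0 by auto
  have "(\<integral>\<omega>. component X n \<omega> g * cnj (component X n' \<omega> g') \<partial>M) = 0"
    by (rule E0[where F = "\<lambda>u v. u * cnj v", OF g borel_measurable_times[OF fst_m borel_measurable_cnj[OF snd_m]]])
      (rule orth(2)[OF g n])
  thus "(\<integral>\<omega>. component X n \<omega> g * cnj (component X n' \<omega> g') \<partial>M) = (\<integral>\<omega>. component X n \<omega> g \<partial>M) * cnj (\<integral>\<omega>. component X n' \<omega> g' \<partial>M)"
    using prod0 by auto
qed

section \<open>The three families of translations and the conclusion\<close>

lemma left_translations_eq: "left_translations = {\<lambda>h. k ** h | k. k \<in> SU2}"
proof (intro equalityI subsetI)
  fix \<tau> :: "complex^2^2 \<Rightarrow> complex^2^2"
  assume "\<tau> \<in> {\<lambda>h. k ** h | k. k \<in> SU2}"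
  then obtain k where k: "k \<in> SU2" "\<tau> = (\<lambda>h. k ** h)" by blast
  hence "\<tau> = (\<lambda>h. matrix_inv (matrix_inv k) ** h)" by (simp add: SU2_inv(4))
  thus "\<tau> \<in> left_translations" unfolding left_translations_def using SU2_inv(1)[OF k(1)] by blast
qed (auto simp: left_translations_def SU2_inv(1))

lemma translations_subset:
  "left_translations \<subseteq> Collect su2_translation" "right_translations \<subseteq> Collect su2_translation"
  "bi_translations \<subseteq> Collect su2_translation"
proof -
  show "left_translations \<subseteq> Collect su2_translation"
    using su2_translation_left by (auto simp: left_translations_eq)
  show "right_translations \<subseteq> Collect su2_translation"
    using su2_translation_right by (auto simp: right_translations_def)
  show "bi_translations \<subseteq> Collect su2_translation"
  proof
    fix \<tau> assume "\<tau> \<in> bi_translations"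
    then obtain g g' where "g \<in> SU2" "g' \<in> SU2" "\<tau> = (\<lambda>h. matrix_inv g ** h ** g')"
      unfolding bi_translations_def by blast
    thus "\<tau> \<in> Collect su2_translation" using SU2_inv(1) unfolding su2_translation_def by blast
  qed
qed

text \<open>Taking the identity as right factor; bi-invariant fields thereby inherit the result on
  correlations from left-invariant ones.\<close>

lemma left_subset_bi: "left_translations \<subseteq> bi_translations"
proof
  fix \<tau> assume "\<tau> \<in> left_translations"
  then obtain g where g: "g \<in> SU2" "\<tau> = (\<lambda>h. matrix_inv g ** h)" by (auto simp: left_translations_def)
  have "\<tau> = (\<lambda>h. matrix_inv g ** h ** mat 1)" by (simp add: g(2))
  thus "\<tau> \<in> bi_translations" using g(1) SU2_one unfolding bi_translations_def by blast
qed

theorem theorem2: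
  fixes M :: "'w measure" and X :: "'w \<Rightarrow> complex^2^2 \<Rightarrow> complex"
  assumes "prob_space M"
    and "random_field M X"
    and "square_integrable_field M X"
  shows "(invariant left_translations M X \<longleftrightarrow>
            jointly_invariant left_translations M UNIV (component X)) \<and>
         (invariant right_translations M X \<longleftrightarrow>
            jointly_invariant right_translations M UNIV (component X)) \<and>
         (invariant bi_translations M X \<longleftrightarrow>
            jointly_invariant bi_translations M UNIV (component X)) \<and>
         (invariant left_translations M X \<or> invariant right_translations M X \<or>
            invariant bi_translations M X \<longrightarrow>
            (\<forall>n n'. n \<noteq> n' \<longrightarrow> uncorrelated M (component X n) (component X n')))"
proof -
  note M = assms(1) and X = assms(2) and sq = assms(3)
  have iff: "invariant T M X \<longleftrightarrow> jointly_invariant T M UNIV (component X)"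
    if "T \<subseteq> Collect su2_translation" for T
    unfolding invariant_def jointly_invariant_def
    using law_translate_iff[OF M X sq] that by (intro ball_cong refl) auto
  have left: "uncorrelated M (component X n) (component X n')"
    if inv: "invariant left_translations M X" and n: "n \<noteq> n'" for n n'
  proof (rule uncorrelated_components[OF M X sq _ _ _ _ n, where t = "\<lambda>k h. k ** h"])
    show "law M (\<lambda>\<omega> h. X \<omega> (k ** h)) = law M X" if "k \<in> SU2" for k
    proof -
      have "(\<lambda>h. k ** h) \<in> left_translations" using that by (auto simp: left_translations_eq)
      from bspec[OF inv[unfolded invariant_def] this] show ?thesis .
    qed
    show "su2_translation (\<lambda>h. k ** h)" if "k \<in> SU2" for k
      by (rule su2_translation_left[OF that])
    \<comment> \<open>As a function of the translating element k, left translation evaluated at g is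
      right multiplication by g; hence the facts for the opposite side.\<close>
    show "(\<lambda>k. k ** g) \<in> su2_volume \<rightarrow>\<^sub>M su2_volume" if "g \<in> SU2" for g
      by (rule translation_measurable(2)[OF that])
    show "\<forall>n a. \<forall>g\<in>SU2. \<exists>b. \<forall>k\<in>SU2. proj n a (k ** g) = proj n b k"
      by (intro allI ballI proj_orbit(1))
  qed
  have right: "uncorrelated M (component X n) (component X n')"
    if inv: "invariant right_translations M X" and n: "n \<noteq> n'" for n n'
  proof (rule uncorrelated_components[OF M X sq _ _ _ _ n, where t = "\<lambda>k h. h ** k"])
    show "law M (\<lambda>\<omega> h. X \<omega> (h ** k)) = law M X" if "k \<in> SU2" for k
    proof -
      have "(\<lambda>h. h ** k) \<in> right_translations" using that by (auto simp: right_translations_def)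
      from bspec[OF inv[unfolded invariant_def] this] show ?thesis .
    qed
    show "su2_translation (\<lambda>h. h ** k)" if "k \<in> SU2" for k
      by (rule su2_translation_right[OF that])
    show "(\<lambda>k. g ** k) \<in> su2_volume \<rightarrow>\<^sub>M su2_volume" if "g \<in> SU2" for g
      by (rule translation_measurable(1)[OF that])
    show "\<forall>n a. \<forall>g\<in>SU2. \<exists>b. \<forall>k\<in>SU2. proj n a (g ** k) = proj n b k"
      by (intro allI ballI proj_orbit(2))
  qed
  have bi: "invariant left_translations M X" if "invariant bi_translations M X"
    using bspec[OF that[unfolded invariant_def]] left_subset_bi unfolding invariant_def by auto
  show ?thesis
    using left right bi
    by (intro conjI iff translations_subset impI allI) (elim disjE; simp)
qed

end
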